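(* Let $\Lambda$ be a $\lambda$-synchronizing subshift over a finite alphabet $\Sigma$. Assume that $\Lambda$ is homeomorphic to a Cantor discontinuum (Cantor set). If $\Lambda$ is synchronizingly transitive, then the $C^*$-algebra $\mathcal{O}_{\lambda(\Lambda)}$ associated with the $\lambda$-synchronizing $\lambda$-graph system $\mathfrak{L}^{\lambda(\Lambda)}$ for $\Lambda$ is simple.
   Context: **Subshifts.** $\Sigma$ is a finite set with the discrete topology, and a subshift $\Lambda$ over $\Sigma$ is a closed subset of $\Sigma^{\mathbb{Z}}$ with $\sigma(\Lambda)=\Lambda$, where $\sigma((x_i)_i)=(x_{i+1})_i$. $B_l(\Lambda)$ is the set of words of length $l$ appearing in $\Lambda$, $B_0(\Lambda)=\{\emptyset\}$ (the empty word), $B_*(\Lambda)=\bigcup_{l\ge 0}B_l(\Lambda)$. For $\mu\in B_*(\Lambda)$ and $l\in\mathbb{Z}_+=\{0,1,2,\dots\}$ put $\Gamma_l^-(\mu)=\{\nu\in B_l(\Lambda): \nu\mu\in B_*(\Lambda)\}$, $\Gamma_l^+(\mu)=\{\omega\in B_l(\Lambda):\mu\omega\in B_*(\Lambda)\}$, $\Gamma_*^+(\mu)=\bigcup_{l\ge0}\Gamma_l^+(\mu)$. A word $\mu\in B_*(\Lambda)$ is $l$-synchronizing if $\Gamma_l^-(\mu)=\Gamma_l^-(\mu\omega)$ for all $\omega\in\Gamma_*^+(\mu)$; $S_l(\Lambda)$ is the set of $l$-synchronizing words. $\Lambda$ is *$\lambda$-synchronizing* if it is irreducible (for all $\mu,\nu\in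 B_*(\Lambda)$ there is $\eta$ with $\mu\eta\nu\in B_*(\Lambda)$) and for every $\eta\in B_l(\Lambda)$ and $k\ge l$ there exists $\nu\in S_k(\Lambda)$ such that $\eta\nu\in S_{k-l}(\Lambda)$. **Synchronizing transitivity.** For $\mu,\nu\in B_*(\Lambda)$ write $\mu\succ\nu$ if there exists $\eta\in B_*(\Lambda)$ such that $\Gamma_*^+(\nu)=\Gamma_*^+(\mu\eta\nu)$ (in particular $\mu\eta\nu\in B_*(\Lambda)$). A $\lambda$-synchronizing subshift $\Lambda$ is *synchronizingly transitive* if for any two words $\mu,\nu\in B_*(\Lambda)$ both $\mu\succ\nu$ and $\nu\succ\mu$ hold. **The $\lambda$-graph system $\mathfrak{L}^{\lambda(\Lambda)}$.** Two words $\mu,\nu$ are $l$-past equivalent if $\Gamma_l^-(\mu)=\Gamma_l^-(\nu)$. The vertex set $V_l=\{v_1^l,\dots,v_{m(l)}^l\}$ at level $l\in\mathbb{Z}_+$ is the (finite) set of $l$-past equivalence classes $[\mu]_l$ of words $\mu\in S_l(\Lambda)$. For each $\nu\in S_{l+1}(\Lambda)$ and each symbol $\alpha\in\Gamma_1^-(\nu)$ there is one edge labeled $\alpha$ from $[\alpha\nu]_l\in V_l$ to $[\nu]_{l+1}\in V_{l+1}$ (depending only on $[\nu]_{l+1}$ and $\alpha$). The map $\iota:V_{l+1}\to V_l$ is $\iota([\mu]_{l+1})=[\mu]_l$. **The $C^*$-algebra $\mathcal{O}_{\lambda(\Lambda)}$.** Put $A_{l,l+1}(i,\alpha,j)=1$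 if there is an edge labeled $\alpha$ from $v_i^l$ to $v_j^{l+1}$, and $0$ otherwise; $I_{l,l+1}(i,j)=1$ if $\iota(v_j^{l+1})=v_i^l$, and $0$ otherwise. $\mathcal{O}_{\lambda(\Lambda)}$ is the universal unital $C^*$-algebra generated by partial isometries $S_\alpha$ ($\alpha\in\Sigma$) and projections $E_i^l$ ($1\le i\le m(l)$, $l\in\mathbb{Z}_+$) subject to $\sum_{\beta\in\Sigma}S_\beta S_\beta^*=1$; $\sum_{i=1}^{m(l)}E_i^l=1$; $E_i^l=\sum_{j}I_{l,l+1}(i,j)E_j^{l+1}$; $S_\alpha S_\alpha^*E_i^l=E_i^lS_\alpha S_\alpha^*$; $S_\alpha^*E_i^lS_\alpha=\sum_jA_{l,l+1}(i,\alpha,j)E_j^{l+1}$. *)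

theory Defs
  imports
    "HOL-Analysis.Analysis"
    "HOL-Algebra.Ideal"
    "HOL-Algebra.Module"
    "HOL-Library.Poly_Mapping"
begin

section \<open>Subshifts\<close>

definition shift_map :: "(int \<Rightarrow> 'a) \<Rightarrow> int \<Rightarrow> 'a" where
  "shift_map x = (\<lambda>i. x (i + 1))"

definition full_shift :: "(int \<Rightarrow> 'a) topology" where
  "full_shift = product_topology (\<lambda>_. discrete_topology UNIV) UNIV"

definition subshift :: "(int \<Rightarrow> 'a::finite) set \<Rightarrow> bool" where
  "subshift \<Lambda> \<longleftrightarrow> closedin full_shift \<Lambda> \<and> shift_map ` \<Lambda> = \<Lambda>"

definition cantor_space :: "(nat \<Rightarrow> bool) topology" where
  "cantor_space = product_topology (\<lambda>_. discrete_topology UNIV) UNIV"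

definition words :: "(int \<Rightarrow> 'a) set \<Rightarrow> 'a list set" where
  "words \<Lambda> = {w. \<exists>x\<in>\<Lambda>. \<exists>k. \<forall>i<length w. w ! i = x (k + int i)}"

definition words_of_length :: "(int \<Rightarrow> 'a) set \<Rightarrow> nat \<Rightarrow> 'a list set" where
  "words_of_length \<Lambda> l = {w \<in> words \<Lambda>. length w = l}"

definition predecessors :: "(int \<Rightarrow> 'a) set \<Rightarrow> nat \<Rightarrow> 'a list \<Rightarrow> 'a list set" where
  "predecessors \<Lambda> l \<mu> = {\<nu> \<in> words_of_length \<Lambda> l. \<nu> @ \<mu> \<in> words \<Lambda>}"

definition followers :: "(int \<Rightarrow> 'a) set \<Rightarrow> 'a list \<Rightarrow> 'a list set" where
  "followers \<Lambda> \<mu> = {\<omega> \<in> words \<Lambda>. \<mu> @ \<omega> \<in> words \<Lambda>}"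

definition synchronizing_words :: "(int \<Rightarrow> 'a) set \<Rightarrow> nat \<Rightarrow> 'a list set" where
  "synchronizing_words \<Lambda> l =
     {\<mu> \<in> words \<Lambda>. \<forall>\<omega>\<in>followers \<Lambda> \<mu>. predecessors \<Lambda> l \<mu> = predecessors \<Lambda> l (\<mu> @ \<omega>)}"

definition irreducible_subshift :: "(int \<Rightarrow> 'a) set \<Rightarrow> bool" where
  "irreducible_subshift \<Lambda> \<longleftrightarrow>
     (\<forall>\<mu>\<in>words \<Lambda>. \<forall>\<nu>\<in>words \<Lambda>. \<exists>\<eta>. \<mu> @ \<eta> @ \<nu> \<in> words \<Lambda>)"

definition lambda_synchronizing :: "(int \<Rightarrow> 'a) set \<Rightarrow> bool" where
  "lambda_synchronizing \<Lambda> \<longleftrightarrow> irreducible_subshift \<Lambda> \<and>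
     (\<forall>l. \<forall>\<eta>\<in>words_of_length \<Lambda> l. \<forall>k\<ge>l.
        \<exists>\<nu>\<in>synchronizing_words \<Lambda> k. \<eta> @ \<nu> \<in> synchronizing_words \<Lambda> (k - l))"

definition synchronizes_to :: "(int \<Rightarrow> 'a) set \<Rightarrow> 'a list \<Rightarrow> 'a list \<Rightarrow> bool" where
  "synchronizes_to \<Lambda> \<mu> \<nu> \<longleftrightarrow>
     (\<exists>\<eta>\<in>words \<Lambda>. \<mu> @ \<eta> @ \<nu> \<in> words \<Lambda> \<and> followers \<Lambda> \<nu> = followers \<Lambda> (\<mu> @ \<eta> @ \<nu>))"

definition synchronizingly_transitive :: "(int \<Rightarrow> 'a) set \<Rightarrow> bool" where
  "synchronizingly_transitive \<Lambda> \<longleftrightarrow>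
     (\<forall>\<mu>\<in>words \<Lambda>. \<forall>\<nu>\<in>words \<Lambda>. synchronizes_to \<Lambda> \<mu> \<nu> \<and> synchronizes_to \<Lambda> \<nu> \<mu>)"


section \<open>The \<open>\<lambda>\<close>-synchronizing \<open>\<lambda>\<close>-graph system\<close>

text \<open>
  Vertices at level \<open>l\<close> are \<open>l\<close>-past equivalence classes inside \<open>synchronizing_words \<Lambda> l\<close>.
  In \<open>iota\<close>, the vertex \<open>u\<close> is determined by \<open>v\<close> (lemma \<open>iota_past_class\<close>).
\<close>

definition past_equiv :: "(int \<Rightarrow> 'a) set \<Rightarrow> nat \<Rightarrow> ('a list \<times> 'a list) set" where
  "past_equiv \<Lambda> l = {(\<mu>, \<nu>). \<mu> \<in> synchronizing_words \<Lambda> l \<and> \<nu> \<in> synchronizing_words \<Lambda> l \<and>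
     predecessors \<Lambda> l \<mu> = predecessors \<Lambda> l \<nu>}"

definition past_class :: "(int \<Rightarrow> 'a) set \<Rightarrow> nat \<Rightarrow> 'a list \<Rightarrow> 'a list set" where
  "past_class \<Lambda> l \<mu> = past_equiv \<Lambda> l `` {\<mu>}"

definition vertices :: "(int \<Rightarrow> 'a) set \<Rightarrow> nat \<Rightarrow> 'a list set set" where
  "vertices \<Lambda> l = synchronizing_words \<Lambda> l // past_equiv \<Lambda> l"

definition labeled_edge ::
  "(int \<Rightarrow> 'a) set \<Rightarrow> nat \<Rightarrow> 'a list set \<Rightarrow> 'a \<Rightarrow> 'a list set \<Rightarrow> bool" where
  "labeled_edge \<Lambda> l u \<alpha> v \<longleftrightarrow>
     (\<exists>\<nu>\<in>synchronizing_words \<Lambda> (Suc l). [\<alpha>] \<in> predecessors \<Lambda> 1 \<nu> \<and>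
        u = past_class \<Lambda> l (\<alpha> # \<nu>) \<and> v = past_class \<Lambda> (Suc l) \<nu>)"

definition iota :: "(int \<Rightarrow> 'a) set \<Rightarrow> nat \<Rightarrow> 'a list set \<Rightarrow> 'a list set" where
  "iota \<Lambda> l v = (THE u. \<exists>\<mu>\<in>synchronizing_words \<Lambda> (Suc l).
     v = past_class \<Lambda> (Suc l) \<mu> \<and> u = past_class \<Lambda> l \<mu>)"

definition A_entry :: "(int \<Rightarrow> 'a) set \<Rightarrow> nat \<Rightarrow> 'a list set \<Rightarrow> 'a \<Rightarrow> 'a list set \<Rightarrow> complex" where
  "A_entry \<Lambda> l u \<alpha> v = (if labeled_edge \<Lambda> l u \<alpha> v then 1 else 0)"

definition I_entry :: "(int \<Rightarrow> 'a) set \<Rightarrow> nat \<Rightarrow> 'a list set \<Rightarrow> 'a list set \<Rightarrow> complex" where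
  "I_entry \<Lambda> l u v = (if iota \<Lambda> l v = u then 1 else 0)"


section \<open>Unital \<open>C\<^sup>*\<close>-algebras\<close>

record 'b cstar = "(complex, 'b) module" +
  cadj :: "'b \<Rightarrow> 'b"
  cnorm :: "'b \<Rightarrow> real"

locale unital_cstar_algebra = ring A for A (structure) +
  assumes smult_closed: "x \<in> carrier A \<Longrightarrow> c \<odot> x \<in> carrier A"
    and smult_add_scalar: "x \<in> carrier A \<Longrightarrow> (c + d) \<odot> x = c \<odot> x \<oplus> d \<odot> x"
    and smult_add: "\<lbrakk>x \<in> carrier A; y \<in> carrier A\<rbrakk> \<Longrightarrow> c \<odot> (x \<oplus> y) = c \<odot> x \<oplus> c \<odot> y"
    and smult_smult: "x \<in> carrier A \<Longrightarrow> (c * d) \<odot> x = c \<odot> (d \<odot> x)"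
    and smult_one: "x \<in> carrier A \<Longrightarrow> 1 \<odot> x = x"
    and smult_mult_left: "\<lbrakk>x \<in> carrier A; y \<in> carrier A\<rbrakk> \<Longrightarrow> (c \<odot> x) \<otimes> y = c \<odot> (x \<otimes> y)"
    and smult_mult_right: "\<lbrakk>x \<in> carrier A; y \<in> carrier A\<rbrakk> \<Longrightarrow> x \<otimes> (c \<odot> y) = c \<odot> (x \<otimes> y)"
    and cadj_closed: "x \<in> carrier A \<Longrightarrow> cadj A x \<in> carrier A"
    and cadj_cadj: "x \<in> carrier A \<Longrightarrow> cadj A (cadj A x) = x"
    and cadj_add: "\<lbrakk>x \<in> carrier A; y \<in> carrier A\<rbrakk> \<Longrightarrow> cadj A (x \<oplus> y) = cadj A x \<oplus> cadj A y"
    and cadj_mult: "\<lbrakk>x \<in> carrier A; y \<in> carrier A\<rbrakk> \<Longrightarrow> cadj A (x \<otimes> y) = cadj A y \<otimes> cadj A x"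
    and cadj_smult: "x \<in> carrier A \<Longrightarrow> cadj A (c \<odot> x) = cnj c \<odot> cadj A x"
    and cnorm_eq_zero: "x \<in> carrier A \<Longrightarrow> cnorm A x = 0 \<longleftrightarrow> x = \<zero>"
    and cnorm_add: "\<lbrakk>x \<in> carrier A; y \<in> carrier A\<rbrakk> \<Longrightarrow> cnorm A (x \<oplus> y) \<le> cnorm A x + cnorm A y"
    and cnorm_smult: "x \<in> carrier A \<Longrightarrow> cnorm A (c \<odot> x) = cmod c * cnorm A x"
    and cnorm_mult: "\<lbrakk>x \<in> carrier A; y \<in> carrier A\<rbrakk> \<Longrightarrow> cnorm A (x \<otimes> y) \<le> cnorm A x * cnorm A y"
    and cstar_identity: "x \<in> carrier A \<Longrightarrow> cnorm A (cadj A x \<otimes> x) = (cnorm A x)\<^sup>2"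
    and complete: "\<lbrakk>\<And>n. f n \<in> carrier A;
        \<And>e. e > 0 \<Longrightarrow> \<exists>N. \<forall>m\<ge>N. \<forall>n\<ge>N. cnorm A (f m \<ominus> f n) < e\<rbrakk>
      \<Longrightarrow> \<exists>x\<in>carrier A. (\<lambda>n. cnorm A (f n \<ominus> x)) \<longlonglongrightarrow> 0"

definition closed_in_norm :: "('b, 'm) cstar_scheme \<Rightarrow> 'b set \<Rightarrow> bool" where
  "closed_in_norm A J \<longleftrightarrow>
     (\<forall>f. \<forall>x\<in>carrier A. (\<forall>n. f n \<in> J) \<and> (\<lambda>n. cnorm A (f n \<ominus>\<^bsub>A\<^esub> x)) \<longlonglongrightarrow> 0 \<longrightarrow> x \<in> J)"

definition simple_cstar_algebra :: "('b, 'm) cstar_scheme \<Rightarrow> bool" where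
  "simple_cstar_algebra A \<longleftrightarrow> unital_cstar_algebra A \<and> carrier A \<noteq> {\<zero>\<^bsub>A\<^esub>} \<and>
     (\<forall>J. ideal J A \<and> closed_in_norm A J \<longrightarrow> J = {\<zero>\<^bsub>A\<^esub>} \<or> J = carrier A)"


section \<open>Universal \<open>C\<^sup>*\<close>-algebras given by generators and relations\<close>

text \<open>
  The free unital complex \<open>*\<close>-algebra on a type of generators is the monoid algebra of the free
  monoid on the letters \<open>(g, False)\<close> (standing for \<open>g\<close>) and \<open>(g, True)\<close> (standing for \<open>g\<^sup>*\<close>).
\<close>

datatype 'g star_word = Star_Word "('g \<times> bool) list"

instantiation star_word :: (type) monoid_add
begin

definition zero_star_word :: "'a star_word" where
  "0 = Star_Word []"

fun plus_star_word :: "'a star_word \<Rightarrow> 'a star_word \<Rightarrow> 'a star_word" where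
  "Star_Word u + Star_Word v = Star_Word (u @ v)"

instance
proof
  fix a b c :: "'a star_word"
  show "a + b + c = a + (b + c)"
    by (cases a; cases b; cases c) simp
  show "0 + a = a"
    by (cases a) (simp add: zero_star_word_def)
  show "a + 0 = a"
    by (cases a) (simp add: zero_star_word_def)
qed

end

type_synonym 'g free_star_algebra = "'g star_word \<Rightarrow>\<^sub>0 complex"

primrec word_adj :: "'g star_word \<Rightarrow> 'g star_word" where
  "word_adj (Star_Word w) = Star_Word (rev (map (\<lambda>(g, b). (g, \<not> b)) w))"

lemma word_adj_word_adj [simp]: "word_adj (word_adj w) = w"
  by (cases w) (simp add: rev_map comp_def case_prod_beta)

lift_definition free_adj :: "'g free_star_algebra \<Rightarrow> 'g free_star_algebra"
  is "\<lambda>f w. cnj (f (word_adj w))"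
proof -
  fix f :: "'g star_word \<Rightarrow> complex"
  assume "finite {w. f w \<noteq> 0}"
  then have "finite (word_adj ` {w. f w \<noteq> 0})"
    by simp
  moreover have "{w. cnj (f (word_adj w)) \<noteq> 0} \<subseteq> word_adj ` {w. f w \<noteq> 0}"
    by (auto intro!: image_eqI [where x = "word_adj w" for w])
  ultimately show "finite {w. cnj (f (word_adj w)) \<noteq> 0}"
    by (rule rev_finite_subset)
qed

definition free_scale :: "complex \<Rightarrow> 'g free_star_algebra \<Rightarrow> 'g free_star_algebra" where
  "free_scale c x = Poly_Mapping.map ((*) c) x"

definition free_gen :: "'g \<Rightarrow> 'g free_star_algebra" where
  "free_gen g = Poly_Mapping.single (Star_Word [(g, False)]) 1"

definition cstar_seminorm :: "('g free_star_algebra \<Rightarrow> real) \<Rightarrow> bool" where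
  "cstar_seminorm p \<longleftrightarrow>
     (\<forall>x y. p (x + y) \<le> p x + p y) \<and>
     (\<forall>c x. p (free_scale c x) = cmod c * p x) \<and>
     (\<forall>x y. p (x * y) \<le> p x * p y) \<and>
     (\<forall>x. p (free_adj x * x) = (p x)\<^sup>2)"

text \<open>
  A relation \<open>a = b\<close> is a pair \<open>(a, b)\<close>.  The universal \<open>C\<^sup>*\<close>-algebra is the completion of the
  free \<open>*\<close>-algebra for the largest \<open>C\<^sup>*\<close>-seminorm in which all relations hold.  The supremum is
  only meaningful when it is finite at every element, which holds as soon as the relations bound
  the norms of the generators (lemma \<open>admissible_bounded\<close>).
\<close>

definition admissible_seminorms ::
  "('g free_star_algebra \<times> 'g free_star_algebra) set \<Rightarrow> ('g free_star_algebra \<Rightarrow> real) set" where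
  "admissible_seminorms R = {p. cstar_seminorm p \<and> (\<forall>(a, b) \<in> R. p (a - b) = 0)}"

definition universal_seminorm ::
  "('g free_star_algebra \<times> 'g free_star_algebra) set \<Rightarrow> 'g free_star_algebra \<Rightarrow> real" where
  "universal_seminorm R x = (SUP p \<in> admissible_seminorms R. p x)"

text \<open>The completion, as the \<open>*\<close>-algebra of Cauchy sequences modulo null sequences.\<close>

definition cauchy_seqs ::
  "('g free_star_algebra \<Rightarrow> real) \<Rightarrow> (nat \<Rightarrow> 'g free_star_algebra) set" where
  "cauchy_seqs q = {f. \<forall>e>0. \<exists>N. \<forall>m\<ge>N. \<forall>n\<ge>N. q (f m - f n) < e}"

definition same_limit ::
  "('g free_star_algebra \<Rightarrow> real) \<Rightarrow>
    ((nat \<Rightarrow> 'g free_star_algebra) \<times> (nat \<Rightarrow> 'g free_star_algebra)) set" where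
  "same_limit q = {(f, g). f \<in> cauchy_seqs q \<and> g \<in> cauchy_seqs q \<and> (\<lambda>n. q (f n - g n)) \<longlonglongrightarrow> 0}"

definition limit_class ::
  "('g free_star_algebra \<Rightarrow> real) \<Rightarrow> (nat \<Rightarrow> 'g free_star_algebra) \<Rightarrow>
    (nat \<Rightarrow> 'g free_star_algebra) set" where
  "limit_class q f = same_limit q `` {f}"

definition cstar_completion ::
  "('g free_star_algebra \<Rightarrow> real) \<Rightarrow> (nat \<Rightarrow> 'g free_star_algebra) set cstar" where
  "cstar_completion q =
    \<lparr>carrier = cauchy_seqs q // same_limit q,
     mult = (\<lambda>X Y. \<Union>f\<in>X. \<Union>g\<in>Y. limit_class q (\<lambda>n. f n * g n)),
     one = limit_class q (\<lambda>n. 1),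
     zero = limit_class q (\<lambda>n. 0),
     add = (\<lambda>X Y. \<Union>f\<in>X. \<Union>g\<in>Y. limit_class q (\<lambda>n. f n + g n)),
     smult = (\<lambda>c X. \<Union>f\<in>X. limit_class q (\<lambda>n. free_scale c (f n))),
     cadj = (\<lambda>X. \<Union>f\<in>X. limit_class q (\<lambda>n. free_adj (f n))),
     cnorm = (\<lambda>X. THE r. \<forall>f\<in>X. (\<lambda>n. q (f n)) \<longlonglongrightarrow> r)\<rparr>"

definition universal_cstar_algebra ::
  "('g free_star_algebra \<times> 'g free_star_algebra) set \<Rightarrow>
    (nat \<Rightarrow> 'g free_star_algebra) set cstar" where
  "universal_cstar_algebra R = cstar_completion (universal_seminorm R)"


section \<open>The \<open>C\<^sup>*\<close>-algebra of a \<open>\<lambda>\<close>-synchronizing subshift\<close>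

text \<open>
  The projections are indexed by the vertices themselves rather than by an enumeration
  \<open>1, \<dots>, m(l)\<close> of each level.  A generator \<open>Vertex_Projection l v\<close> for which \<open>v\<close> is not
  a vertex of level \<open>l\<close> is removed by the relation \<open>no_vertex\<close>.
\<close>

datatype 'a lambda_gen = Partial_Isometry 'a | Vertex_Projection nat "'a list set"

abbreviation S_gen :: "'a \<Rightarrow> 'a lambda_gen free_star_algebra" where
  "S_gen \<alpha> \<equiv> free_gen (Partial_Isometry \<alpha>)"

abbreviation E_gen :: "nat \<Rightarrow> 'a list set \<Rightarrow> 'a lambda_gen free_star_algebra" where
  "E_gen l v \<equiv> free_gen (Vertex_Projection l v)"

inductive_set lambda_relations ::
  "(int \<Rightarrow> 'a::finite) set \<Rightarrow> ('a lambda_gen free_star_algebra \<times> 'a lambda_gen free_star_algebra) set"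
  for \<Lambda> :: "(int \<Rightarrow> 'a) set" where
  partial_isometry:
    "(S_gen \<alpha> * free_adj (S_gen \<alpha>) * S_gen \<alpha>, S_gen \<alpha>) \<in> lambda_relations \<Lambda>"
| projection_adj:
    "v \<in> vertices \<Lambda> l \<Longrightarrow> (free_adj (E_gen l v), E_gen l v) \<in> lambda_relations \<Lambda>"
| projection_idem:
    "v \<in> vertices \<Lambda> l \<Longrightarrow> (E_gen l v * E_gen l v, E_gen l v) \<in> lambda_relations \<Lambda>"
| no_vertex:
    "v \<notin> vertices \<Lambda> l \<Longrightarrow> (E_gen l v, 0) \<in> lambda_relations \<Lambda>"
| sum_ranges:
    "((\<Sum>\<beta>\<in>UNIV. S_gen \<beta> * free_adj (S_gen \<beta>)), 1) \<in> lambda_relations \<Lambda>"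
| sum_vertices:
    "((\<Sum>v\<in>vertices \<Lambda> l. E_gen l v), 1) \<in> lambda_relations \<Lambda>"
| refine:
    "u \<in> vertices \<Lambda> l \<Longrightarrow>
     (E_gen l u, \<Sum>v\<in>vertices \<Lambda> (Suc l). free_scale (I_entry \<Lambda> l u v) (E_gen (Suc l) v))
       \<in> lambda_relations \<Lambda>"
| commute:
    "v \<in> vertices \<Lambda> l \<Longrightarrow>
     (S_gen \<alpha> * free_adj (S_gen \<alpha>) * E_gen l v, E_gen l v * S_gen \<alpha> * free_adj (S_gen \<alpha>))
       \<in> lambda_relations \<Lambda>"
| edges:
    "u \<in> vertices \<Lambda> l \<Longrightarrow>
     (free_adj (S_gen \<alpha>) * E_gen l u * S_gen \<alpha>,
      \<Sum>v\<in>vertices \<Lambda> (Suc l). free_scale (A_entry \<Lambda> l u \<alpha> v) (E_gen (Suc l) v))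
       \<in> lambda_relations \<Lambda>"

definition O_lambda ::
  "(int \<Rightarrow> 'a::finite) set \<Rightarrow> (nat \<Rightarrow> 'a lambda_gen free_star_algebra) set cstar" where
  "O_lambda \<Lambda> = universal_cstar_algebra (lambda_relations \<Lambda>)"

definition O_gen ::
  "(int \<Rightarrow> 'a::finite) set \<Rightarrow> 'a lambda_gen \<Rightarrow> (nat \<Rightarrow> 'a lambda_gen free_star_algebra) set" where
  "O_gen \<Lambda> g = limit_class (universal_seminorm (lambda_relations \<Lambda>)) (\<lambda>_. free_gen g)"


section \<open>Well-definedness of the \<open>\<lambda>\<close>-graph system\<close>

lemma words_Cons_left: "w \<in> words \<Lambda> \<Longrightarrow> \<exists>a. a # w \<in> words \<Lambda>"
proof -
  assume "w \<in> words \<Lambda>"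
  then obtain x k where x: "x \<in> \<Lambda>" "\<forall>i<length w. w ! i = x (k + int i)"
    by (auto simp: words_def)
  have "(x (k - 1) # w) ! i = x (k - 1 + int i)" if "i < length (x (k - 1) # w)" for i
    using that x(2) by (cases i) (auto simp: algebra_simps)
  then show ?thesis using x(1) unfolding words_def by blast
qed

lemma words_append_left: "u @ w \<in> words \<Lambda> \<Longrightarrow> u \<in> words \<Lambda>"
proof -
  assume "u @ w \<in> words \<Lambda>"
  then obtain x k where x: "x \<in> \<Lambda>" "\<forall>i<length (u @ w). (u @ w) ! i = x (k + int i)"
    by (auto simp: words_def)
  have "u ! i = x (k + int i)" if "i < length u" for i
    using that x(2)[rule_format, of i] by (simp add: nth_append)
  then show ?thesis using x(1) unfolding words_def by blast
qed

lemma words_append_right: "u @ w \<in> words \<Lambda> \<Longrightarrow> w \<in> words \<Lambda>"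
proof -
  assume "u @ w \<in> words \<Lambda>"
  then obtain x k where x: "x \<in> \<Lambda>" "\<forall>i<length (u @ w). (u @ w) ! i = x (k + int i)"
    by (auto simp: words_def)
  have "w ! i = x (k + int (length u) + int i)" if "i < length w" for i
    using that x(2)[rule_format, of "length u + i"] by (simp add: add.assoc)
  then show ?thesis using x(1) unfolding words_def by blast
qed

lemma mem_predecessors: "\<nu> \<in> predecessors \<Lambda> l \<mu> \<longleftrightarrow> length \<nu> = l \<and> \<nu> @ \<mu> \<in> words \<Lambda>"
  using words_append_left by (auto simp: predecessors_def words_of_length_def)

lemma predecessors_lower:
  "predecessors \<Lambda> l \<mu> = {\<nu>. \<exists>a. a # \<nu> \<in> predecessors \<Lambda> (Suc l) \<mu>}"
proof (rule Set.set_eqI)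
  fix \<nu>
  have "\<nu> @ \<mu> \<in> words \<Lambda> \<longleftrightarrow> (\<exists>a. a # \<nu> @ \<mu> \<in> words \<Lambda>)"
    using words_Cons_left[of "\<nu> @ \<mu>" \<Lambda>] words_append_right[of "[a]" "\<nu> @ \<mu>" \<Lambda> for a] by auto
  then show "\<nu> \<in> predecessors \<Lambda> l \<mu> \<longleftrightarrow> \<nu> \<in> {\<nu>. \<exists>a. a # \<nu> \<in> predecessors \<Lambda> (Suc l) \<mu>}"
    by (simp add: mem_predecessors)
qed

lemma predecessors_Cons:
  "predecessors \<Lambda> l (a # \<mu>) = {\<nu>. \<nu> @ [a] \<in> predecessors \<Lambda> (Suc l) \<mu>}"
  by (auto simp: mem_predecessors)

lemma synchronizing_words_antimono: "synchronizing_words \<Lambda> (Suc l) \<subseteq> synchronizing_words \<Lambda> l"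
proof
  fix \<mu> assume "\<mu> \<in> synchronizing_words \<Lambda> (Suc l)"
  then show "\<mu> \<in> synchronizing_words \<Lambda> l"
    unfolding synchronizing_words_def mem_Collect_eq
    by (simp only: predecessors_lower[of \<Lambda> l]) blast
qed

lemma synchronizing_words_Cons:
  assumes "\<nu> \<in> synchronizing_words \<Lambda> (Suc l)" "[\<alpha>] \<in> predecessors \<Lambda> 1 \<nu>"
  shows "\<alpha> # \<nu> \<in> synchronizing_words \<Lambda> l"
proof -
  have "\<omega> \<in> followers \<Lambda> \<nu>" if "\<omega> \<in> followers \<Lambda> (\<alpha> # \<nu>)" for \<omega>
    using that words_append_right[of "[\<alpha>]" "\<nu> @ \<omega>" \<Lambda>] by (simp add: followers_def)
  then show ?thesis
    using assms unfolding synchronizing_words_def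
    by (auto simp: predecessors_Cons mem_predecessors[of "[\<alpha>]"])
qed

lemma equiv_past_equiv: "equiv (synchronizing_words \<Lambda> l) (past_equiv \<Lambda> l)"
  by (rule equivI) (auto simp: past_equiv_def refl_on_def sym_def trans_def)

lemma past_class_eq_iff:
  "\<mu> \<in> synchronizing_words \<Lambda> l \<Longrightarrow> \<nu> \<in> synchronizing_words \<Lambda> l \<Longrightarrow>
     past_class \<Lambda> l \<mu> = past_class \<Lambda> l \<nu> \<longleftrightarrow> predecessors \<Lambda> l \<mu> = predecessors \<Lambda> l \<nu>"
  unfolding past_class_def
  by (subst eq_equiv_class_iff[OF equiv_past_equiv]) (auto simp: past_equiv_def)

lemma vertices_eq: "vertices \<Lambda> l = past_class \<Lambda> l ` synchronizing_words \<Lambda> l"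
  by (auto simp: vertices_def past_class_def quotient_def)

lemma iota_past_class:
  assumes "\<mu> \<in> synchronizing_words \<Lambda> (Suc l)"
  shows "iota \<Lambda> l (past_class \<Lambda> (Suc l) \<mu>) = past_class \<Lambda> l \<mu>"
  unfolding iota_def
proof (rule the_equality)
  fix u assume "\<exists>\<mu>'\<in>synchronizing_words \<Lambda> (Suc l).
    past_class \<Lambda> (Suc l) \<mu> = past_class \<Lambda> (Suc l) \<mu>' \<and> u = past_class \<Lambda> l \<mu>'"
  then obtain \<mu>' where m: "\<mu>' \<in> synchronizing_words \<Lambda> (Suc l)" "u = past_class \<Lambda> l \<mu>'"
    and "predecessors \<Lambda> (Suc l) \<mu> = predecessors \<Lambda> (Suc l) \<mu>'"
    using past_class_eq_iff[OF assms] by blast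
  then have "predecessors \<Lambda> l \<mu> = predecessors \<Lambda> l \<mu>'"
    by (simp add: predecessors_lower[of \<Lambda> l])
  then show "u = past_class \<Lambda> l \<mu>"
    using m assms synchronizing_words_antimono[of \<Lambda> l]
      past_class_eq_iff[of \<mu> \<Lambda> l \<mu>'] by blast
qed (use assms in blast)

lemma labeled_edge_vertices:
  assumes "labeled_edge \<Lambda> l u \<alpha> v"
  shows "u \<in> vertices \<Lambda> l" "v \<in> vertices \<Lambda> (Suc l)"
proof -
  obtain \<nu> where \<nu>: "\<nu> \<in> synchronizing_words \<Lambda> (Suc l)" "[\<alpha>] \<in> predecessors \<Lambda> 1 \<nu>"
      "u = past_class \<Lambda> l (\<alpha> # \<nu>)" "v = past_class \<Lambda> (Suc l) \<nu>"
    using assms unfolding labeled_edge_def by blast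
  show "u \<in> vertices \<Lambda> l"
    unfolding \<nu>(3) vertices_eq by (rule imageI, rule synchronizing_words_Cons[OF \<nu>(1,2)])
  show "v \<in> vertices \<Lambda> (Suc l)"
    unfolding \<nu>(4) vertices_eq by (rule imageI, rule \<nu>(1))
qed

lemma finite_vertices: "finite (vertices (\<Lambda> :: (int \<Rightarrow> 'a::finite) set) l)"
proof -
  have "range (predecessors \<Lambda> l) \<subseteq> Pow {w. set w \<subseteq> UNIV \<and> length w = l}"
    by (auto simp: mem_predecessors)
  then have fin: "finite (range (predecessors \<Lambda> l))"
    by (rule finite_subset) (simp only: finite_Pow_iff, rule finite_lists_length_eq, rule finite)
  have "past_class \<Lambda> l \<mu> = {\<nu> \<in> synchronizing_words \<Lambda> l. predecessors \<Lambda> l \<nu> = predecessors \<Lambda> l \<mu>}"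
    if "\<mu> \<in> synchronizing_words \<Lambda> l" for \<mu>
    using that by (auto simp: past_class_def past_equiv_def)
  then have "vertices \<Lambda> l \<subseteq>
      (\<lambda>P. {\<nu> \<in> synchronizing_words \<Lambda> l. predecessors \<Lambda> l \<nu> = P}) ` range (predecessors \<Lambda> l)"
    by (auto simp: vertices_eq)
  then show ?thesis using fin by (meson finite_imageI finite_subset)
qed


section \<open>The universal property\<close>

text \<open>
  It is shown that \<open>O_lambda \<Lambda>\<close> is a unital \<open>C\<^sup>*\<close>-algebra in which the generators \<open>O_gen \<Lambda> g\<close> satisfy
  the relations, that \<open>*\<close>-polynomials in the generators are dense
  (\<open>completion_const_dense\<close>), and that every family satisfying the relations in
  a unital \<open>C\<^sup>*\<close>-algebra is the image of the generators under a unital \<open>*\<close>-homomorphism.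
  The predicate \<open>lambda_family\<close> spells out the relations for elements of an arbitrary algebra.
\<close>

definition lambda_family ::
  "(int \<Rightarrow> 'a::finite) set \<Rightarrow> ('b, 'm) cstar_scheme \<Rightarrow> ('a \<Rightarrow> 'b) \<Rightarrow> (nat \<Rightarrow> 'a list set \<Rightarrow> 'b) \<Rightarrow> bool" where
  "lambda_family \<Lambda> A S E \<longleftrightarrow>
     (\<forall>\<alpha>. S \<alpha> \<in> carrier A \<and> S \<alpha> \<otimes>\<^bsub>A\<^esub> cadj A (S \<alpha>) \<otimes>\<^bsub>A\<^esub> S \<alpha> = S \<alpha>) \<and>
     (\<forall>l. \<forall>v\<in>vertices \<Lambda> l. E l v \<in> carrier A \<and> cadj A (E l v) = E l v \<and> E l v \<otimes>\<^bsub>A\<^esub> E l v = E l v) \<and>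
     (\<Oplus>\<^bsub>A\<^esub>\<beta>\<in>UNIV. S \<beta> \<otimes>\<^bsub>A\<^esub> cadj A (S \<beta>)) = \<one>\<^bsub>A\<^esub> \<and>
     (\<forall>l. (\<Oplus>\<^bsub>A\<^esub>v\<in>vertices \<Lambda> l. E l v) = \<one>\<^bsub>A\<^esub>) \<and>
     (\<forall>l. \<forall>u\<in>vertices \<Lambda> l.
        E l u = (\<Oplus>\<^bsub>A\<^esub>v\<in>vertices \<Lambda> (Suc l). I_entry \<Lambda> l u v \<odot>\<^bsub>A\<^esub> E (Suc l) v)) \<and>
     (\<forall>\<alpha> l. \<forall>v\<in>vertices \<Lambda> l.
        S \<alpha> \<otimes>\<^bsub>A\<^esub> cadj A (S \<alpha>) \<otimes>\<^bsub>A\<^esub> E l v = E l v \<otimes>\<^bsub>A\<^esub> S \<alpha> \<otimes>\<^bsub>A\<^esub> cadj A (S \<alpha>)) \<and>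
     (\<forall>\<alpha> l. \<forall>u\<in>vertices \<Lambda> l.
        cadj A (S \<alpha>) \<otimes>\<^bsub>A\<^esub> E l u \<otimes>\<^bsub>A\<^esub> S \<alpha> =
        (\<Oplus>\<^bsub>A\<^esub>v\<in>vertices \<Lambda> (Suc l). A_entry \<Lambda> l u \<alpha> v \<odot>\<^bsub>A\<^esub> E (Suc l) v))"

definition contractive_star_hom ::
  "('b, 'm) cstar_scheme \<Rightarrow> ('c, 'n) cstar_scheme \<Rightarrow> ('b \<Rightarrow> 'c) set" where
  "contractive_star_hom A B = {\<phi> \<in> ring_hom A B.
     (\<forall>c. \<forall>x\<in>carrier A. \<phi> (c \<odot>\<^bsub>A\<^esub> x) = c \<odot>\<^bsub>B\<^esub> \<phi> x) \<and>
     (\<forall>x\<in>carrier A. \<phi> (cadj A x) = cadj B (\<phi> x)) \<and>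
     (\<forall>x\<in>carrier A. cnorm B (\<phi> x) \<le> cnorm A x)}"


subsection \<open>The free \<open>*\<close>-algebra and its \<open>C\<^sup>*\<close>-seminorms\<close>

lemma word_adj_plus: "word_adj (u + v) = word_adj v + word_adj u"
  by (cases u; cases v) simp

lemma word_adj_zero [simp]: "word_adj 0 = 0"
  by (simp add: zero_star_word_def)

lemma lookup_free_adj: "Poly_Mapping.lookup (free_adj x) w = cnj (Poly_Mapping.lookup x (word_adj w))"
  by transfer simp

lemma lookup_free_scale: "Poly_Mapping.lookup (free_scale c x) w = c * Poly_Mapping.lookup x w"
  unfolding free_scale_def by transfer (simp add: when_def)

lemma free_scale_eq_mult: "free_scale c x = Poly_Mapping.single 0 c * x"
  unfolding free_scale_def by (rule mult_map_scale_conv_mult)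

lemma free_algebra_induct [case_names single add]:
  assumes "\<And>w c. P (Poly_Mapping.single w c)" and "\<And>x y. P x \<Longrightarrow> P y \<Longrightarrow> P (x + y)"
  shows "P (x :: 'g free_star_algebra)"
proof -
  have eq: "x = (\<Sum>k\<in>Poly_Mapping.keys x. Poly_Mapping.single k (Poly_Mapping.lookup x k))"
    by (rule poly_mapping_eqI)
       (auto simp: lookup_sum lookup_single when_def in_keys_iff)
  have "P (\<Sum>k\<in>A. Poly_Mapping.single k (Poly_Mapping.lookup x k))" if "finite A" for A
    using that
  proof (induction A)
    case empty
    show ?case using assms(1)[of 0 0] by simp
  qed (use assms in auto)
  then show ?thesis by (subst eq) simp
qed

lemma free_adj_add: "free_adj (x + y) = free_adj x + free_adj y"
  by (rule poly_mapping_eqI) (simp add: lookup_free_adj lookup_add)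

lemma free_adj_single: "free_adj (Poly_Mapping.single w c) = Poly_Mapping.single (word_adj w) (cnj c)"
  by (rule poly_mapping_eqI) (auto simp: lookup_free_adj lookup_single when_def)

lemma free_adj_mult: "free_adj (x * y) = free_adj y * free_adj x"
proof (induction x rule: free_algebra_induct)
  case (single w c)
  show ?case
    by (induction y rule: free_algebra_induct)
       (simp_all add: mult_single free_adj_single word_adj_plus mult.commute free_adj_add
         distrib_left distrib_right)
qed (simp add: distrib_left distrib_right free_adj_add)

lemma free_adj_adj [simp]: "free_adj (free_adj x) = x"
  by (rule poly_mapping_eqI) (simp add: lookup_free_adj)

lemma free_adj_scale: "free_adj (free_scale c x) = free_scale (cnj c) (free_adj x)"
  by (rule poly_mapping_eqI) (simp add: lookup_free_adj lookup_free_scale)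

lemma free_adj_diff: "free_adj (x - y) = free_adj x - free_adj y"
  by (rule poly_mapping_eqI) (simp add: lookup_free_adj lookup_minus)

lemma free_adj_zero [simp]: "free_adj 0 = 0"
  by (rule poly_mapping_eqI) (simp add: lookup_free_adj)

lemma free_adj_one [simp]: "free_adj 1 = 1"
  using free_adj_single[of 0 1] by simp

lemma free_scale_add: "free_scale c (x + y) = free_scale c x + free_scale c y"
  by (simp add: free_scale_eq_mult distrib_left)

lemma free_scale_diff: "free_scale c (x - y) = free_scale c x - free_scale c y"
  by (simp add: free_scale_eq_mult right_diff_distrib)

lemma free_scale_add_scalar: "free_scale (c + d) x = free_scale c x + free_scale d x"
  by (rule poly_mapping_eqI) (simp add: lookup_free_scale lookup_add distrib_right)

lemma free_scale_scale: "free_scale c (free_scale d x) = free_scale (c * d) x"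
  by (rule poly_mapping_eqI) (simp add: lookup_free_scale)

lemma free_scale_one [simp]: "free_scale 1 x = x"
  by (rule poly_mapping_eqI) (simp add: lookup_free_scale)

lemma free_scale_mult_left: "free_scale c x * y = free_scale c (x * y)"
  by (simp add: free_scale_eq_mult mult.assoc)

lemma free_scale_mult_right: "x * free_scale c y = free_scale c (x * y)"
proof (induction x rule: free_algebra_induct)
  case (single w d)
  show ?case
    by (simp add: free_scale_eq_mult mult_single mult.assoc[symmetric] mult.commute)
qed (simp add: distrib_right free_scale_add)

lemma free_scale_minus_one: "free_scale (-1) x = - x"
  by (rule poly_mapping_eqI) (simp add: lookup_free_scale)

lemma free_scale_zero [simp]: "free_scale 0 x = 0"
  by (rule poly_mapping_eqI) (simp add: lookup_free_scale)

context
  fixes p :: "'g free_star_algebra \<Rightarrow> real"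
  assumes p: "cstar_seminorm p"
begin

lemma seminorm_add: "p (x + y) \<le> p x + p y"
  and seminorm_scale: "p (free_scale c x) = cmod c * p x"
  and seminorm_mult: "p (x * y) \<le> p x * p y"
  and seminorm_cstar: "p (free_adj x * x) = (p x)\<^sup>2"
  using p unfolding cstar_seminorm_def by blast+

lemma seminorm_zero [simp]: "p 0 = 0"
  using seminorm_scale[of 0 0] by simp

lemma seminorm_minus: "p (- x) = p x"
  using seminorm_scale[of "-1" x] by (simp add: free_scale_minus_one)

lemma seminorm_diff_commute: "p (x - y) = p (y - x)"
  using seminorm_minus[of "x - y"] by simp

lemma seminorm_nonneg: "0 \<le> p x"
  using seminorm_add[of x "- x"] by (simp add: seminorm_minus)

lemma seminorm_diff: "p (x - y) \<le> p x + p y"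
  using seminorm_add[of x "- y"] by (simp add: seminorm_minus)

lemma seminorm_triangle: "p (x - z) \<le> p (x - y) + p (y - z)"
  using seminorm_add[of "x - y" "y - z"] by simp

lemma seminorm_le_diff: "p x \<le> p y + p (x - y)"
  using seminorm_add[of y "x - y"] by simp

lemma seminorm_abs_diff: "\<bar>p x - p y\<bar> \<le> p (x - y)"
  using seminorm_le_diff[of x y] seminorm_le_diff[of y x] seminorm_diff_commute[of x y] by linarith

lemma seminorm_le_adj: "p x \<le> p (free_adj x)"
proof (cases "p x = 0")
  case False
  then have "p x > 0" using seminorm_nonneg[of x] by simp
  moreover have "p x * p x \<le> p (free_adj x) * p x"
    using seminorm_mult[of "free_adj x" x] by (simp add: seminorm_cstar power2_eq_square)
  ultimately show ?thesis by simp
qed (simp add: seminorm_nonneg)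

lemma seminorm_adj: "p (free_adj x) = p x"
  using seminorm_le_adj[of x] seminorm_le_adj[of "free_adj x"] by simp

lemma seminorm_one: "p 1 \<le> 1"
proof -
  have "p 1 = p 1 * p 1" using seminorm_cstar[of 1] by (simp add: power2_eq_square)
  then have "p 1 = 0 \<or> p 1 = 1" by simp
  then show ?thesis by auto
qed

lemma seminorm_eqD: "p (x - y) = 0 \<Longrightarrow> p x = p y"
  using seminorm_abs_diff[of x y] by simp

lemma seminorm_idem_selfadj:
  assumes "p (x * x - x) = 0" "p (free_adj x - x) = 0"
  shows "p x \<le> 1"
proof -
  have "p (free_adj x * x - x * x) \<le> p (free_adj x - x) * p x"
    using seminorm_mult[of "free_adj x - x" x] by (simp add: left_diff_distrib)
  then have "p (free_adj x * x - x * x) = 0"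
    using seminorm_nonneg[of "free_adj x * x - x * x"] assms by simp
  then have "(p x)\<^sup>2 = p x"
    using seminorm_eqD assms(1) seminorm_cstar by metis
  then have "p x = 0 \<or> p x = 1" by (simp add: power2_eq_square)
  then show ?thesis by auto
qed

lemma seminorm_partial_isometry:
  assumes "p (x * free_adj x * x - x) = 0"
  shows "p x \<le> 1"
proof -
  let ?y = "free_adj x * x"
  have "p (?y * ?y - ?y) \<le> p (free_adj x) * p (x * free_adj x * x - x)"
    using seminorm_mult[of "free_adj x" "x * free_adj x * x - x"]
    by (simp add: right_diff_distrib mult.assoc)
  then have "p (?y * ?y - ?y) = 0"
    using seminorm_nonneg[of "?y * ?y - ?y"] assms by simp
  then have "p ?y \<le> 1"
    by (rule seminorm_idem_selfadj) (simp add: free_adj_mult)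
  then show ?thesis by (simp add: seminorm_cstar power_le_one_iff seminorm_nonneg)
qed

end

lemma zero_admissible: "(\<lambda>_. 0) \<in> admissible_seminorms R"
  by (simp add: admissible_seminorms_def cstar_seminorm_def)

lemma admissible_bounded:
  assumes "\<And>g. \<exists>M. \<forall>p\<in>admissible_seminorms R. p (free_gen g) \<le> M"
  shows "bdd_above ((\<lambda>p. p x) ` admissible_seminorms R)"
proof -
  have sn: "cstar_seminorm p" if "p \<in> admissible_seminorms R" for p
    using that by (simp add: admissible_seminorms_def)
  have letter: "\<exists>M. \<forall>p\<in>admissible_seminorms R. p (Poly_Mapping.single (Star_Word [(g, b)]) 1) \<le> M" for g b
  proof (cases b)
    case True
    have "Poly_Mapping.single (Star_Word [(g, b)]) 1 = free_adj (free_gen g)"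
      by (simp add: free_gen_def free_adj_single True)
    moreover have "p (free_adj (free_gen g)) = p (free_gen g)" if "p \<in> admissible_seminorms R" for p
      using seminorm_adj[OF sn[OF that]] .
    ultimately show ?thesis using assms[of g] by (metis (no_types, lifting))
  qed (use assms[of g] in \<open>simp add: free_gen_def\<close>)
  have word: "\<exists>M. \<forall>p\<in>admissible_seminorms R. p (Poly_Mapping.single (Star_Word w) 1) \<le> M" for w
  proof (induction w)
    case Nil
    then show ?case using seminorm_one[OF sn] by (auto simp: zero_star_word_def[symmetric])
  next
    case (Cons a w)
    obtain g b where a: "a = (g, b)" by (cases a)
    obtain M N where M: "\<And>p. p\<in>admissible_seminorms R \<Longrightarrow> p (Poly_Mapping.single (Star_Word [a]) 1) \<le> M"
      and N: "\<And>p. p\<in>admissible_seminorms R \<Longrightarrow> p (Poly_Mapping.single (Star_Word w) 1) \<le> N"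
      using letter[of g b] Cons.IH a by auto
    have "p (Poly_Mapping.single (Star_Word (a # w)) 1) \<le> M * N" if p: "p \<in> admissible_seminorms R" for p
    proof -
      have "Poly_Mapping.single (Star_Word (a # w)) (1::complex) =
          Poly_Mapping.single (Star_Word [a]) 1 * Poly_Mapping.single (Star_Word w) 1"
        by (simp add: mult_single)
      then have "p (Poly_Mapping.single (Star_Word (a # w)) 1) \<le>
          p (Poly_Mapping.single (Star_Word [a]) 1) * p (Poly_Mapping.single (Star_Word w) 1)"
        using seminorm_mult[OF sn[OF p]] by metis
      also have "\<dots> \<le> M * N"
        by (intro mult_mono M N p seminorm_nonneg[OF sn[OF p]]
            order_trans[OF seminorm_nonneg[OF sn[OF p]] M[OF p]])
      finally show ?thesis .
    qed
    then show ?case by blast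
  qed
  have "\<exists>M. \<forall>p\<in>admissible_seminorms R. p x \<le> M"
  proof (induction x rule: free_algebra_induct)
    case (single w c)
    obtain l where l: "w = Star_Word l" by (cases w)
    obtain M where M: "\<And>p. p\<in>admissible_seminorms R \<Longrightarrow> p (Poly_Mapping.single (Star_Word l) 1) \<le> M"
      using word[of l] by auto
    have "p (Poly_Mapping.single w c) \<le> cmod c * M" if p: "p \<in> admissible_seminorms R" for p
    proof -
      have "Poly_Mapping.single w c = free_scale c (Poly_Mapping.single w 1)"
        by (simp add: free_scale_eq_mult mult_single)
      then show ?thesis
        using seminorm_scale[OF sn[OF p]] M[OF p] l by (simp add: mult_left_mono)
    qed
    then show ?case by blast
  next
    case (add x y)
    then obtain M N where "\<forall>p\<in>admissible_seminorms R. p x \<le> M" "\<forall>p\<in>admissible_seminorms R. p y \<le> N"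
      by blast
    then have "\<forall>p\<in>admissible_seminorms R. p (x + y) \<le> M + N"
      using seminorm_add[OF sn] by (meson add_mono order_trans)
    then show ?case by blast
  qed
  then show ?thesis by (auto simp: bdd_above_def)
qed

context
  fixes R :: "('g free_star_algebra \<times> 'g free_star_algebra) set"
  assumes gens_bounded: "\<And>g. \<exists>M. \<forall>p\<in>admissible_seminorms R. p (free_gen g) \<le> M"
begin

lemma universal_seminorm_upper: "p \<in> admissible_seminorms R \<Longrightarrow> p x \<le> universal_seminorm R x"
  unfolding universal_seminorm_def
  by (rule cSUP_upper[OF _ admissible_bounded[OF gens_bounded]])

lemma universal_seminorm_least:
  "(\<And>p. p \<in> admissible_seminorms R \<Longrightarrow> p x \<le> M) \<Longrightarrow> universal_seminorm R x \<le> M"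
  unfolding universal_seminorm_def
  by (rule cSUP_least) (use zero_admissible in auto)

lemma universal_seminorm_nonneg: "0 \<le> universal_seminorm R x"
  using universal_seminorm_upper[OF zero_admissible] .

lemma cstar_seminorm_universal: "cstar_seminorm (universal_seminorm R)"
proof -
  let ?q = "universal_seminorm R"
  have sn: "cstar_seminorm p" if "p \<in> admissible_seminorms R" for p
    using that by (simp add: admissible_seminorms_def)
  note up = universal_seminorm_upper and nn = universal_seminorm_nonneg
  have add: "?q (x + y) \<le> ?q x + ?q y" for x y
    by (rule universal_seminorm_least) (meson add_mono order_trans seminorm_add sn up)
  have mult: "?q (x * y) \<le> ?q x * ?q y" for x y
    by (rule universal_seminorm_least)
       (meson mult_mono order_trans seminorm_mult seminorm_nonneg sn up nn)
  have scale_le: "?q (free_scale c x) \<le> cmod c * ?q x" for c x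
    by (rule universal_seminorm_least) (simp add: seminorm_scale[OF sn] up mult_left_mono)
  have scale: "?q (free_scale c x) = cmod c * ?q x" for c x
  proof (cases "c = 0")
    case True
    then show ?thesis using scale_le[of c x] nn[of "free_scale c x"] by simp
  next
    case False
    have "?q x \<le> cmod (1/c) * ?q (free_scale c x)"
      using scale_le[of "1/c" "free_scale c x"] False by (simp add: free_scale_scale)
    then have "cmod c * ?q x \<le> ?q (free_scale c x)"
      using False by (simp add: norm_divide field_simps)
    with scale_le[of c x] show ?thesis by simp
  qed
  have cstar: "?q (free_adj x * x) = (?q x)\<^sup>2" for x
  proof (rule antisym)
    show "?q (free_adj x * x) \<le> (?q x)\<^sup>2"
      by (rule universal_seminorm_least)
         (simp add: seminorm_cstar[OF sn] power_mono seminorm_nonneg[OF sn] up)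
    have "?q x \<le> sqrt (?q (free_adj x * x))"
    proof (rule universal_seminorm_least)
      fix p assume p: "p \<in> admissible_seminorms R"
      have "(p x)\<^sup>2 \<le> ?q (free_adj x * x)"
        using up[OF p, of "free_adj x * x"] by (simp add: seminorm_cstar[OF sn[OF p]])
      then show "p x \<le> sqrt (?q (free_adj x * x))"
        by (rule real_le_rsqrt)
    qed
    then show "(?q x)\<^sup>2 \<le> ?q (free_adj x * x)"
      by (metis nn sqrt_le_D real_sqrt_pow2 power_mono)
  qed
  show ?thesis unfolding cstar_seminorm_def using add mult scale cstar by blast
qed

lemma universal_seminorm_relation: "(a, b) \<in> R \<Longrightarrow> universal_seminorm R (a - b) = 0"
  by (rule antisym[OF universal_seminorm_least universal_seminorm_nonneg])
     (auto simp: admissible_seminorms_def)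

end


subsection \<open>The completion\<close>

context
  fixes q :: "'g free_star_algebra \<Rightarrow> real"
  assumes q: "cstar_seminorm q"
begin

lemma cauchy_seqs_iff:
  "f \<in> cauchy_seqs q \<longleftrightarrow> (\<forall>e>0. \<exists>N. \<forall>m\<ge>N. \<forall>n\<ge>N. q (f m - f n) < e)"
  by (simp add: cauchy_seqs_def)

lemma cauchy_seqsI:
  assumes "\<And>m n. q (f m - f n) \<le> K * q (g m - g n) + L * q (h m - h n)"
    and "g \<in> cauchy_seqs q" "h \<in> cauchy_seqs q" and "0 \<le> K" "0 \<le> L"
  shows "f \<in> cauchy_seqs q"
  unfolding cauchy_seqs_iff
proof (intro allI impI)
  fix e :: real assume "e > 0"
  define d where "d = e / (K + L + 1)"
  have d: "d > 0" using \<open>e > 0\<close> assms(4,5) by (simp add: d_def)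
  obtain M N where M: "\<And>m n. m \<ge> M \<Longrightarrow> n \<ge> M \<Longrightarrow> q (g m - g n) < d"
    and N: "\<And>m n. m \<ge> N \<Longrightarrow> n \<ge> N \<Longrightarrow> q (h m - h n) < d"
    using assms(2,3) d unfolding cauchy_seqs_iff by meson
  have "q (f m - f n) < e" if "m \<ge> max M N" "n \<ge> max M N" for m n
  proof -
    have "q (f m - f n) \<le> K * d + L * d"
      using assms(1)[of m n] M[of m n] N[of m n] that assms(4,5)
      by (smt (verit, best) max.bounded_iff mult_left_mono)
    also have "\<dots> < (K + L + 1) * d"
      using d by (simp add: algebra_simps)
    also have "\<dots> = e" using assms(4,5) by (simp add: d_def)
    finally show ?thesis .
  qed
  then show "\<exists>N. \<forall>m\<ge>N. \<forall>n\<ge>N. q (f m - f n) < e" by blast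
qed

lemma cauchy_seqs_const [simp]: "(\<lambda>_. x) \<in> cauchy_seqs q"
  by (simp add: cauchy_seqs_iff seminorm_zero[OF q])

lemma cauchy_seqs_add:
  assumes "f \<in> cauchy_seqs q" "g \<in> cauchy_seqs q"
  shows "(\<lambda>n. f n + g n) \<in> cauchy_seqs q"
proof (rule cauchy_seqsI[OF _ assms, of _ 1 1])
  fix m n
  show "q (f m + g m - (f n + g n)) \<le> 1 * q (f m - f n) + 1 * q (g m - g n)"
    using seminorm_add[OF q, of "f m - f n" "g m - g n"] by (simp add: algebra_simps)
qed auto

lemma cauchy_seqs_scale:
  assumes "f \<in> cauchy_seqs q"
  shows "(\<lambda>n. free_scale c (f n)) \<in> cauchy_seqs q"
  by (rule cauchy_seqsI[OF _ assms assms, of _ "cmod c" 0])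
     (simp_all add: free_scale_diff[symmetric] seminorm_scale[OF q])

lemma cauchy_seqs_adj:
  assumes "f \<in> cauchy_seqs q"
  shows "(\<lambda>n. free_adj (f n)) \<in> cauchy_seqs q"
  by (rule cauchy_seqsI[OF _ assms assms, of _ 1 0])
     (simp_all add: free_adj_diff[symmetric] seminorm_adj[OF q])

lemma cauchy_seqs_convergent:
  assumes "f \<in> cauchy_seqs q"
  shows "convergent (\<lambda>n. q (f n))"
proof -
  have "Cauchy (\<lambda>n. q (f n))"
    unfolding Cauchy_def dist_real_def
  proof (intro allI impI)
    fix e :: real assume "e > 0"
    then obtain N where "\<forall>m\<ge>N. \<forall>n\<ge>N. q (f m - f n) < e"
      using assms unfolding cauchy_seqs_iff by meson
    then show "\<exists>M. \<forall>m\<ge>M. \<forall>n\<ge>M. \<bar>q (f m) - q (f n)\<bar> < e"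
      using seminorm_abs_diff[OF q] by (meson order.strict_trans1)
  qed
  then show ?thesis by (simp add: Cauchy_convergent_iff)
qed

lemma cauchy_seqs_bounded:
  assumes "f \<in> cauchy_seqs q"
  obtains K where "K \<ge> 0" "\<And>n. q (f n) \<le> K"
proof -
  have "Bseq (\<lambda>n. q (f n))"
    using cauchy_seqs_convergent[OF assms] convergent_imp_Bseq by blast
  then obtain K where "K > 0" "\<And>n. norm (q (f n)) \<le> K"
    unfolding Bseq_def by blast
  then show ?thesis using that[of K] by (simp add: abs_le_iff)
qed

lemma seminorm_mult_diff:
  "q (a * b - c * d) \<le> q a * q (b - d) + q (a - c) * q d"
proof -
  have "a * b - c * d = a * (b - d) + (a - c) * d"
    by (simp add: algebra_simps)
  then have "q (a * b - c * d) \<le> q (a * (b - d)) + q ((a - c) * d)"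
    using seminorm_add[OF q] by metis
  then show ?thesis
    using seminorm_mult[OF q, of a "b - d"] seminorm_mult[OF q, of "a - c" d] by linarith
qed

lemma cauchy_seqs_mult:
  assumes "f \<in> cauchy_seqs q" "g \<in> cauchy_seqs q"
  shows "(\<lambda>n. f n * g n) \<in> cauchy_seqs q"
proof -
  obtain K where K: "K \<ge> 0" "\<And>n. q (f n) \<le> K" using cauchy_seqs_bounded[OF assms(1)] by blast
  obtain L where L: "L \<ge> 0" "\<And>n. q (g n) \<le> L" using cauchy_seqs_bounded[OF assms(2)] by blast
  show ?thesis
  proof (rule cauchy_seqsI[OF _ assms(2,1) K(1) L(1)])
    fix m n
    have "q (f m) * q (g m - g n) \<le> K * q (g m - g n)"
      by (intro mult_right_mono K seminorm_nonneg[OF q])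
    moreover have "q (f m - f n) * q (g n) \<le> L * q (f m - f n)"
      using mult_left_mono[OF L(2)[of n] seminorm_nonneg[OF q, of "f m - f n"]]
      by (simp add: mult.commute)
    ultimately show "q (f m * g m - f n * g n) \<le> K * q (g m - g n) + L * q (f m - f n)"
      using seminorm_mult_diff[of "f m" "g m" "f n" "g n"] by linarith
  qed
qed

lemma seminorm_tendsto_zero:
  assumes "\<And>n. q (f n) \<le> g n" "g \<longlonglongrightarrow> 0"
  shows "(\<lambda>n. q (f n)) \<longlonglongrightarrow> 0"
  by (rule tendsto_sandwich[of "\<lambda>_. 0" "\<lambda>n. q (f n)" sequentially g])
     (use assms seminorm_nonneg[OF q] in auto)

lemma same_limit_iff:
  "(f, g) \<in> same_limit q \<longleftrightarrow> f \<in> cauchy_seqs q \<and> g \<in> cauchy_seqs q \<and> (\<lambda>n. q (f n - g n)) \<longlonglongrightarrow> 0"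
  by (simp add: same_limit_def)

lemma equiv_same_limit: "equiv (cauchy_seqs q) (same_limit q)"
proof (rule equivI)
  show "same_limit q \<subseteq> cauchy_seqs q \<times> cauchy_seqs q"
    by (auto simp: same_limit_def)
  show "refl_on (cauchy_seqs q) (same_limit q)"
    by (auto simp: refl_on_def same_limit_iff seminorm_zero[OF q])
  show "sym (same_limit q)"
    by (auto simp: sym_def same_limit_iff seminorm_diff_commute[OF q])
  show "trans (same_limit q)"
  proof (rule transI)
    fix f g h assume fg: "(f, g) \<in> same_limit q" and gh: "(g, h) \<in> same_limit q"
    then have "(\<lambda>n. q (f n - g n) + q (g n - h n)) \<longlonglongrightarrow> 0"
      unfolding same_limit_iff by (auto intro: tendsto_add_zero)
    then have "(\<lambda>n. q (f n - h n)) \<longlonglongrightarrow> 0"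
      by (rule seminorm_tendsto_zero[OF seminorm_triangle[OF q]])
    then show "(f, h) \<in> same_limit q"
      using fg gh by (simp add: same_limit_iff)
  qed
qed

lemma limit_class_eq_iff:
  "f \<in> cauchy_seqs q \<Longrightarrow> g \<in> cauchy_seqs q \<Longrightarrow>
     limit_class q f = limit_class q g \<longleftrightarrow> (\<lambda>n. q (f n - g n)) \<longlonglongrightarrow> 0"
  unfolding limit_class_def
  using eq_equiv_class_iff[OF equiv_same_limit] by (simp add: same_limit_iff)

lemma same_limit_congruent2I:
  assumes "\<And>f f' g g'. (f, f') \<in> same_limit q \<Longrightarrow> (g, g') \<in> same_limit q \<Longrightarrow>
    limit_class q (F f g) = limit_class q (F f' g')"
  shows "congruent2 (same_limit q) (same_limit q) (\<lambda>f g. limit_class q (F f g))"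
  unfolding congruent2_def split_def using assms by (metis prod.collapse)

lemma carrier_completion: "carrier (cstar_completion q) = limit_class q ` cauchy_seqs q"
  unfolding cstar_completion_def limit_class_def quotient_def by auto

lemma limit_class_closed [simp]: "f \<in> cauchy_seqs q \<Longrightarrow> limit_class q f \<in> carrier (cstar_completion q)"
  by (simp add: carrier_completion)

lemma add_completion:
  assumes "f \<in> cauchy_seqs q" "g \<in> cauchy_seqs q"
  shows "limit_class q f \<oplus>\<^bsub>cstar_completion q\<^esub> limit_class q g = limit_class q (\<lambda>n. f n + g n)"
proof -
  have "congruent2 (same_limit q) (same_limit q) (\<lambda>f g. limit_class q (\<lambda>n. f n + g n))"
  proof (rule same_limit_congruent2I)
    fix f f' g g' assume *: "(f, f') \<in> same_limit q" "(g, g') \<in> same_limit q"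
    have "q (f n + g n - (f' n + g' n)) \<le> q (f n - f' n) + q (g n - g' n)" for n
      using seminorm_add[OF q, of "f n - f' n" "g n - g' n"] by (simp add: algebra_simps)
    moreover have "(\<lambda>n. q (f n - f' n) + q (g n - g' n)) \<longlonglongrightarrow> 0"
      using * by (auto simp: same_limit_iff intro: tendsto_add_zero)
    ultimately have "(\<lambda>n. q (f n + g n - (f' n + g' n))) \<longlonglongrightarrow> 0"
      by (rule seminorm_tendsto_zero)
    then show "limit_class q (\<lambda>n. f n + g n) = limit_class q (\<lambda>n. f' n + g' n)"
      using * by (subst limit_class_eq_iff) (auto simp: same_limit_iff cauchy_seqs_add)
  qed
  from UN_equiv_class2[OF equiv_same_limit equiv_same_limit this assms]
  show ?thesis by (simp add: cstar_completion_def limit_class_def)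
qed

lemma mult_completion:
  assumes "f \<in> cauchy_seqs q" "g \<in> cauchy_seqs q"
  shows "limit_class q f \<otimes>\<^bsub>cstar_completion q\<^esub> limit_class q g = limit_class q (\<lambda>n. f n * g n)"
proof -
  have "congruent2 (same_limit q) (same_limit q) (\<lambda>f g. limit_class q (\<lambda>n. f n * g n))"
  proof (rule same_limit_congruent2I)
    fix f f' g g' assume *: "(f, f') \<in> same_limit q" "(g, g') \<in> same_limit q"
    obtain K where K: "K \<ge> 0" "\<And>n. q (f n) \<le> K"
      using * cauchy_seqs_bounded[of f] by (auto simp: same_limit_iff)
    obtain L where L: "L \<ge> 0" "\<And>n. q (g' n) \<le> L"
      using * cauchy_seqs_bounded[of g'] by (auto simp: same_limit_iff)
    have "q (f n * g n - f' n * g' n) \<le> K * q (g n - g' n) + q (f n - f' n) * L" for n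
    proof -
      have "q (f n) * q (g n - g' n) \<le> K * q (g n - g' n)"
        by (intro mult_right_mono K seminorm_nonneg[OF q])
      moreover have "q (f n - f' n) * q (g' n) \<le> q (f n - f' n) * L"
        by (intro mult_left_mono L seminorm_nonneg[OF q])
      ultimately show ?thesis
        using seminorm_mult_diff[of "f n" "g n" "f' n" "g' n"] by linarith
    qed
    moreover have "(\<lambda>n. K * q (g n - g' n) + q (f n - f' n) * L) \<longlonglongrightarrow> 0"
      using * by (auto simp: same_limit_iff intro!: tendsto_add_zero tendsto_mult_right_zero tendsto_mult_left_zero)
    ultimately have "(\<lambda>n. q (f n * g n - f' n * g' n)) \<longlonglongrightarrow> 0"
      by (rule seminorm_tendsto_zero)
    then show "limit_class q (\<lambda>n. f n * g n) = limit_class q (\<lambda>n. f' n * g' n)"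
      using * by (subst limit_class_eq_iff) (auto simp: same_limit_iff cauchy_seqs_mult)
  qed
  from UN_equiv_class2[OF equiv_same_limit equiv_same_limit this assms]
  show ?thesis by (simp add: cstar_completion_def limit_class_def)
qed

lemma smult_completion:
  assumes "f \<in> cauchy_seqs q"
  shows "c \<odot>\<^bsub>cstar_completion q\<^esub> limit_class q f = limit_class q (\<lambda>n. free_scale c (f n))"
proof -
  have "congruent (same_limit q) (\<lambda>f. limit_class q (\<lambda>n. free_scale c (f n)))"
  proof (rule congruentI)
    fix f f' assume *: "(f, f') \<in> same_limit q"
    have "(\<lambda>n. q (free_scale c (f n) - free_scale c (f' n))) \<longlonglongrightarrow> 0"
      using * by (auto simp: same_limit_iff free_scale_diff[symmetric] seminorm_scale[OF q]
          intro: tendsto_mult_right_zero)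
    then show "limit_class q (\<lambda>n. free_scale c (f n)) = limit_class q (\<lambda>n. free_scale c (f' n))"
      using * by (subst limit_class_eq_iff) (auto simp: same_limit_iff cauchy_seqs_scale)
  qed
  from UN_equiv_class[OF equiv_same_limit this assms]
  show ?thesis by (simp add: cstar_completion_def limit_class_def)
qed

lemma cadj_completion:
  assumes "f \<in> cauchy_seqs q"
  shows "cadj (cstar_completion q) (limit_class q f) = limit_class q (\<lambda>n. free_adj (f n))"
proof -
  have "congruent (same_limit q) (\<lambda>f. limit_class q (\<lambda>n. free_adj (f n)))"
  proof (rule congruentI)
    fix f f' assume *: "(f, f') \<in> same_limit q"
    have "(\<lambda>n. q (free_adj (f n) - free_adj (f' n))) \<longlonglongrightarrow> 0"
      using * by (auto simp: same_limit_iff free_adj_diff[symmetric] seminorm_adj[OF q])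
    then show "limit_class q (\<lambda>n. free_adj (f n)) = limit_class q (\<lambda>n. free_adj (f' n))"
      using * by (subst limit_class_eq_iff) (auto simp: same_limit_iff cauchy_seqs_adj)
  qed
  from UN_equiv_class[OF equiv_same_limit this assms]
  show ?thesis by (simp add: cstar_completion_def limit_class_def)
qed

lemma cnorm_completion:
  assumes "f \<in> cauchy_seqs q" "(\<lambda>n. q (f n)) \<longlonglongrightarrow> r"
  shows "cnorm (cstar_completion q) (limit_class q f) = r"
proof -
  have "\<forall>g\<in>limit_class q f. (\<lambda>n. q (g n)) \<longlonglongrightarrow> r"
  proof
    fix g assume "g \<in> limit_class q f"
    then have "(\<lambda>n. q (f n - g n)) \<longlonglongrightarrow> 0"
      by (simp add: limit_class_def same_limit_iff)
    then have "(\<lambda>n. q (g n) - q (f n)) \<longlonglongrightarrow> 0"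
      by (rule Lim_null_comparison[rotated])
         (use seminorm_abs_diff[OF q] in \<open>simp add: abs_minus_commute\<close>)
    from tendsto_add[OF this assms(2)] show "(\<lambda>n. q (g n)) \<longlonglongrightarrow> r" by simp
  qed
  moreover have "f \<in> limit_class q f"
    using assms by (simp add: limit_class_def same_limit_iff seminorm_zero[OF q])
  ultimately have "(THE r. \<forall>g\<in>limit_class q f. (\<lambda>n. q (g n)) \<longlonglongrightarrow> r) = r"
    by (intro the_equality) (auto intro: LIMSEQ_unique)
  then show ?thesis by (simp add: cstar_completion_def)
qed

lemma cnorm_tendsto:
  assumes "f \<in> cauchy_seqs q"
  shows "(\<lambda>n. q (f n)) \<longlonglongrightarrow> cnorm (cstar_completion q) (limit_class q f)"
  using cauchy_seqs_convergent[OF assms] cnorm_completion[OF assms] by (auto simp: convergent_def)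

lemma zero_completion: "\<zero>\<^bsub>cstar_completion q\<^esub> = limit_class q (\<lambda>n. 0)"
  and one_completion: "\<one>\<^bsub>cstar_completion q\<^esub> = limit_class q (\<lambda>n. 1)"
  by (simp_all add: cstar_completion_def)

lemmas completion_ops = add_completion mult_completion smult_completion cadj_completion
  zero_completion one_completion
lemmas cauchy_intros = cauchy_seqs_const cauchy_seqs_add cauchy_seqs_mult cauchy_seqs_scale cauchy_seqs_adj

lemma completion_cases:
  assumes "X \<in> carrier (cstar_completion q)"
  obtains f where "f \<in> cauchy_seqs q" "X = limit_class q f"
  using assms by (auto simp: carrier_completion)

lemma ring_completion: "ring (cstar_completion q)"
proof (rule ringI)
  show "abelian_group (cstar_completion q)"
  proof (rule abelian_groupI)
    fix X assume "X \<in> carrier (cstar_completion q)"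
    then obtain f where f: "f \<in> cauchy_seqs q" "X = limit_class q f" by (rule completion_cases)
    show "\<exists>Y\<in>carrier (cstar_completion q). Y \<oplus>\<^bsub>cstar_completion q\<^esub> X = \<zero>\<^bsub>cstar_completion q\<^esub>"
    proof
      have "(-1) \<odot>\<^bsub>cstar_completion q\<^esub> X \<oplus>\<^bsub>cstar_completion q\<^esub> X = limit_class q (\<lambda>n. free_scale (-1) (f n) + f n)"
        using f by (simp add: completion_ops cauchy_intros)
      then show "(-1) \<odot>\<^bsub>cstar_completion q\<^esub> X \<oplus>\<^bsub>cstar_completion q\<^esub> X = \<zero>\<^bsub>cstar_completion q\<^esub>"
        by (simp add: free_scale_minus_one zero_completion)
      show "(-1) \<odot>\<^bsub>cstar_completion q\<^esub> X \<in> carrier (cstar_completion q)"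
        using f by (simp add: completion_ops cauchy_intros)
    qed
  qed (auto elim!: completion_cases simp: completion_ops cauchy_intros add_ac)
  show "monoid (cstar_completion q)"
    by (rule monoidI) (auto elim!: completion_cases simp: completion_ops cauchy_intros mult.assoc)
qed (auto elim!: completion_cases simp: completion_ops cauchy_intros distrib_left distrib_right)

lemma minus_completion:
  assumes "f \<in> cauchy_seqs q" "g \<in> cauchy_seqs q"
  shows "limit_class q f \<ominus>\<^bsub>cstar_completion q\<^esub> limit_class q g = limit_class q (\<lambda>n. f n - g n)"
proof -
  interpret ring "cstar_completion q" by (rule ring_completion)
  have "(\<lambda>n. f n + free_scale (-1) (g n)) \<in> cauchy_seqs q"
    by (intro cauchy_intros assms)
  then have c: "(\<lambda>n. f n - g n) \<in> cauchy_seqs q"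
    by (simp add: free_scale_minus_one)
  have "limit_class q (\<lambda>n. f n - g n) \<oplus>\<^bsub>cstar_completion q\<^esub> limit_class q g = limit_class q f"
    using assms c by (simp add: completion_ops)
  moreover have "limit_class q (\<lambda>n. f n - g n) \<oplus>\<^bsub>cstar_completion q\<^esub> limit_class q g \<ominus>\<^bsub>cstar_completion q\<^esub> limit_class q g =
      limit_class q (\<lambda>n. f n - g n)"
    using limit_class_closed[OF c] limit_class_closed[OF assms(2)]
    by (simp only: minus_eq a_assoc r_neg r_zero a_inv_closed)
  ultimately show ?thesis by simp
qed

lemma cauchy_seqs_diff:
  assumes "f \<in> cauchy_seqs q" "g \<in> cauchy_seqs q"
  shows "(\<lambda>n. f n - g n) \<in> cauchy_seqs q"
  using cauchy_seqs_add[OF assms(1) cauchy_seqs_scale[OF assms(2), of "-1"]]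
  by (simp add: free_scale_minus_one)

lemma cnorm_const: "cnorm (cstar_completion q) (limit_class q (\<lambda>_. x)) = q x"
  by (rule cnorm_completion) auto

lemma cnorm_diff_const_bound:
  assumes f: "f \<in> cauchy_seqs q" and "e > 0"
  shows "\<exists>N. \<forall>k\<ge>N. cnorm (cstar_completion q) (limit_class q f \<ominus>\<^bsub>cstar_completion q\<^esub> limit_class q (\<lambda>_. f k)) \<le> e"
proof -
  obtain N where N: "\<And>m n. m \<ge> N \<Longrightarrow> n \<ge> N \<Longrightarrow> q (f m - f n) < e"
    using f \<open>e > 0\<close> unfolding cauchy_seqs_iff by meson
  have "cnorm (cstar_completion q) (limit_class q f \<ominus>\<^bsub>cstar_completion q\<^esub> limit_class q (\<lambda>_. f k)) \<le> e" if "k \<ge> N" for k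
  proof -
    have c: "(\<lambda>n. f n - f k) \<in> cauchy_seqs q"
      by (rule cauchy_seqs_diff[OF f cauchy_seqs_const])
    have "cnorm (cstar_completion q) (limit_class q (\<lambda>n. f n - f k)) \<le> e"
      by (rule Lim_bounded[OF cnorm_tendsto[OF c], of N])
         (use N[OF _ that] in \<open>auto intro: less_imp_le\<close>)
    then show ?thesis by (simp add: minus_completion f)
  qed
  then show ?thesis by blast
qed

lemma unital_cstar_algebra_completion: "unital_cstar_algebra (cstar_completion q)"
proof -
  interpret ring "cstar_completion q" by (rule ring_completion)
  have add: "cnorm (cstar_completion q) (X \<oplus>\<^bsub>cstar_completion q\<^esub> Y) \<le> cnorm (cstar_completion q) X + cnorm (cstar_completion q) Y" if "X \<in> carrier (cstar_completion q)" "Y \<in> carrier (cstar_completion q)" for X Y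
  proof -
    obtain f g where f: "f \<in> cauchy_seqs q" "X = limit_class q f"
      and g: "g \<in> cauchy_seqs q" "Y = limit_class q g"
      using \<open>X \<in> carrier (cstar_completion q)\<close> \<open>Y \<in> carrier (cstar_completion q)\<close> by (auto elim!: completion_cases)
    show ?thesis
      using LIMSEQ_le[OF cnorm_tendsto[OF cauchy_seqs_add[OF f(1) g(1)]]
          tendsto_add[OF cnorm_tendsto[OF f(1)] cnorm_tendsto[OF g(1)]]]
      by (simp add: f g completion_ops seminorm_add[OF q])
  qed
  have diff_commute: "cnorm (cstar_completion q) (X \<ominus>\<^bsub>cstar_completion q\<^esub> Y) = cnorm (cstar_completion q) (Y \<ominus>\<^bsub>cstar_completion q\<^esub> X)"
    if "X \<in> carrier (cstar_completion q)" "Y \<in> carrier (cstar_completion q)" for X Y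
  proof -
    obtain f g where f: "f \<in> cauchy_seqs q" "X = limit_class q f"
      and g: "g \<in> cauchy_seqs q" "Y = limit_class q g"
      using \<open>X \<in> carrier (cstar_completion q)\<close> \<open>Y \<in> carrier (cstar_completion q)\<close> by (auto elim!: completion_cases)
    have "cnorm (cstar_completion q) (limit_class q (\<lambda>n. f n - g n)) = cnorm (cstar_completion q) (limit_class q (\<lambda>n. g n - f n))"
      by (rule cnorm_completion[OF cauchy_seqs_diff[OF f(1) g(1)]])
         (subst seminorm_diff_commute[OF q], rule cnorm_tendsto[OF cauchy_seqs_diff[OF g(1) f(1)]])
    then show ?thesis by (simp add: f g minus_completion)
  qed
  have triangle: "cnorm (cstar_completion q) (X \<ominus>\<^bsub>cstar_completion q\<^esub> Z) \<le> cnorm (cstar_completion q) (X \<ominus>\<^bsub>cstar_completion q\<^esub> Y) + cnorm (cstar_completion q) (Y \<ominus>\<^bsub>cstar_completion q\<^esub> Z)"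
    if "X \<in> carrier (cstar_completion q)" "Y \<in> carrier (cstar_completion q)" "Z \<in> carrier (cstar_completion q)" for X Y Z
  proof -
    have "X \<ominus>\<^bsub>cstar_completion q\<^esub> Z = (X \<ominus>\<^bsub>cstar_completion q\<^esub> Y) \<oplus>\<^bsub>cstar_completion q\<^esub> (Y \<ominus>\<^bsub>cstar_completion q\<^esub> Z)"
      using that by (simp add: minus_eq a_assoc) (metis a_assoc a_inv_closed l_neg l_zero)
    then show ?thesis using add that by simp
  qed
  show ?thesis
  proof unfold_locales
    fix X assume "X \<in> carrier (cstar_completion q)"
    then obtain f where f: "f \<in> cauchy_seqs q" "X = limit_class q f" by (rule completion_cases)
    show "cnorm (cstar_completion q) X = 0 \<longleftrightarrow> X = \<zero>\<^bsub>cstar_completion q\<^esub>"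
      using f cnorm_completion[of f 0] cnorm_tendsto[of f]
      by (auto simp: zero_completion limit_class_eq_iff)
    fix c
    show "cnorm (cstar_completion q) (c \<odot>\<^bsub>cstar_completion q\<^esub> X) = cmod c * cnorm (cstar_completion q) X"
      using cnorm_completion[OF cauchy_seqs_scale[OF f(1), of c], of "cmod c * cnorm (cstar_completion q) X"]
        tendsto_mult[OF tendsto_const cnorm_tendsto[OF f(1)], of "cmod c"]
      by (simp add: f smult_completion seminorm_scale[OF q])
    show "cnorm (cstar_completion q) (cadj (cstar_completion q) X \<otimes>\<^bsub>cstar_completion q\<^esub> X) = (cnorm (cstar_completion q) X)\<^sup>2"
      using cnorm_completion[OF cauchy_seqs_mult[OF cauchy_seqs_adj[OF f(1)] f(1)], of "(cnorm (cstar_completion q) X)\<^sup>2"]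
        tendsto_power[OF cnorm_tendsto[OF f(1)], of 2]
      by (simp add: f cadj_completion mult_completion cauchy_intros seminorm_cstar[OF q])
  next
    fix X Y assume "X \<in> carrier (cstar_completion q)" "Y \<in> carrier (cstar_completion q)"
    then obtain f g where f: "f \<in> cauchy_seqs q" "X = limit_class q f"
      and g: "g \<in> cauchy_seqs q" "Y = limit_class q g" by (auto elim!: completion_cases)
    show "cnorm (cstar_completion q) (X \<otimes>\<^bsub>cstar_completion q\<^esub> Y) \<le> cnorm (cstar_completion q) X * cnorm (cstar_completion q) Y"
      using LIMSEQ_le[OF cnorm_tendsto[OF cauchy_seqs_mult[OF f(1) g(1)]]
          tendsto_mult[OF cnorm_tendsto[OF f(1)] cnorm_tendsto[OF g(1)]]]
      by (simp add: f g completion_ops seminorm_mult[OF q])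
  next
    fix F :: "nat \<Rightarrow> (nat \<Rightarrow> 'g free_star_algebra) set"
    assume F: "\<And>n. F n \<in> carrier (cstar_completion q)"
      and cau: "\<And>e. e > 0 \<Longrightarrow> \<exists>N. \<forall>m\<ge>N. \<forall>n\<ge>N. cnorm (cstar_completion q) (F m \<ominus>\<^bsub>cstar_completion q\<^esub> F n) < e"
    have "\<exists>a. cnorm (cstar_completion q) (F k \<ominus>\<^bsub>cstar_completion q\<^esub> limit_class q (\<lambda>_. a)) \<le> 1 / Suc k" for k
    proof -
      obtain f where "f \<in> cauchy_seqs q" "F k = limit_class q f" using F by (rule completion_cases)
      then show ?thesis using cnorm_diff_const_bound[of f "1 / Suc k"] by force
    qed
    then obtain a where a: "\<And>k. cnorm (cstar_completion q) (F k \<ominus>\<^bsub>cstar_completion q\<^esub> limit_class q (\<lambda>_. a k)) \<le> 1 / Suc k"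
      by metis
    have small: "\<exists>N. \<forall>k\<ge>N. 1 / Suc k < e" if "e > 0" for e :: real
      using order_tendstoD(2)[OF LIMSEQ_inverse_real_of_nat that]
      by (simp add: eventually_sequentially inverse_eq_divide)
    have aC: "a \<in> cauchy_seqs q"
      unfolding cauchy_seqs_iff
    proof (intro allI impI)
      fix e :: real assume "e > 0"
      obtain N1 where N1: "\<And>k. k \<ge> N1 \<Longrightarrow> 1 / Suc k < e / 3" using small[of "e / 3"] \<open>e > 0\<close> by auto
      obtain N2 where N2: "\<And>m n. m \<ge> N2 \<Longrightarrow> n \<ge> N2 \<Longrightarrow> cnorm (cstar_completion q) (F m \<ominus>\<^bsub>cstar_completion q\<^esub> F n) < e / 3"
        using cau[of "e / 3"] \<open>e > 0\<close> by auto
      have "q (a m - a n) < e" if mn: "m \<ge> max N1 N2" "n \<ge> max N1 N2" for m n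
      proof -
        let ?c = "\<lambda>k. limit_class q (\<lambda>_. a k)"
        have "q (a m - a n) = cnorm (cstar_completion q) (?c m \<ominus>\<^bsub>cstar_completion q\<^esub> ?c n)"
          by (simp add: minus_completion cnorm_const)
        also have "\<dots> \<le> cnorm (cstar_completion q) (?c m \<ominus>\<^bsub>cstar_completion q\<^esub> F m) + (cnorm (cstar_completion q) (F m \<ominus>\<^bsub>cstar_completion q\<^esub> F n) + cnorm (cstar_completion q) (F n \<ominus>\<^bsub>cstar_completion q\<^esub> ?c n))"
          using triangle[of "?c m" "F m" "?c n"] triangle[of "F m" "F n" "?c n"] F by simp
        also have "\<dots> < e"
          using diff_commute[of "?c m" "F m"] F a[of m] a[of n] N1[of m] N1[of n] N2[of m n] mn by simp
        finally show ?thesis .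
      qed
      then show "\<exists>N. \<forall>m\<ge>N. \<forall>n\<ge>N. q (a m - a n) < e" by blast
    qed
    show "\<exists>X\<in>carrier (cstar_completion q). (\<lambda>n. cnorm (cstar_completion q) (F n \<ominus>\<^bsub>cstar_completion q\<^esub> X)) \<longlonglongrightarrow> 0"
    proof
      show "limit_class q a \<in> carrier (cstar_completion q)" using aC by simp
      show "(\<lambda>n. cnorm (cstar_completion q) (F n \<ominus>\<^bsub>cstar_completion q\<^esub> limit_class q a)) \<longlonglongrightarrow> 0"
      proof (rule LIMSEQ_I)
        fix e :: real assume "e > 0"
        obtain N1 where N1: "\<And>k. k \<ge> N1 \<Longrightarrow> 1 / Suc k < e / 2" using small[of "e / 2"] \<open>e > 0\<close> by auto
        obtain N2 where N2: "\<And>k. k \<ge> N2 \<Longrightarrow>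
            cnorm (cstar_completion q) (limit_class q a \<ominus>\<^bsub>cstar_completion q\<^esub> limit_class q (\<lambda>_. a k)) \<le> e / 2"
          using cnorm_diff_const_bound[OF aC, of "e / 2"] \<open>e > 0\<close> by auto
        have "norm (cnorm (cstar_completion q) (F n \<ominus>\<^bsub>cstar_completion q\<^esub> limit_class q a) - 0) < e" if n: "n \<ge> max N1 N2" for n
        proof -
          have "cnorm (cstar_completion q) (F n \<ominus>\<^bsub>cstar_completion q\<^esub> limit_class q a) < e"
            using triangle[OF F limit_class_closed limit_class_closed[OF aC], of "\<lambda>_. a n" n]
              diff_commute[of "limit_class q (\<lambda>_. a n)" "limit_class q a"] aC
              a[of n] N1[of n] N2[of n] n by simp
          moreover have "cnorm (cstar_completion q) (F n \<ominus>\<^bsub>cstar_completion q\<^esub> limit_class q a) \<ge> 0"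
          proof -
            have "F n \<ominus>\<^bsub>cstar_completion q\<^esub> limit_class q a \<in> carrier (cstar_completion q)" using F aC by simp
            then obtain h where h: "h \<in> cauchy_seqs q" "F n \<ominus>\<^bsub>cstar_completion q\<^esub> limit_class q a = limit_class q h"
              by (rule completion_cases)
            show ?thesis
              unfolding h(2) by (rule LIMSEQ_le_const[OF cnorm_tendsto[OF h(1)]])
                (simp add: seminorm_nonneg[OF q])
          qed
          ultimately show ?thesis by simp
        qed
        then show "\<exists>N. \<forall>n\<ge>N. norm (cnorm (cstar_completion q) (F n \<ominus>\<^bsub>cstar_completion q\<^esub> limit_class q a) - 0) < e" by blast
      qed
    qed
  qed (auto elim!: completion_cases simp: add completion_ops cauchy_intros free_scale_add
      free_scale_add_scalar free_scale_scale free_scale_mult_left free_scale_mult_right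
      free_adj_add free_adj_mult free_adj_scale)
qed

end


subsection \<open>Evaluation of \<open>*\<close>-polynomials in a \<open>C\<^sup>*\<close>-algebra\<close>

context unital_cstar_algebra
begin

lemma smult_zero_scalar: "x \<in> carrier A \<Longrightarrow> 0 \<odot> x = \<zero>"
  using smult_add_scalar[of x 0 0] smult_closed[of x 0] by (metis add.r_cancel_one' add_0)

lemma smult_minus_one: "x \<in> carrier A \<Longrightarrow> (-1) \<odot> x = \<ominus> x"
  using smult_add_scalar[of x "-1" 1] smult_closed[of x "-1"] smult_zero_scalar[of x]
  by (simp add: smult_one minus_equality)

lemma smult_uminus: "x \<in> carrier A \<Longrightarrow> c \<odot> (\<ominus> x) = \<ominus> (c \<odot> x)"
  using smult_smult[of x c "-1"] smult_smult[of x "-1" c] smult_closed[of x c]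
  by (simp add: smult_minus_one)

lemma smult_zero: "c \<odot> \<zero> = \<zero>"
  using smult_smult[of \<zero> c 0] smult_zero_scalar[of \<zero>] by simp

lemma cadj_zero: "cadj A \<zero> = \<zero>"
  using cadj_smult[of \<zero> 0] cadj_closed[of \<zero>] by (simp add: smult_zero_scalar)

lemma cadj_uminus: "x \<in> carrier A \<Longrightarrow> cadj A (\<ominus> x) = \<ominus> (cadj A x)"
  using cadj_smult[of x "-1"] cadj_closed[of x] by (simp add: smult_minus_one)

lemma cadj_one: "cadj A \<one> = \<one>"
proof -
  have c: "cadj A \<one> \<in> carrier A" by (simp add: cadj_closed)
  have "cadj A (cadj A \<one> \<otimes> \<one>) = cadj A \<one> \<otimes> cadj A (cadj A \<one>)"
    by (rule cadj_mult) (simp_all add: c)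
  then show ?thesis using c by (simp add: cadj_cadj)
qed

lemma cnorm_zero: "cnorm A \<zero> = 0"
  by (simp add: cnorm_eq_zero)

lemma cnorm_minus: "x \<in> carrier A \<Longrightarrow> cnorm A (\<ominus> x) = cnorm A x"
  using cnorm_smult[of x "-1"] by (simp add: smult_minus_one)

lemma cnorm_nonneg: "x \<in> carrier A \<Longrightarrow> 0 \<le> cnorm A x"
  using cnorm_add[of x "\<ominus> x"] by (simp add: cnorm_minus r_neg cnorm_zero)

lemma cnorm_le_cadj: "x \<in> carrier A \<Longrightarrow> cnorm A x \<le> cnorm A (cadj A x)"
proof (cases "cnorm A x = 0")
  case False
  assume x: "x \<in> carrier A"
  then have "cnorm A x > 0" using False cnorm_nonneg[of x] by simp
  moreover have "cnorm A x * cnorm A x \<le> cnorm A (cadj A x) * cnorm A x"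
    using cnorm_mult[of "cadj A x" x] x by (simp add: cstar_identity power2_eq_square cadj_closed)
  ultimately show ?thesis by simp
qed (simp add: cnorm_nonneg cadj_closed)

lemma cnorm_cadj: "x \<in> carrier A \<Longrightarrow> cnorm A (cadj A x) = cnorm A x"
  using cnorm_le_cadj[of x] cnorm_le_cadj[of "cadj A x"] by (simp add: cadj_cadj cadj_closed)

lemma minus_add_minus:
  assumes "a \<in> carrier A" "b \<in> carrier A" "c \<in> carrier A" "d \<in> carrier A"
  shows "(a \<oplus> b) \<ominus> (c \<oplus> d) = (a \<ominus> c) \<oplus> (b \<ominus> d)"
  using assms by (simp add: minus_eq minus_add a_ac)

lemma minus_triangle:
  assumes "a \<in> carrier A" "b \<in> carrier A" "c \<in> carrier A"
  shows "cnorm A (a \<ominus> c) \<le> cnorm A (a \<ominus> b) + cnorm A (b \<ominus> c)"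
proof -
  have "(a \<ominus> b) \<oplus> (b \<ominus> c) = (a \<oplus> b) \<ominus> (b \<oplus> c)"
    using assms by (simp add: minus_add_minus)
  also have "\<dots> = (a \<oplus> b) \<ominus> (c \<oplus> b)"
    using assms by (simp add: a_comm)
  also have "\<dots> = a \<ominus> c"
    using assms by (simp add: minus_add_minus) (simp add: minus_eq r_neg)
  finally show ?thesis
    using cnorm_add[of "a \<ominus> b" "b \<ominus> c"] assms by simp
qed

lemma minus_commute_norm:
  assumes "a \<in> carrier A" "b \<in> carrier A"
  shows "cnorm A (a \<ominus> b) = cnorm A (b \<ominus> a)"
proof -
  have "\<ominus> (a \<ominus> b) = b \<ominus> a"
    using assms by (simp add: minus_eq minus_add a_comm)
  then show ?thesis using cnorm_minus[of "a \<ominus> b"] assms by simp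
qed

definition norm_limit :: "(nat \<Rightarrow> 'a) \<Rightarrow> 'a \<Rightarrow> bool" where
  "norm_limit f x \<longleftrightarrow> (\<forall>n. f n \<in> carrier A) \<and> x \<in> carrier A \<and> (\<lambda>n. cnorm A (f n \<ominus> x)) \<longlonglongrightarrow> 0"

lemma norm_limitI:
  assumes "\<And>n. f n \<in> carrier A" "x \<in> carrier A" "\<And>n. cnorm A (f n \<ominus> x) \<le> g n" "g \<longlonglongrightarrow> 0"
  shows "norm_limit f x"
proof -
  have "(\<lambda>n. cnorm A (f n \<ominus> x)) \<longlonglongrightarrow> 0"
    by (rule tendsto_sandwich[of "\<lambda>_. 0" "\<lambda>n. cnorm A (f n \<ominus> x)" sequentially g])
       (use assms in \<open>auto simp: cnorm_nonneg\<close>)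
  then show ?thesis using assms by (simp add: norm_limit_def)
qed

lemma norm_limit_const: "x \<in> carrier A \<Longrightarrow> norm_limit (\<lambda>_. x) x"
  by (simp add: norm_limit_def minus_eq r_neg cnorm_zero)

lemma norm_limit_unique:
  assumes "norm_limit f x" "norm_limit f y"
  shows "x = y"
proof -
  have "(\<lambda>n. cnorm A (f n \<ominus> x) + cnorm A (f n \<ominus> y)) \<longlonglongrightarrow> 0"
    using assms by (auto simp: norm_limit_def intro: tendsto_add_zero)
  moreover have "cnorm A (x \<ominus> y) \<le> cnorm A (f n \<ominus> x) + cnorm A (f n \<ominus> y)" for n
    using minus_triangle[of x "f n" y] minus_commute_norm[of x "f n"] assms
    by (simp add: norm_limit_def)
  ultimately have "cnorm A (x \<ominus> y) \<le> 0"
    by (intro LIMSEQ_le_const) auto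
  then have "cnorm A (x \<ominus> y) = 0"
    using cnorm_nonneg[of "x \<ominus> y"] assms by (simp add: norm_limit_def)
  then have "x \<oplus> \<ominus> y = \<zero>" using assms by (simp add: cnorm_eq_zero norm_limit_def minus_eq)
  then have "\<ominus> (\<ominus> y) = x" using assms by (intro minus_equality) (auto simp: norm_limit_def)
  then show ?thesis using assms by (simp add: norm_limit_def)
qed

lemma norm_limit_add:
  assumes "norm_limit f x" "norm_limit g y"
  shows "norm_limit (\<lambda>n. f n \<oplus> g n) (x \<oplus> y)"
proof (rule norm_limitI[where g = "\<lambda>n. cnorm A (f n \<ominus> x) + cnorm A (g n \<ominus> y)"])
  show "cnorm A (f n \<oplus> g n \<ominus> (x \<oplus> y)) \<le> cnorm A (f n \<ominus> x) + cnorm A (g n \<ominus> y)" for n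
    using cnorm_add[of "f n \<ominus> x" "g n \<ominus> y"] assms by (simp add: norm_limit_def minus_add_minus)
qed (use assms in \<open>auto simp: norm_limit_def intro: tendsto_add_zero\<close>)

lemma norm_limit_smult:
  assumes "norm_limit f x"
  shows "norm_limit (\<lambda>n. c \<odot> f n) (c \<odot> x)"
proof (rule norm_limitI[where g = "\<lambda>n. cmod c * cnorm A (f n \<ominus> x)"])
  fix n
  have "f n \<in> carrier A" "x \<in> carrier A" using assms by (auto simp: norm_limit_def)
  then have "c \<odot> f n \<ominus> c \<odot> x = c \<odot> (f n \<ominus> x)"
    by (simp add: minus_eq smult_add smult_uminus)
  then show "cnorm A (c \<odot> f n \<ominus> c \<odot> x) \<le> cmod c * cnorm A (f n \<ominus> x)"
    using \<open>f n \<in> carrier A\<close> \<open>x \<in> carrier A\<close> by (simp add: cnorm_smult)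
qed (use assms in \<open>auto simp: norm_limit_def smult_closed intro: tendsto_mult_right_zero\<close>)

lemma norm_limit_cadj:
  assumes "norm_limit f x"
  shows "norm_limit (\<lambda>n. cadj A (f n)) (cadj A x)"
proof (rule norm_limitI[where g = "\<lambda>n. cnorm A (f n \<ominus> x)"])
  fix n
  have fx: "f n \<in> carrier A" "x \<in> carrier A" using assms by (auto simp: norm_limit_def)
  then have "cadj A (f n) \<ominus> cadj A x = cadj A (f n \<ominus> x)"
    by (simp add: minus_eq cadj_add cadj_uminus)
  then show "cnorm A (cadj A (f n) \<ominus> cadj A x) \<le> cnorm A (f n \<ominus> x)"
    using fx by (simp add: cnorm_cadj)
qed (use assms in \<open>auto simp: norm_limit_def cadj_closed\<close>)

lemma norm_limit_cnorm:
  assumes "norm_limit f x"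
  shows "(\<lambda>n. cnorm A (f n)) \<longlonglongrightarrow> cnorm A x"
proof -
  have "norm (cnorm A (f n) - cnorm A x) \<le> cnorm A (f n \<ominus> x)" for n
  proof -
    have fx: "f n \<in> carrier A" "x \<in> carrier A" using assms by (auto simp: norm_limit_def)
    have e: "a \<ominus> \<zero> = a" if "a \<in> carrier A" for a using that by (simp add: a_minus_def)
    have "cnorm A (f n) \<le> cnorm A (f n \<ominus> x) + cnorm A x"
      using minus_triangle[of "f n" x \<zero>] fx by (simp only: e zero_closed)
    moreover have "cnorm A x \<le> cnorm A (f n \<ominus> x) + cnorm A (f n)"
      using minus_triangle[of x "f n" \<zero>] fx minus_commute_norm[of x "f n"] by (simp only: e zero_closed)
    ultimately show ?thesis by simp
  qed
  then have "(\<lambda>n. cnorm A (f n) - cnorm A x) \<longlonglongrightarrow> 0"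
    using assms unfolding norm_limit_def
    by (intro Lim_null_comparison[of "\<lambda>n. cnorm A (f n) - cnorm A x" "\<lambda>n. cnorm A (f n \<ominus> x)"]) simp_all
  from tendsto_add[OF this tendsto_const, of "cnorm A x"] show ?thesis by simp
qed

lemma norm_limit_mult:
  assumes "norm_limit f x" "norm_limit g y"
  shows "norm_limit (\<lambda>n. f n \<otimes> g n) (x \<otimes> y)"
proof (rule norm_limitI[where g = "\<lambda>n. cnorm A (f n) * cnorm A (g n \<ominus> y) + cnorm A (f n \<ominus> x) * cnorm A y"])
  show "(\<lambda>n. cnorm A (f n) * cnorm A (g n \<ominus> y) + cnorm A (f n \<ominus> x) * cnorm A y) \<longlonglongrightarrow> 0"
    using tendsto_add[OF tendsto_mult[OF norm_limit_cnorm[OF assms(1)], of "\<lambda>n. cnorm A (g n \<ominus> y)" 0]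
        tendsto_mult_left_zero[of "\<lambda>n. cnorm A (f n \<ominus> x)" sequentially "cnorm A y"]] assms
    by (simp add: norm_limit_def)
  fix n
  have c: "f n \<in> carrier A" "x \<in> carrier A" "g n \<in> carrier A" "y \<in> carrier A"
    using assms by (auto simp: norm_limit_def)
  have "f n \<otimes> (g n \<ominus> y) \<oplus> (f n \<ominus> x) \<otimes> y = (f n \<otimes> g n \<ominus> f n \<otimes> y) \<oplus> (f n \<otimes> y \<ominus> x \<otimes> y)"
    using c by (simp add: minus_eq r_distr l_distr r_minus l_minus)
  also have "\<dots> = (f n \<otimes> g n \<oplus> f n \<otimes> y) \<ominus> (x \<otimes> y \<oplus> f n \<otimes> y)"
    using c by (simp add: minus_add_minus[symmetric] a_comm)
  also have "\<dots> = f n \<otimes> g n \<ominus> x \<otimes> y"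
    using c by (simp add: minus_add_minus) (simp add: minus_eq r_neg)
  finally have "cnorm A (f n \<otimes> g n \<ominus> x \<otimes> y) \<le> cnorm A (f n \<otimes> (g n \<ominus> y)) + cnorm A ((f n \<ominus> x) \<otimes> y)"
    using cnorm_add[of "f n \<otimes> (g n \<ominus> y)" "(f n \<ominus> x) \<otimes> y"] c by simp
  then show "cnorm A (f n \<otimes> g n \<ominus> x \<otimes> y) \<le> cnorm A (f n) * cnorm A (g n \<ominus> y) + cnorm A (f n \<ominus> x) * cnorm A y"
    using cnorm_mult[of "f n" "g n \<ominus> y"] cnorm_mult[of "f n \<ominus> x" y] c by simp
qed (use assms in \<open>auto simp: norm_limit_def\<close>)

end

primrec eval_letters :: "('b, 'm) cstar_scheme \<Rightarrow> ('g \<Rightarrow> 'b) \<Rightarrow> ('g \<times> bool) list \<Rightarrow> 'b" where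
  "eval_letters A h [] = \<one>\<^bsub>A\<^esub>"
| "eval_letters A h (x # w) =
     (if snd x then cadj A (h (fst x)) else h (fst x)) \<otimes>\<^bsub>A\<^esub> eval_letters A h w"

primrec eval_word :: "('b, 'm) cstar_scheme \<Rightarrow> ('g \<Rightarrow> 'b) \<Rightarrow> 'g star_word \<Rightarrow> 'b" where
  "eval_word A h (Star_Word w) = eval_letters A h w"

definition free_eval :: "('b, 'm) cstar_scheme \<Rightarrow> ('g \<Rightarrow> 'b) \<Rightarrow> 'g free_star_algebra \<Rightarrow> 'b" where
  "free_eval A h x =
     (\<Oplus>\<^bsub>A\<^esub>w\<in>Poly_Mapping.keys x. Poly_Mapping.lookup x w \<odot>\<^bsub>A\<^esub> eval_word A h w)"

context unital_cstar_algebra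
begin

context
  fixes h :: "'g \<Rightarrow> 'a"
  assumes h: "\<And>g. h g \<in> carrier A"
begin

lemma eval_letters_closed [simp]: "eval_letters A h w \<in> carrier A"
  by (induction w) (auto simp: h cadj_closed)

lemma eval_word_closed [simp]: "eval_word A h w \<in> carrier A"
  by (cases w) simp

lemma eval_letters_append: "eval_letters A h (u @ v) = eval_letters A h u \<otimes> eval_letters A h v"
  by (induction u) (auto simp: m_assoc h cadj_closed)

lemma eval_word_plus: "eval_word A h (u + v) = eval_word A h u \<otimes> eval_word A h v"
  by (cases u; cases v) (simp add: eval_letters_append)

lemma eval_word_adj: "eval_word A h (word_adj w) = cadj A (eval_word A h w)"
proof -
  have "eval_letters A h (rev (map (\<lambda>(g, b). (g, \<not> b)) l)) = cadj A (eval_letters A h l)" for l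
    by (induction l)
       (auto simp: cadj_one eval_letters_append cadj_mult cadj_cadj h cadj_closed split: prod.splits)
  then show ?thesis by (cases w) simp
qed

lemma free_eval_superset:
  assumes "finite K" "Poly_Mapping.keys x \<subseteq> K"
  shows "free_eval A h x = (\<Oplus>w\<in>K. Poly_Mapping.lookup x w \<odot> eval_word A h w)"
  unfolding free_eval_def
  by (rule add.finprod_mono_neutral_cong_left)
     (use assms in \<open>auto simp: in_keys_iff smult_zero_scalar smult_closed\<close>)

lemma free_eval_closed [simp]: "free_eval A h x \<in> carrier A"
  unfolding free_eval_def by (rule finsum_closed) (auto simp: smult_closed)

lemma free_eval_add: "free_eval A h (x + y) = free_eval A h x \<oplus> free_eval A h y"
proof -
  let ?K = "Poly_Mapping.keys x \<union> Poly_Mapping.keys y"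
  have "free_eval A h (x + y) = (\<Oplus>w\<in>?K. Poly_Mapping.lookup (x + y) w \<odot> eval_word A h w)"
    by (rule free_eval_superset) (use keys_add[of x y] in auto)
  also have "\<dots> = (\<Oplus>w\<in>?K. Poly_Mapping.lookup x w \<odot> eval_word A h w \<oplus> Poly_Mapping.lookup y w \<odot> eval_word A h w)"
    by (simp add: lookup_add smult_add_scalar)
  also have "\<dots> = (\<Oplus>w\<in>?K. Poly_Mapping.lookup x w \<odot> eval_word A h w) \<oplus>
      (\<Oplus>w\<in>?K. Poly_Mapping.lookup y w \<odot> eval_word A h w)"
    by (rule finsum_addf) (auto simp: smult_closed)
  also have "\<dots> = free_eval A h x \<oplus> free_eval A h y"
    by (simp add: free_eval_superset[of ?K])
  finally show ?thesis .
qed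

lemma free_eval_single: "free_eval A h (Poly_Mapping.single w c) = c \<odot> eval_word A h w"
  by (subst free_eval_superset[of "{w}"]) (auto simp: smult_closed)

lemma free_eval_gen: "free_eval A h (free_gen g) = h g"
  by (simp add: free_gen_def free_eval_single smult_one h)

lemma free_eval_zero: "free_eval A h 0 = \<zero>"
  by (simp add: free_eval_def)

lemma free_eval_one: "free_eval A h 1 = \<one>"
proof -
  have "eval_word A h 0 = \<one>" by (simp add: zero_star_word_def)
  then show ?thesis using free_eval_single[of 0 1] by (simp add: smult_one)
qed

lemma free_eval_scale: "free_eval A h (free_scale c x) = c \<odot> free_eval A h x"
  by (induction x rule: free_algebra_induct)
     (simp_all add: free_scale_eq_mult mult_single free_eval_single smult_smult distrib_left
       free_eval_add smult_add)

lemma free_eval_mult: "free_eval A h (x * y) = free_eval A h x \<otimes> free_eval A h y"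
proof (induction x rule: free_algebra_induct)
  case (single w c)
  show ?case
    by (induction y rule: free_algebra_induct)
       (simp_all add: mult_single free_eval_single eval_word_plus smult_mult_left smult_mult_right
         smult_closed smult_smult[symmetric] mult.commute distrib_left free_eval_add r_distr)
qed (simp add: distrib_right free_eval_add l_distr)

lemma free_eval_adj: "free_eval A h (free_adj x) = cadj A (free_eval A h x)"
  by (induction x rule: free_algebra_induct)
     (simp_all add: free_adj_single free_eval_single eval_word_adj cadj_smult free_adj_add
       free_eval_add cadj_add)

lemma free_eval_diff: "free_eval A h (x - y) = free_eval A h x \<ominus> free_eval A h y"
  using free_eval_add[of x "free_scale (-1) y"]
  by (simp add: free_scale_minus_one free_eval_scale[of "-1", unfolded free_scale_minus_one]
      smult_minus_one minus_eq)

lemma cstar_seminorm_free_eval: "cstar_seminorm (\<lambda>x. cnorm A (free_eval A h x))"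
  unfolding cstar_seminorm_def
  by (simp add: free_eval_add free_eval_scale free_eval_mult free_eval_adj cnorm_add cnorm_smult
      cnorm_mult cstar_identity)

lemma free_eval_sum: "free_eval A h (\<Sum>i\<in>I. f i) = (\<Oplus>i\<in>I. free_eval A h (f i))"
  by (induction I rule: infinite_finite_induct)
     (auto simp: free_eval_zero free_eval_add finsum_insert)

end

end


subsection \<open>Homomorphisms out of the universal algebra\<close>

lemma universal_hom_exists:
  fixes R :: "('g free_star_algebra \<times> 'g free_star_algebra) set" and h :: "'g \<Rightarrow> 'b"
    and B :: "('b, 'm) cstar_scheme"
  assumes R: "\<And>g. \<exists>M. \<forall>p\<in>admissible_seminorms R. p (free_gen g) \<le> M"
    and B: "unital_cstar_algebra B" and h: "\<And>g. h g \<in> carrier B"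
    and rel: "\<And>a b. (a, b) \<in> R \<Longrightarrow> free_eval B h a = free_eval B h b"
  shows "\<exists>\<phi>\<in>contractive_star_hom (universal_cstar_algebra R) B.
           \<forall>x. \<phi> (limit_class (universal_seminorm R) (\<lambda>_. x)) = free_eval B h x"
proof -
  interpret B: unital_cstar_algebra B by (rule B)
  let ?e = "free_eval B h"
  define q where "q = universal_seminorm R"
  have q: "cstar_seminorm q" unfolding q_def by (rule cstar_seminorm_universal[OF R])
  note ev = B.free_eval_closed[OF h] B.free_eval_add[OF h] B.free_eval_mult[OF h]
    B.free_eval_scale[OF h] B.free_eval_adj[OF h] B.free_eval_one[OF h] B.free_eval_diff[OF h]
  let ?C = "cstar_completion q"
  have le: "cnorm B (?e x) \<le> q x" for x
  proof -
    have "(\<lambda>x. cnorm B (?e x)) \<in> admissible_seminorms R"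
      unfolding admissible_seminorms_def
      using B.cstar_seminorm_free_eval[OF h] rel
      by (auto simp: ev B.minus_eq B.r_neg B.cnorm_zero)
    from universal_seminorm_upper[OF R this] show ?thesis by (simp add: q_def)
  qed
  have lim: "\<exists>b. B.norm_limit (\<lambda>n. ?e (f n)) b" if f: "f \<in> cauchy_seqs q" for f
  proof -
    have "\<exists>x\<in>carrier B. (\<lambda>n. cnorm B (?e (f n) \<ominus>\<^bsub>B\<^esub> x)) \<longlonglongrightarrow> 0"
    proof (rule B.complete)
      fix e :: real assume "e > 0"
      then obtain N where N: "\<forall>m\<ge>N. \<forall>n\<ge>N. q (f m - f n) < e"
        using f unfolding cauchy_seqs_def by blast
      have "cnorm B (?e (f m) \<ominus>\<^bsub>B\<^esub> ?e (f n)) \<le> q (f m - f n)" for m n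
        using le[of "f m - f n"] by (simp add: ev)
      with N show "\<exists>N. \<forall>m\<ge>N. \<forall>n\<ge>N. cnorm B (?e (f m) \<ominus>\<^bsub>B\<^esub> ?e (f n)) < e"
        by (meson order.strict_trans1)
    qed (simp add: ev)
    then show ?thesis by (auto simp: B.norm_limit_def ev)
  qed
  define \<phi> where "\<phi> X = (SOME b. \<exists>f\<in>cauchy_seqs q. X = limit_class q f \<and> B.norm_limit (\<lambda>n. ?e (f n)) b)" for X
  have \<phi>: "\<phi> (limit_class q f) = b" if f: "f \<in> cauchy_seqs q" and b: "B.norm_limit (\<lambda>n. ?e (f n)) b" for f b
  proof -
    have "\<exists>g\<in>cauchy_seqs q. limit_class q f = limit_class q g \<and> B.norm_limit (\<lambda>n. ?e (g n)) (\<phi> (limit_class q f))"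
      unfolding \<phi>_def by (rule someI_ex) (use f b in blast)
    then obtain g where g: "g \<in> cauchy_seqs q" "limit_class q f = limit_class q g"
      and gl: "B.norm_limit (\<lambda>n. ?e (g n)) (\<phi> (limit_class q f))" by blast
    have "(\<lambda>n. q (f n - g n)) \<longlonglongrightarrow> 0"
      using limit_class_eq_iff[OF q f g(1)] g(2) by simp
    then have fg: "(\<lambda>n. q (f n - g n) + cnorm B (?e (g n) \<ominus>\<^bsub>B\<^esub> \<phi> (limit_class q f))) \<longlonglongrightarrow> 0"
      using gl by (auto simp: B.norm_limit_def intro: tendsto_add_zero)
    have "B.norm_limit (\<lambda>n. ?e (f n)) (\<phi> (limit_class q f))"
    proof (rule B.norm_limitI[OF _ _ _ fg])
      show c: "\<phi> (limit_class q f) \<in> carrier B" using gl by (simp add: B.norm_limit_def)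
      fix n
      show "cnorm B (?e (f n) \<ominus>\<^bsub>B\<^esub> \<phi> (limit_class q f)) \<le>
          q (f n - g n) + cnorm B (?e (g n) \<ominus>\<^bsub>B\<^esub> \<phi> (limit_class q f))"
        using B.minus_triangle[of "?e (f n)" "?e (g n)" "\<phi> (limit_class q f)"] le[of "f n - g n"] c
        by (simp add: ev)
    qed (simp add: ev)
    then show ?thesis using b by (rule B.norm_limit_unique)
  qed
  have \<phi>_lim: "B.norm_limit (\<lambda>n. ?e (f n)) (\<phi> (limit_class q f))" if "f \<in> cauchy_seqs q" for f
    using lim[OF that] \<phi>[OF that] by auto
  have const: "\<phi> (limit_class q (\<lambda>_. x)) = ?e x" for x
    by (rule \<phi>[OF cauchy_seqs_const[OF q]]) (rule B.norm_limit_const, simp add: ev)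
  have "\<phi> \<in> contractive_star_hom ?C B"
    unfolding contractive_star_hom_def mem_Collect_eq
  proof (intro conjI ballI allI)
    show "\<phi> \<in> ring_hom ?C B"
    proof (rule ring_hom_memI)
      fix X assume "X \<in> carrier ?C"
      then obtain f where f: "f \<in> cauchy_seqs q" "X = limit_class q f" by (rule completion_cases[OF q])
      show "\<phi> X \<in> carrier B" using \<phi>_lim[OF f(1)] by (simp add: f B.norm_limit_def)
    next
      fix X Y assume "X \<in> carrier ?C" "Y \<in> carrier ?C"
      then obtain f g where f: "f \<in> cauchy_seqs q" "X = limit_class q f"
        and g: "g \<in> cauchy_seqs q" "Y = limit_class q g" by (metis completion_cases[OF q])
      show "\<phi> (X \<otimes>\<^bsub>?C\<^esub> Y) = \<phi> X \<otimes>\<^bsub>B\<^esub> \<phi> Y"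
        unfolding f(2) g(2) mult_completion[OF q f(1) g(1)]
        by (rule \<phi>[OF cauchy_seqs_mult[OF q f(1) g(1)]])
           (simp add: ev B.norm_limit_mult[OF \<phi>_lim[OF f(1)] \<phi>_lim[OF g(1)]])
      show "\<phi> (X \<oplus>\<^bsub>?C\<^esub> Y) = \<phi> X \<oplus>\<^bsub>B\<^esub> \<phi> Y"
        unfolding f(2) g(2) add_completion[OF q f(1) g(1)]
        by (rule \<phi>[OF cauchy_seqs_add[OF q f(1) g(1)]])
           (simp add: ev B.norm_limit_add[OF \<phi>_lim[OF f(1)] \<phi>_lim[OF g(1)]])
    next
      show "\<phi> \<one>\<^bsub>?C\<^esub> = \<one>\<^bsub>B\<^esub>"
        using const[of 1] by (simp add: one_completion[OF q] ev)
    qed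
  next
    fix c X assume "X \<in> carrier ?C"
    then obtain f where f: "f \<in> cauchy_seqs q" "X = limit_class q f" by (rule completion_cases[OF q])
    show "\<phi> (c \<odot>\<^bsub>?C\<^esub> X) = c \<odot>\<^bsub>B\<^esub> \<phi> X"
      unfolding f(2) smult_completion[OF q f(1)]
      by (rule \<phi>[OF cauchy_seqs_scale[OF q f(1)]])
         (simp add: ev B.norm_limit_smult[OF \<phi>_lim[OF f(1)]])
  next
    fix X assume "X \<in> carrier ?C"
    then obtain f where f: "f \<in> cauchy_seqs q" "X = limit_class q f" by (rule completion_cases[OF q])
    show "\<phi> (cadj ?C X) = cadj B (\<phi> X)"
      unfolding f(2) cadj_completion[OF q f(1)]
      by (rule \<phi>[OF cauchy_seqs_adj[OF q f(1)]])
         (simp add: ev B.norm_limit_cadj[OF \<phi>_lim[OF f(1)]])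
    show "cnorm B (\<phi> X) \<le> cnorm ?C X"
      unfolding f(2)
      by (rule LIMSEQ_le[OF B.norm_limit_cnorm[OF \<phi>_lim[OF f(1)]] cnorm_tendsto[OF q f(1)]])
         (use le in blast)
  qed
  with const show ?thesis unfolding universal_cstar_algebra_def q_def by blast
qed

lemma completion_const_dense:
  assumes q: "cstar_seminorm q" and X: "X \<in> carrier (cstar_completion q)"
  shows "\<exists>f. (\<lambda>k. cnorm (cstar_completion q)
               (X \<ominus>\<^bsub>cstar_completion q\<^esub> limit_class q (\<lambda>_. f k))) \<longlonglongrightarrow> 0"
proof -
  interpret C: unital_cstar_algebra "cstar_completion q"
    by (rule unital_cstar_algebra_completion[OF q])
  obtain f where f: "f \<in> cauchy_seqs q" "X = limit_class q f" using X by (rule completion_cases[OF q])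
  have "(\<lambda>k. cnorm (cstar_completion q) (X \<ominus>\<^bsub>cstar_completion q\<^esub> limit_class q (\<lambda>_. f k))) \<longlonglongrightarrow> 0"
  proof (rule LIMSEQ_I)
    fix e :: real assume "e > 0"
    obtain N where N: "\<forall>k\<ge>N. cnorm (cstar_completion q)
        (X \<ominus>\<^bsub>cstar_completion q\<^esub> limit_class q (\<lambda>_. f k)) \<le> e / 2"
      using cnorm_diff_const_bound[OF q f(1), of "e / 2"] \<open>e > 0\<close> f(2) by auto
    moreover have "0 \<le> cnorm (cstar_completion q) (X \<ominus>\<^bsub>cstar_completion q\<^esub> limit_class q (\<lambda>_. f k))" for k
      using X limit_class_closed[OF q cauchy_seqs_const[OF q]] by (intro C.cnorm_nonneg) simp
    ultimately show "\<exists>N. \<forall>k\<ge>N. norm (cnorm (cstar_completion q)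
        (X \<ominus>\<^bsub>cstar_completion q\<^esub> limit_class q (\<lambda>_. f k)) - 0) < e"
      using \<open>e > 0\<close> by (intro exI[of _ N]) force
  qed
  then show ?thesis by blast
qed

lemma lambda_gens_bounded: "\<exists>M. \<forall>p\<in>admissible_seminorms (lambda_relations \<Lambda>). p (free_gen g) \<le> M"
proof (intro exI[of _ 1] ballI)
  fix p assume "p \<in> admissible_seminorms (lambda_relations \<Lambda>)"
  then have p: "cstar_seminorm p" and r: "\<And>a b. (a, b) \<in> lambda_relations \<Lambda> \<Longrightarrow> p (a - b) = 0"
    by (auto simp: admissible_seminorms_def)
  show "p (free_gen g) \<le> 1"
  proof (cases g)
    case (Partial_Isometry \<alpha>)
    show ?thesis unfolding Partial_Isometry
      by (rule seminorm_partial_isometry[OF p r[OF lambda_relations.partial_isometry]])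
  next
    case (Vertex_Projection l v)
    show ?thesis
    proof (cases "v \<in> vertices \<Lambda> l")
      case True
      show ?thesis unfolding Vertex_Projection
        by (rule seminorm_idem_selfadj[OF p])
           (rule r, rule lambda_relations.projection_idem lambda_relations.projection_adj, rule True)+
    next
      case False
      show ?thesis unfolding Vertex_Projection
        using r[OF lambda_relations.no_vertex[OF False]] by simp
    qed
  qed
qed

theorem unital_cstar_algebra_O_lambda: "unital_cstar_algebra (O_lambda \<Lambda>)"
  unfolding O_lambda_def universal_cstar_algebra_def
  by (rule unital_cstar_algebra_completion[OF cstar_seminorm_universal[OF lambda_gens_bounded]])

theorem lambda_family_O_lambda:
  "lambda_family \<Lambda> (O_lambda \<Lambda>) (\<lambda>\<alpha>. O_gen \<Lambda> (Partial_Isometry \<alpha>)) (\<lambda>l v. O_gen \<Lambda> (Vertex_Projection l v))"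
proof -
  define q where "q = universal_seminorm (lambda_relations \<Lambda>)"
  have q: "cstar_seminorm q"
    unfolding q_def by (rule cstar_seminorm_universal[OF lambda_gens_bounded])
  define j where "j x = limit_class q (\<lambda>_. x)" for x
  let ?O = "O_lambda \<Lambda>"
  interpret O: unital_cstar_algebra ?O by (rule unital_cstar_algebra_O_lambda)
  have O: "?O = cstar_completion q" by (simp add: O_lambda_def universal_cstar_algebra_def q_def)
  have jc: "j x \<in> carrier ?O" for x
    unfolding O j_def by (rule limit_class_closed[OF q cauchy_seqs_const[OF q]])
  have j: "j (x * y) = j x \<otimes>\<^bsub>?O\<^esub> j y" "j (x + y) = j x \<oplus>\<^bsub>?O\<^esub> j y" "j 1 = \<one>\<^bsub>?O\<^esub>" "j 0 = \<zero>\<^bsub>?O\<^esub>"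
    "j (free_scale c x) = c \<odot>\<^bsub>?O\<^esub> j x" "j (free_adj x) = cadj ?O (j x)" for x y c
    unfolding O j_def by (simp_all add: completion_ops[OF q] cauchy_seqs_const[OF q])
  have jsum: "j (\<Sum>i\<in>I. F i) = (\<Oplus>\<^bsub>?O\<^esub>i\<in>I. j (F i))" for I and F :: "'i \<Rightarrow> _"
    by (induction I rule: infinite_finite_induct) (auto simp: j O.finsum_insert jc)
  have rel: "j a = j b" if "(a, b) \<in> lambda_relations \<Lambda>" for a b
    unfolding j_def limit_class_eq_iff[OF q cauchy_seqs_const[OF q] cauchy_seqs_const[OF q]]
    using universal_seminorm_relation[OF lambda_gens_bounded that] by (simp add: q_def)
  have g: "O_gen \<Lambda> g = j (free_gen g)" for g by (simp add: O_gen_def j_def q_def)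
  show ?thesis
    unfolding lambda_family_def g
  proof (intro conjI allI ballI)
  qed (rule jc lambda_relations.intros[THEN rel, unfolded j jsum]; assumption?)+
qed

theorem O_lambda_universal:
  assumes B: "unital_cstar_algebra B" and fam: "lambda_family \<Lambda> B S E"
  shows "\<exists>\<phi>\<in>contractive_star_hom (O_lambda \<Lambda>) B.
           (\<forall>\<alpha>. \<phi> (O_gen \<Lambda> (Partial_Isometry \<alpha>)) = S \<alpha>) \<and>
           (\<forall>l. \<forall>v\<in>vertices \<Lambda> l. \<phi> (O_gen \<Lambda> (Vertex_Projection l v)) = E l v)"
proof -
  interpret B: unital_cstar_algebra B by (rule B)
  define h where "h g = (case g of Partial_Isometry \<alpha> \<Rightarrow> S \<alpha>
      | Vertex_Projection l v \<Rightarrow> if v \<in> vertices \<Lambda> l then E l v else \<zero>\<^bsub>B\<^esub>)" for g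
  have h: "h g \<in> carrier B" for g
    using fam by (auto simp: h_def lambda_family_def split: lambda_gen.split)
  have E: "E l v \<in> carrier B" if "v \<in> vertices \<Lambda> l" for l v
    using fam that by (auto simp: lambda_family_def)
  note ev = B.free_eval_add[OF h] B.free_eval_mult[OF h] B.free_eval_zero[OF h]
    B.free_eval_scale[OF h] B.free_eval_adj[OF h] B.free_eval_one[OF h] B.free_eval_gen[OF h]
    B.free_eval_sum[OF h]
  have sums: "(\<Oplus>\<^bsub>B\<^esub>v\<in>vertices \<Lambda> l. h (Vertex_Projection l v)) = (\<Oplus>\<^bsub>B\<^esub>v\<in>vertices \<Lambda> l. E l v)"
    "(\<Oplus>\<^bsub>B\<^esub>v\<in>vertices \<Lambda> l. c v \<odot>\<^bsub>B\<^esub> h (Vertex_Projection l v)) = (\<Oplus>\<^bsub>B\<^esub>v\<in>vertices \<Lambda> l. c v \<odot>\<^bsub>B\<^esub> E l v)"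
    for l c
    by (rule B.finsum_cong'; simp add: h_def E B.smult_closed)+
  have hS: "h (Partial_Isometry \<alpha>) = S \<alpha>" and
    hE: "v \<in> vertices \<Lambda> l \<Longrightarrow> h (Vertex_Projection l v) = E l v" and
    hN: "v \<notin> vertices \<Lambda> l \<Longrightarrow> h (Vertex_Projection l v) = \<zero>\<^bsub>B\<^esub>" for \<alpha> l v
    by (simp_all add: h_def)
  have fam1: "S \<alpha> \<otimes>\<^bsub>B\<^esub> cadj B (S \<alpha>) \<otimes>\<^bsub>B\<^esub> S \<alpha> = S \<alpha>"
      "v \<in> vertices \<Lambda> l \<Longrightarrow> cadj B (E l v) = E l v"
      "v \<in> vertices \<Lambda> l \<Longrightarrow> E l v \<otimes>\<^bsub>B\<^esub> E l v = E l v"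
      "(\<Oplus>\<^bsub>B\<^esub>\<beta>\<in>UNIV. S \<beta> \<otimes>\<^bsub>B\<^esub> cadj B (S \<beta>)) = \<one>\<^bsub>B\<^esub>"
      "(\<Oplus>\<^bsub>B\<^esub>v\<in>vertices \<Lambda> l. E l v) = \<one>\<^bsub>B\<^esub>" for \<alpha> l v
    using fam unfolding lambda_family_def by blast+
  have rel: "free_eval B h a = free_eval B h b" if "(a, b) \<in> lambda_relations \<Lambda>" for a b
    using that
  proof cases
    case (refine u l)
    have "E l u = (\<Oplus>\<^bsub>B\<^esub>v\<in>vertices \<Lambda> (Suc l). I_entry \<Lambda> l u v \<odot>\<^bsub>B\<^esub> E (Suc l) v)"
      using fam refine(3) by (simp add: lambda_family_def)
    then show ?thesis using refine by (simp only: ev sums hE)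
  next
    case (edges u l \<alpha>)
    have "cadj B (S \<alpha>) \<otimes>\<^bsub>B\<^esub> E l u \<otimes>\<^bsub>B\<^esub> S \<alpha> =
        (\<Oplus>\<^bsub>B\<^esub>v\<in>vertices \<Lambda> (Suc l). A_entry \<Lambda> l u \<alpha> v \<odot>\<^bsub>B\<^esub> E (Suc l) v)"
      using fam edges(3) unfolding lambda_family_def by blast
    then show ?thesis using edges by (simp only: ev sums hE hS)
  next
    case (commute v l \<alpha>)
    have "S \<alpha> \<otimes>\<^bsub>B\<^esub> cadj B (S \<alpha>) \<otimes>\<^bsub>B\<^esub> E l v = E l v \<otimes>\<^bsub>B\<^esub> S \<alpha> \<otimes>\<^bsub>B\<^esub> cadj B (S \<alpha>)"
      using fam commute(3) unfolding lambda_family_def by blast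
    then show ?thesis using commute by (simp only: ev sums hE hS)
  qed (simp_all add: ev sums hS hE hN fam1)
  obtain \<phi> where \<phi>: "\<phi> \<in> contractive_star_hom (O_lambda \<Lambda>) B"
    "\<And>x. \<phi> (limit_class (universal_seminorm (lambda_relations \<Lambda>)) (\<lambda>_. x)) = free_eval B h x"
    using universal_hom_exists[OF lambda_gens_bounded B h rel] unfolding O_lambda_def by blast
  then show ?thesis
    by (intro bexI[of _ \<phi>]) (simp_all add: O_gen_def ev hS hE)
qed

end

theory Submission
  imports Defs
begin

text \<open>
  Let \<open>J\<close> be a closed ideal with \<open>1 \<notin> J\<close> and let \<open>\<parallel>x\<parallel>\<^sub>J\<close> be the distance of \<open>x\<close> from \<open>J\<close>.  This is a
  submultiplicative seminorm below the norm, it vanishes on \<open>J\<close>, and it does not decrease the norm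
  of scalars (\<open>quotient_norm_scalar\<close>).  Simplicity follows from \<open>\<parallel>x\<parallel> \<le> \<parallel>x\<parallel>\<^sub>J\<close> for every
  \<open>*\<close>-polynomial \<open>x\<close> in the generators (\<open>norm_le_quotient_norm\<close>), because these are dense.
  
  Synchronizing transitivity for a word \<open>\<mu>\<close> and the empty word says that \<open>\<mu>\<close> extends to a word \<open>\<omega>\<close>
  that may be followed by everything.  If \<open>\<omega>\<close> begins with an \<open>l\<close>-synchronizing word \<open>\<nu>\<close>, then
  \<open>S\<^sub>\<omega>\<^sup>* E S\<^sub>\<omega>\<close> is \<open>1\<close> for the vertex projection \<open>E\<close> of \<open>\<nu>\<close> at level \<open>l\<close> and \<open>0\<close> for all other ones
  (\<open>universal_compression\<close>).  So compression by \<open>S\<^sub>\<omega>\<close> turns an element of the diagonal at level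
  \<open>l\<close> into the scalar that is its coefficient at \<open>\<nu>\<close>.  A Cantor set has more than one point, so two letters occur;
  hence \<open>\<omega>\<close> can be chosen without small periods, and then the compression kills
  every term of nonzero degree, where \<open>S\<^sub>\<alpha>\<close> has degree \<open>1\<close> (\<open>off_diagonal_vanishes\<close>).
  
  Thus all coefficients of the degree zero part \<open>f\<close> of \<open>x\<close> are bounded by \<open>\<parallel>x\<parallel>\<^sub>J\<close>.  They determine
  \<open>f\<close> as a matrix of some fixed size, which bounds \<open>\<parallel>f\<parallel>\<close> up to a constant.  The constant disappears
  on passing to high powers of \<open>f\<^sup>* f\<close>, which have the same size (\<open>norm_le_of_compressions\<close>).
  The part \<open>x\<^sub>k\<close> of degree \<open>k\<close> is reached through the degree zero part of \<open>x\<^sub>k\<^sup>* x\<close>.  If the degrees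
  of \<open>x\<close> lie between \<open>-N\<close> and \<open>N\<close>, summation gives \<open>\<parallel>x\<parallel> \<le> (2N+1) \<parallel>x\<parallel>\<^sub>J\<close>.  Since the number of
  degrees grows only linearly with the exponent of a power of \<open>x\<^sup>* x\<close>, high powers remove this
  factor as well.  This argument replaces a faithful conditional expectation onto the degree zero part.
  
  Two facts about the relations are needed in addition.  They only say that the vertex projections of
  one level, and the range projections of the letters, add up to \<open>1\<close>; that the summands are orthogonal
  is a positivity argument (\<open>orthogonal_projections\<close>).  And the algebra is not zero, because the
  relations hold for operators on finitely supported functions on the rays all of whose tails
  synchronize (\<open>ray_seminorm_admissible\<close>).
\<close>

section \<open>Universal words and words without period\<close>

definition universal_words :: "(int \<Rightarrow> 'a) set \<Rightarrow> 'a list set" where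
  "universal_words \<Lambda> = {\<omega> \<in> words \<Lambda>. \<forall>\<zeta>\<in>words \<Lambda>. \<omega> @ \<zeta> \<in> words \<Lambda>}"

lemma words_Cons_right: "w \<in> words \<Lambda> \<Longrightarrow> \<exists>a. w @ [a] \<in> words \<Lambda>"
proof -
  assume "w \<in> words \<Lambda>"
  then obtain x k where x: "x \<in> \<Lambda>" "\<forall>i<length w. w ! i = x (k + int i)"
    by (auto simp: words_def)
  have "(w @ [x (k + int (length w))]) ! i = x (k + int i)"
    if "i < length (w @ [x (k + int (length w))])" for i
    using that x(2) by (auto simp: nth_append less_Suc_eq)
  then show ?thesis using x(1) unfolding words_def by blast
qed

lemma Nil_in_words: "w \<in> words \<Lambda> \<Longrightarrow> [] \<in> words \<Lambda>"
  using words_append_left[of "[]" w \<Lambda>] by simp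

lemma words_of_any_length: "[] \<in> words \<Lambda> \<Longrightarrow> \<exists>w\<in>words \<Lambda>. length w = n"
proof (induction n)
  case (Suc n)
  then show ?case by (metis length_append_singleton words_Cons_right)
qed simp

text \<open>
  Everything follows the empty word, so this is synchronizing transitivity for \<open>\<mu>\<close> and the empty word.
\<close>
lemma universal_word_extension:
  assumes "synchronizingly_transitive \<Lambda>" "\<mu> \<in> words \<Lambda>"
  shows "\<exists>\<eta>. \<mu> @ \<eta> \<in> universal_words \<Lambda>"
proof -
  have nil: "[] \<in> words \<Lambda>" using assms(2) by (rule Nil_in_words)
  obtain \<eta> where "\<mu> @ \<eta> \<in> words \<Lambda>" "followers \<Lambda> [] = followers \<Lambda> (\<mu> @ \<eta>)"
    using assms nil unfolding synchronizingly_transitive_def synchronizes_to_def by fastforce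
  then have "\<mu> @ \<eta> \<in> universal_words \<Lambda>"
    by (force simp: universal_words_def followers_def)
  then show ?thesis by blast
qed

text \<open>
  If only one letter occurs, then \<open>\<Lambda>\<close> has at most one point.
\<close>
lemma two_letters:
  fixes \<Lambda> :: "(int \<Rightarrow> 'a::finite) set"
  assumes "subtopology full_shift \<Lambda> homeomorphic_space cantor_space"
  shows "\<exists>a b. a \<noteq> b \<and> [a] \<in> words \<Lambda> \<and> [b] \<in> words \<Lambda>"
proof (rule ccontr)
  assume neg: "\<not> ?thesis"
  have letter: "[x i] \<in> words \<Lambda>" if "x \<in> \<Lambda>" for x i
    using that by (auto simp: words_def intro!: bexI[of _ x] exI[of _ i])
  have single: "x = y" if "x \<in> \<Lambda>" "y \<in> \<Lambda>" for x y
    using neg letter that by (intro ext) metis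
  obtain f g where fg: "homeomorphic_maps (subtopology full_shift \<Lambda>) cantor_space f g"
    using assms unfolding homeomorphic_space_def by blast
  have top: "topspace (subtopology full_shift \<Lambda>) = \<Lambda>" "topspace cantor_space = UNIV"
    by (auto simp: full_shift_def cantor_space_def)
  have "g y \<in> \<Lambda>" "f (g y) = y" for y
    using fg unfolding homeomorphic_maps_def continuous_map_def top by auto
  then have "(\<lambda>_. True) = (\<lambda>_::nat. False)" using single by metis
  then show False by metis
qed

definition no_period_upto :: "nat \<Rightarrow> 'a list \<Rightarrow> bool" where
  "no_period_upto N w \<longleftrightarrow> (\<forall>d\<in>{1..N}. \<exists>i. i + d < length w \<and> w ! i \<noteq> w ! (i + d))"

lemma no_period_upto_append: "no_period_upto N u \<Longrightarrow> no_period_upto N (u @ v)"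
  unfolding no_period_upto_def by (metis add_lessD1 length_append nth_append trans_less_add1)

lemma no_period_upto_shift:
  assumes "no_period_upto N w" "0 < length \<rho>" "length \<rho> \<le> N"
  shows "take (length w) (\<rho> @ w) \<noteq> w"
proof
  assume eq: "take (length w) (\<rho> @ w) = w"
  obtain i where i: "i + length \<rho> < length w" "w ! i \<noteq> w ! (i + length \<rho>)"
    using assms(1)[unfolded no_period_upto_def, rule_format, of "length \<rho>"] assms(2,3) by auto
  have "take (length w) (\<rho> @ w) ! (i + length \<rho>) = w ! i"
    using i(1) by (simp add: nth_append)
  with eq i(2) show False by simp
qed

text \<open>
  A universal word may be followed by either of two letters.  One of them differs from the letter that
  stands \<open>d\<close> places earlier; adding it destroys the period \<open>d\<close>, and no further extension restores it.
\<close>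
lemma universal_word_without_period:
  fixes \<Lambda> :: "(int \<Rightarrow> 'a) set"
  assumes st: "synchronizingly_transitive \<Lambda>"
    and ab: "a \<noteq> b" "[a] \<in> words \<Lambda>" "[b] \<in> words \<Lambda>" and \<mu>: "\<mu> \<in> words \<Lambda>"
  shows "\<exists>\<eta>. \<mu> @ \<eta> \<in> universal_words \<Lambda> \<and> no_period_upto N (\<mu> @ \<eta>)"
proof (induction N)
  case 0
  then show ?case using universal_word_extension[OF st \<mu>] by (auto simp: no_period_upto_def)
next
  case (Suc N)
  then obtain \<eta> where \<eta>: "\<mu> @ \<eta> \<in> universal_words \<Lambda>" "no_period_upto N (\<mu> @ \<eta>)" by blast
  obtain w where w: "w \<in> words \<Lambda>" "length w = Suc N"
    using words_of_any_length Nil_in_words[OF \<mu>] by blast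
  have "(\<mu> @ \<eta>) @ w \<in> words \<Lambda>" using \<eta>(1) w(1) by (simp add: universal_words_def)
  then obtain \<eta>' where u: "((\<mu> @ \<eta>) @ w) @ \<eta>' \<in> universal_words \<Lambda>"
    using universal_word_extension[OF st] by blast
  define u where "u = \<mu> @ \<eta> @ w @ \<eta>'"
  have u: "u \<in> universal_words \<Lambda>" "Suc N \<le> length u" "no_period_upto N u"
    using u w(2) no_period_upto_append[OF \<eta>(2), of "w @ \<eta>'"] by (simp_all add: u_def)
  obtain x where x: "[x] \<in> words \<Lambda>" "u ! (length u - Suc N) \<noteq> x"
    using ab by metis
  have "u @ [x] \<in> words \<Lambda>" using u(1) x(1) by (simp add: universal_words_def)
  then obtain \<eta>'' where v: "(u @ [x]) @ \<eta>'' \<in> universal_words \<Lambda>"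
    using universal_word_extension[OF st] by blast
  have "no_period_upto (Suc N) (u @ [x])"
    unfolding no_period_upto_def
  proof
    fix d assume d: "d \<in> {1..Suc N}"
    show "\<exists>i. i + d < length (u @ [x]) \<and> (u @ [x]) ! i \<noteq> (u @ [x]) ! (i + d)"
    proof (cases "d = Suc N")
      case True
      then show ?thesis using u(2) x(2)
        by (intro exI[of _ "length u - Suc N"]) (auto simp: nth_append)
    next
      case False
      then show ?thesis
        using no_period_upto_append[OF u(3), of "[x]"] d unfolding no_period_upto_def by auto
    qed
  qed
  then have "no_period_upto (Suc N) ((u @ [x]) @ \<eta>'')" by (rule no_period_upto_append)
  then show ?case using v by (intro exI[of _ "\<eta> @ w @ \<eta>' @ [x] @ \<eta>''"]) (simp add: u_def)
qed

lemma synchronizing_words_antimono':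
  "l \<le> l' \<Longrightarrow> synchronizing_words \<Lambda> l' \<subseteq> synchronizing_words \<Lambda> l"
  using lift_Suc_antimono_le[of "synchronizing_words \<Lambda>" l l'] synchronizing_words_antimono by blast

lemma synchronizing_words_extend:
  assumes "\<mu> \<in> synchronizing_words \<Lambda> l" "\<mu> @ \<omega> \<in> words \<Lambda>"
  shows "\<mu> @ \<omega> \<in> synchronizing_words \<Lambda> l" "predecessors \<Lambda> l (\<mu> @ \<omega>) = predecessors \<Lambda> l \<mu>"
proof -
  have sync: "predecessors \<Lambda> l \<mu> = predecessors \<Lambda> l (\<mu> @ \<zeta>)" if "\<mu> @ \<zeta> \<in> words \<Lambda>" for \<zeta>
    using assms(1) that words_append_right by (force simp: synchronizing_words_def followers_def)
  show "predecessors \<Lambda> l (\<mu> @ \<omega>) = predecessors \<Lambda> l \<mu>" using sync[OF assms(2)] by simp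
  show "\<mu> @ \<omega> \<in> synchronizing_words \<Lambda> l"
    unfolding synchronizing_words_def mem_Collect_eq
  proof (intro conjI ballI assms(2))
    fix \<zeta> assume "\<zeta> \<in> followers \<Lambda> (\<mu> @ \<omega>)"
    then have "\<mu> @ \<omega> @ \<zeta> \<in> words \<Lambda>" by (simp add: followers_def)
    then show "predecessors \<Lambda> l (\<mu> @ \<omega>) = predecessors \<Lambda> l ((\<mu> @ \<omega>) @ \<zeta>)"
      using sync[OF assms(2)] sync[of "\<omega> @ \<zeta>"] by simp
  qed
qed

lemma synchronizing_words_append_left:
  assumes "\<nu> \<in> synchronizing_words \<Lambda> (length \<eta> + l)" "\<eta> @ \<nu> \<in> words \<Lambda>"
  shows "\<eta> @ \<nu> \<in> synchronizing_words \<Lambda> l"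
  using assms
proof (induction \<eta> arbitrary: l)
  case (Cons a \<eta>)
  then have "\<eta> @ \<nu> \<in> synchronizing_words \<Lambda> (Suc l)"
    using words_append_right[of "[a]" "\<eta> @ \<nu>" \<Lambda>] by simp
  moreover have "[a] \<in> predecessors \<Lambda> 1 (\<eta> @ \<nu>)" using Cons.prems by (simp add: mem_predecessors)
  ultimately show ?case using synchronizing_words_Cons by simp
qed simp

text \<open>
  A ray in this set determines a vertex at every level, and so do all its tails.  These are the basis
  vectors of the representation that shows that the algebra is not zero.
\<close>
definition sync_rays :: "(int \<Rightarrow> 'a) set \<Rightarrow> (nat \<Rightarrow> 'a) set" where
  "sync_rays \<Lambda> = {x. (\<forall>k. map x [0..<k] \<in> words \<Lambda>) \<and>
     (\<forall>i l. \<exists>k. map x [i..<k] \<in> synchronizing_words \<Lambda> l)}"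

text \<open>
  A word \<open>\<mu>\<close> has an extension \<open>\<mu>\<nu>\<close> with \<open>\<nu> \<in> synchronizing_words \<Lambda> (length \<mu> + n)\<close>.  Then every suffix
  of \<open>\<mu>\<nu>\<close> that contains \<open>\<nu>\<close> is \<open>n\<close>-synchronizing.  The ray is the limit of such extensions for
  growing \<open>n\<close>.
\<close>
lemma sync_rays_nonempty:
  assumes ls: "lambda_synchronizing \<Lambda>" and nil: "[] \<in> words \<Lambda>"
  shows "sync_rays \<Lambda> \<noteq> {}"
proof -
  have step: "\<exists>\<mu>'. \<mu>' \<in> words \<Lambda> \<and> (\<exists>\<rho>. \<rho> \<noteq> [] \<and> \<mu>' = \<mu> @ \<rho>) \<and>
      (\<forall>i\<le>length \<mu>. drop i \<mu>' \<in> synchronizing_words \<Lambda> n)" if \<mu>: "\<mu> \<in> words \<Lambda>" for \<mu> n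
  proof -
    have "\<mu> \<in> words_of_length \<Lambda> (length \<mu>)" using \<mu> by (simp add: words_of_length_def)
    then obtain \<nu> where \<nu>: "\<nu> \<in> synchronizing_words \<Lambda> (length \<mu> + n)"
        "\<mu> @ \<nu> \<in> synchronizing_words \<Lambda> (length \<mu> + n - length \<mu>)"
      using ls unfolding lambda_synchronizing_def by (meson le_add1)
    then have w: "\<mu> @ \<nu> \<in> words \<Lambda>" by (simp add: synchronizing_words_def)
    obtain a where a: "(\<mu> @ \<nu>) @ [a] \<in> words \<Lambda>" using words_Cons_right[OF w] by blast
    have "drop i (\<mu> @ \<nu> @ [a]) \<in> synchronizing_words \<Lambda> n" if "i \<le> length \<mu>" for i
    proof -
      have s: "take i \<mu> @ drop i \<mu> @ \<nu> @ [a] \<in> words \<Lambda>" using a by (simp flip: append_assoc)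
      then have "drop i \<mu> @ \<nu> @ [a] \<in> words \<Lambda>" by (rule words_append_right)
      then have s2: "(drop i \<mu> @ \<nu>) @ [a] \<in> words \<Lambda>" by simp
      have "drop i \<mu> @ \<nu> \<in> synchronizing_words \<Lambda> n"
        using synchronizing_words_append_left[of \<nu> \<Lambda> "drop i \<mu>" "n"] words_append_left[OF s2] \<nu>(1)
          synchronizing_words_antimono'[of "length (drop i \<mu>) + n" "length \<mu> + n" \<Lambda>] by auto
      then show ?thesis using synchronizing_words_extend(1)[OF _ s2] that by simp
    qed
    then show ?thesis using a by (intro exI[of _ "\<mu> @ \<nu> @ [a]"]) simp
  qed
  have "\<exists>M. \<forall>n. (M n \<in> words \<Lambda>) \<and> ((\<exists>\<rho>. \<rho> \<noteq> [] \<and> M (Suc n) = M n @ \<rho>) \<and>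
      (\<forall>i\<le>length (M n). drop i (M (Suc n)) \<in> synchronizing_words \<Lambda> n))"
    by (rule dependent_nat_choice) (use nil step in blast)+
  then obtain M where M: "\<And>n. M n \<in> words \<Lambda>" "\<And>n. \<exists>\<rho>. \<rho> \<noteq> [] \<and> M (Suc n) = M n @ \<rho>"
    "\<And>n i. i \<le> length (M n) \<Longrightarrow> drop i (M (Suc n)) \<in> synchronizing_words \<Lambda> n" by metis
  have len: "n \<le> length (M n)" for n
  proof (induction n)
    case (Suc n)
    obtain \<rho> where "\<rho> \<noteq> []" "M (Suc n) = M n @ \<rho>" using M(2) by blast
    then show ?case using Suc by (cases \<rho>) auto
  qed simp
  have pre: "\<exists>\<rho>. M m = M n @ \<rho>" if "n \<le> m" for n m
    using that
  proof (induction m rule: dec_induct)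
    case (step m)
    then show ?case using M(2)[of m] by auto
  qed simp
  define x where "x i = M (Suc i) ! i" for i
  have nth: "M n ! i = x i" if "i < length (M n)" for n i
  proof (cases "n \<le> Suc i")
    case True
    then obtain \<rho> where "M (Suc i) = M n @ \<rho>" using pre by blast
    then show ?thesis using that by (simp add: x_def nth_append)
  next
    case False
    then obtain \<rho> where "M n = M (Suc i) @ \<rho>" using pre[of "Suc i" n] by auto
    then show ?thesis using len[of "Suc i"] by (simp add: x_def nth_append)
  qed
  have seg: "map x [i..<length (M n)] = drop i (M n)" for i n
    by (rule nth_equalityI) (auto simp: nth)
  have "map x [0..<k] \<in> words \<Lambda>" for k
  proof -
    have "map x [0..<length (M k)] \<in> words \<Lambda>" using M(1)[of k] by (simp add: seg)
    moreover have "[0..<length (M k)] = [0..<k] @ [k..<length (M k)]"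
      using upt_add_eq_append[of 0 k "length (M k) - k"] len[of k] by simp
    ultimately show ?thesis using words_append_left by (metis map_append)
  qed
  moreover have "\<exists>k. map x [i..<k] \<in> synchronizing_words \<Lambda> l" for i l
  proof -
    have "i \<le> length (M (max i l))" using len[of "max i l"] by simp
    from M(3)[OF this] have "map x [i..<length (M (Suc (max i l)))] \<in> synchronizing_words \<Lambda> (max i l)"
      by (simp add: seg)
    then show ?thesis using synchronizing_words_antimono'[of l "max i l" \<Lambda>] by auto
  qed
  ultimately show ?thesis unfolding sync_rays_def by blast
qed

section \<open>Words and vertices of the \<open>\<lambda>\<close>-graph system\<close>

lemma predecessors_mono:
  assumes "predecessors \<Lambda> l' \<mu> = predecessors \<Lambda> l' \<nu>" "l \<le> l'"
  shows "predecessors \<Lambda> l \<mu> = predecessors \<Lambda> l \<nu>"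
  using assms(2,1)
proof (induction l' rule: dec_induct)
  case (step n)
  then show ?case by (simp add: predecessors_lower[of \<Lambda> n])
qed

lemma vertex_cases:
  assumes "v \<in> vertices \<Lambda> l"
  obtains \<mu> where "\<mu> \<in> synchronizing_words \<Lambda> l" "v = past_class \<Lambda> l \<mu>"
  using assms by (auto simp: vertices_eq)

lemma past_class_in_vertices: "\<mu> \<in> synchronizing_words \<Lambda> l \<Longrightarrow> past_class \<Lambda> l \<mu> \<in> vertices \<Lambda> l"
  by (simp add: vertices_eq)

lemma mem_vertex:
  assumes "v \<in> vertices \<Lambda> l"
  shows "\<mu> \<in> v \<longleftrightarrow> \<mu> \<in> synchronizing_words \<Lambda> l \<and> past_class \<Lambda> l \<mu> = v"
proof -
  obtain \<nu> where \<nu>: "\<nu> \<in> synchronizing_words \<Lambda> l" "v = past_class \<Lambda> l \<nu>"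
    using assms by (rule vertex_cases)
  have "\<mu> \<in> v \<longleftrightarrow> \<mu> \<in> synchronizing_words \<Lambda> l \<and> predecessors \<Lambda> l \<mu> = predecessors \<Lambda> l \<nu>"
    using \<nu> by (auto simp: past_class_def past_equiv_def)
  then show ?thesis using \<nu> past_class_eq_iff by blast
qed

definition vertex_word :: "'a list set \<Rightarrow> 'a list" where
  "vertex_word v = (SOME \<mu>. \<mu> \<in> v)"

lemma vertex_word:
  assumes "v \<in> vertices \<Lambda> l"
  shows "vertex_word v \<in> synchronizing_words \<Lambda> l" "past_class \<Lambda> l (vertex_word v) = v"
proof -
  obtain \<nu> where "\<nu> \<in> v" using assms mem_vertex[OF assms] by (metis vertex_cases)
  then have "vertex_word v \<in> v" unfolding vertex_word_def by (rule someI)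
  then show "vertex_word v \<in> synchronizing_words \<Lambda> l" "past_class \<Lambda> l (vertex_word v) = v"
    using mem_vertex[OF assms] by auto
qed

lemma predecessors_eq_Cons:
  assumes "predecessors \<Lambda> (Suc l) \<mu> = predecessors \<Lambda> (Suc l) \<nu>"
  shows "a # \<mu> \<in> words \<Lambda> \<longleftrightarrow> a # \<nu> \<in> words \<Lambda>"
    and "predecessors \<Lambda> l (a # \<mu>) = predecessors \<Lambda> l (a # \<nu>)"
proof -
  have "predecessors \<Lambda> 1 \<mu> = predecessors \<Lambda> 1 \<nu>" by (rule predecessors_mono[OF assms]) simp
  then have "[a] \<in> predecessors \<Lambda> 1 \<mu> \<longleftrightarrow> [a] \<in> predecessors \<Lambda> 1 \<nu>" by simp
  then show "a # \<mu> \<in> words \<Lambda> \<longleftrightarrow> a # \<nu> \<in> words \<Lambda>" by (simp add: mem_predecessors)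
  show "predecessors \<Lambda> l (a # \<mu>) = predecessors \<Lambda> l (a # \<nu>)" by (simp add: predecessors_Cons assms)
qed

lemma synchronizing_words_Cons': "\<nu> \<in> synchronizing_words \<Lambda> (Suc l) \<Longrightarrow> a # \<nu> \<in> words \<Lambda> \<Longrightarrow>
    a # \<nu> \<in> synchronizing_words \<Lambda> l"
  by (rule synchronizing_words_Cons) (auto simp: mem_predecessors)

text \<open>
  The graph is left-resolving: the source of an edge is determined by its target and its label.
\<close>
lemma labeled_edge_past_class:
  assumes \<nu>: "\<nu> \<in> synchronizing_words \<Lambda> (Suc l)"
  shows "labeled_edge \<Lambda> l u \<alpha> (past_class \<Lambda> (Suc l) \<nu>) \<longleftrightarrow>
    \<alpha> # \<nu> \<in> words \<Lambda> \<and> past_class \<Lambda> l (\<alpha> # \<nu>) = u"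
proof
  assume "labeled_edge \<Lambda> l u \<alpha> (past_class \<Lambda> (Suc l) \<nu>)"
  then obtain \<kappa> where \<kappa>: "\<kappa> \<in> synchronizing_words \<Lambda> (Suc l)" "\<alpha> # \<kappa> \<in> words \<Lambda>"
    "u = past_class \<Lambda> l (\<alpha> # \<kappa>)" "past_class \<Lambda> (Suc l) \<nu> = past_class \<Lambda> (Suc l) \<kappa>"
    by (auto simp: labeled_edge_def mem_predecessors)
  then have p: "predecessors \<Lambda> (Suc l) \<kappa> = predecessors \<Lambda> (Suc l) \<nu>"
    using \<nu> past_class_eq_iff by metis
  then have "\<alpha> # \<nu> \<in> words \<Lambda>" using predecessors_eq_Cons(1)[OF p] \<kappa>(2) by simp
  then show "\<alpha> # \<nu> \<in> words \<Lambda> \<and> past_class \<Lambda> l (\<alpha> # \<nu>) = u"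
    using past_class_eq_iff predecessors_eq_Cons(2)[OF p] synchronizing_words_Cons' \<kappa> \<nu> by metis
next
  assume "\<alpha> # \<nu> \<in> words \<Lambda> \<and> past_class \<Lambda> l (\<alpha> # \<nu>) = u"
  then show "labeled_edge \<Lambda> l u \<alpha> (past_class \<Lambda> (Suc l) \<nu>)"
    unfolding labeled_edge_def using \<nu> by (intro bexI[of _ \<nu>]) (auto simp: mem_predecessors)
qed

text \<open>
  Such functions on \<open>l\<close>-synchronizing words are the functions on the vertices of level \<open>l\<close>.
\<close>
definition past_invariant :: "(int \<Rightarrow> 'a) set \<Rightarrow> nat \<Rightarrow> ('a list \<Rightarrow> complex) \<Rightarrow> bool" where
  "past_invariant \<Lambda> l g \<longleftrightarrow> (\<forall>\<mu>\<in>synchronizing_words \<Lambda> l. \<forall>\<nu>\<in>synchronizing_words \<Lambda> l.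
     predecessors \<Lambda> l \<mu> = predecessors \<Lambda> l \<nu> \<longrightarrow> g \<mu> = g \<nu>)"

lemma past_invariantD:
  assumes "past_invariant \<Lambda> l g" "\<mu> \<in> synchronizing_words \<Lambda> l"
  shows "g (vertex_word (past_class \<Lambda> l \<mu>)) = g \<mu>"
  using assms vertex_word[OF past_class_in_vertices[OF assms(2)]] past_class_eq_iff
  unfolding past_invariant_def by metis

lemma past_invariant_Suc: "past_invariant \<Lambda> l g \<Longrightarrow> past_invariant \<Lambda> (Suc l) g"
  unfolding past_invariant_def
  by (meson predecessors_mono le_SucI order_refl subsetD synchronizing_words_antimono)

definition prepend :: "(int \<Rightarrow> 'a) set \<Rightarrow> 'a list \<Rightarrow> ('a list \<Rightarrow> complex) \<Rightarrow> 'a list \<Rightarrow> complex" where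
  "prepend \<Lambda> \<omega> g = (\<lambda>\<zeta>. if \<omega> @ \<zeta> \<in> words \<Lambda> then g (\<omega> @ \<zeta>) else 0)"

lemma past_invariant_prepend:
  assumes "past_invariant \<Lambda> l g"
  shows "past_invariant \<Lambda> (Suc l) (prepend \<Lambda> [a] g)"
  unfolding past_invariant_def
proof (intro ballI impI)
  fix \<mu> \<nu> assume *: "\<mu> \<in> synchronizing_words \<Lambda> (Suc l)" "\<nu> \<in> synchronizing_words \<Lambda> (Suc l)"
    "predecessors \<Lambda> (Suc l) \<mu> = predecessors \<Lambda> (Suc l) \<nu>"
  show "prepend \<Lambda> [a] g \<mu> = prepend \<Lambda> [a] g \<nu>"
    using assms predecessors_eq_Cons[OF *(3), of a] synchronizing_words_Cons'[OF *(1), of a]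
      synchronizing_words_Cons'[OF *(2), of a]
    by (auto simp: prepend_def past_invariant_def)
qed

lemma past_invariant_const: "past_invariant \<Lambda> l (\<lambda>_. c)"
  by (simp add: past_invariant_def)

lemma past_invariant_binary:
  assumes "past_invariant \<Lambda> l g" "past_invariant \<Lambda> l h"
  shows "past_invariant \<Lambda> l (\<lambda>\<mu>. F (g \<mu>) (h \<mu>))"
  unfolding past_invariant_def
proof (intro ballI impI)
  fix \<mu> \<nu> assume "\<mu> \<in> synchronizing_words \<Lambda> l" "\<nu> \<in> synchronizing_words \<Lambda> l"
    "predecessors \<Lambda> l \<mu> = predecessors \<Lambda> l \<nu>"
  then have "g \<mu> = g \<nu>" "h \<mu> = h \<nu>" using assms unfolding past_invariant_def by blast+
  then show "F (g \<mu>) (h \<mu>) = F (g \<nu>) (h \<nu>)" by simp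
qed

section \<open>Two norm estimates\<close>

text \<open>
  The comparison of norms is carried out on high powers, where a factor that grows at most linearly
  with the exponent does no harm.  The exponents are powers of two, because the norm of a self-adjoint
  element is multiplicative under squaring.
\<close>
lemma power_growth_le:
  fixes a b C :: real
  assumes "0 \<le> b" and le: "\<And>j. a ^ 2 ^ j \<le> C * 2 ^ j * b ^ 2 ^ j"
  shows "a \<le> b"
proof (rule ccontr)
  assume "\<not> a \<le> b"
  then have ab: "b < a" "0 < a" using assms(1) by auto
  define x where "x = b / a"
  have "norm x < 1" using ab assms(1) by (simp add: x_def)
  then have "(\<lambda>n. of_nat n * x ^ n) \<longlonglongrightarrow> 0" by (rule powser_times_n_limit_0)
  moreover have "strict_mono (\<lambda>j. 2 ^ j :: nat)" by (auto intro!: strict_monoI_Suc)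
  ultimately have "((\<lambda>n. of_nat n * x ^ n) \<circ> (\<lambda>j. 2 ^ j)) \<longlonglongrightarrow> 0"
    by (rule LIMSEQ_subseq_LIMSEQ)
  then have "(\<lambda>j. C * (2 ^ j * x ^ 2 ^ j)) \<longlonglongrightarrow> C * 0"
    by (intro tendsto_mult tendsto_const) (simp add: o_def)
  moreover have "1 \<le> C * (2 ^ j * x ^ 2 ^ j)" for j
  proof -
    have "1 \<le> (C * 2 ^ j * b ^ 2 ^ j) / a ^ 2 ^ j"
      using le[of j] ab by simp
    then show ?thesis by (simp add: x_def power_divide mult.assoc)
  qed
  ultimately have "1 \<le> C * 0" by (intro LIMSEQ_le_const) auto
  then show False by simp
qed

lemma sum_root_unity_powers:
  assumes "1 \<le> N"
  shows "(\<Sum>k<N. cis (2 * pi / N) ^ (k * s)) = (if N dvd s then of_nat N else 0)"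
proof -
  define z where "z = cis (2 * pi / N) ^ s"
  have w: "cis (2 * pi / N) ^ j = exp (2 * of_real pi * \<i> * of_nat j / of_nat N)" for j
    by (simp add: cis_conv_exp flip: exp_of_nat_mult) (simp add: mult_ac)
  have z1: "z = 1 \<longleftrightarrow> N dvd s" unfolding z_def w by (rule complex_root_unity_eq_1[OF assms])
  have "z ^ N = cis (2 * pi / N) ^ (s * N)" by (simp only: z_def power_mult)
  also have "\<dots> = 1" unfolding w by (subst complex_root_unity_eq_1[OF assms]) simp
  finally have "z ^ N = 1" .
  have "(\<Sum>k<N. cis (2 * pi / N) ^ (k * s)) = (\<Sum>k<N. z ^ k)"
    by (simp add: z_def mult.commute power_mult[symmetric])
  also have "\<dots> = (if N dvd s then of_nat N else 0)"
  proof (cases "N dvd s")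
    case True
    then show ?thesis using z1 by simp
  next
    case False
    then have "(\<Sum>k<N. z ^ k) = 0" using \<open>z ^ N = 1\<close> z1 by (subst sum_gp_strict) auto
    then show ?thesis using False by simp
  qed
  finally show ?thesis .
qed

lemma monic_linear_power:
  "[:a, 1:] ^ n = (\<Sum>j\<le>n. monom (of_nat (n choose j) * a ^ (n - j)) j)" for a :: complex
proof -
  have "[:a, 1:] ^ n = (monom 1 1 + [:a:]) ^ n" by (simp add: monom_altdef)
  also have "\<dots> = (\<Sum>j\<le>n. of_nat (n choose j) * monom 1 1 ^ j * [:a:] ^ (n - j))"
    by (rule binomial_ring)
  also have "\<dots> = (\<Sum>j\<le>n. monom (of_nat (n choose j) * a ^ (n - j)) j)"
  proof (rule sum.cong)
    fix j
    have "of_nat (n choose j) = [:of_nat (n choose j) :: complex:]" by (rule of_nat_poly)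
    moreover have "[:a:] ^ (n - j) = [:a ^ (n - j):]" by (induction "n - j") (auto simp: poly_const_pow)
    ultimately show "of_nat (n choose j) * monom 1 1 ^ j * [:a:] ^ (n - j) =
        monom (of_nat (n choose j) * a ^ (n - j)) j"
      by (simp add: monom_power smult_monom)
  qed simp
  finally show ?thesis .
qed

lemma smult_sum_right: "Polynomial.smult a (\<Sum>i\<in>I. f i) = (\<Sum>i\<in>I. Polynomial.smult a (f i))"
  by (induction I rule: infinite_finite_induct) (simp_all add: smult_add_right)

text \<open>
  Here \<open>\<nu> f\<close> stands for \<open>\<parallel>f(h)\<parallel>\<close> with \<open>h\<close> self-adjoint.  The hypotheses \<open>\<parallel>h \<plusminus> c\<parallel> \<le> c\<close> say that \<open>h\<close>
  is both nonnegative and nonpositive.  To see \<open>h = 0\<close> without spectral theory, note that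
  \<open>\<parallel>h + cz\<parallel>\<^sup>2 = \<parallel>h\<^sup>2 + 2 c h Re z + c\<^sup>2\<parallel>\<close> for \<open>\<bar>z\<bar> = 1\<close> is a convex function of \<open>Re z\<close>, so that the bound
  \<open>\<parallel>h + cz\<parallel> \<le> c\<close> holds on the whole circle.  Averaging \<open>(h + cz)\<^sup>n\<close> against a power of \<open>z\<close> over roots of
  unity isolates its term \<open>n c\<^bsup>n-1\<^esup> h\<close>.  Hence \<open>n \<parallel>h\<parallel> \<le> c\<close> for all \<open>n\<close>.
\<close>
lemma poly_cstar_norm_zero:
  fixes \<nu> :: "complex poly \<Rightarrow> real"
  assumes add: "\<And>f g. \<nu> (f + g) \<le> \<nu> f + \<nu> g"
    and scale: "\<And>a f. \<nu> (Polynomial.smult a f) = cmod a * \<nu> f"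
    and mult: "\<And>f g. \<nu> (f * g) \<le> \<nu> f * \<nu> g"
    and cstar: "\<And>f. \<nu> (map_poly cnj f * f) = (\<nu> f)\<^sup>2"
    and c: "0 < c" and plus: "\<nu> [:complex_of_real c, 1:] \<le> c" and minus: "\<nu> [:- complex_of_real c, 1:] \<le> c"
  shows "\<nu> [:0, 1:] = 0"
proof -
  have zero: "\<nu> 0 = 0" using scale[of 0 0] by simp
  have nonneg: "0 \<le> \<nu> f" for f
    using add[of f "Polynomial.smult (-1) f"] scale[of "-1" f] zero by simp
  have sum: "\<nu> (\<Sum>i\<in>I. f i) \<le> (\<Sum>i\<in>I. \<nu> (f i))" for f and I :: "nat set"
    by (induction I rule: infinite_finite_induct) (auto simp: zero intro: order_trans[OF add])
  have one: "\<nu> 1 \<le> 1"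
  proof -
    have "(\<nu> 1)\<^sup>2 = \<nu> 1" using cstar[of 1] by simp
    then have "\<nu> 1 = 0 \<or> \<nu> 1 = 1" by (simp add: power2_eq_square)
    then show ?thesis by auto
  qed
  have pow: "\<nu> (f ^ n) \<le> \<nu> f ^ n" for f n
  proof (induction n)
    case (Suc n)
    then show ?case using mult[of f "f ^ n"] mult_left_mono[OF Suc nonneg[of f]] by simp
  qed (simp add: one)
  have circle: "\<nu> [:c * z, 1:] \<le> c" if z: "cmod z = 1" for z :: complex
  proof -
    define r where "r = Re z"
    have r: "\<bar>r\<bar> \<le> 1" using abs_Re_le_cmod[of z] z by (simp add: r_def)
    have zz: "cnj z * z = 1" "cnj z + z = 2 * r"
      using z by (simp_all add: complex_norm_square[symmetric] mult.commute r_def complex_add_cnj add.commute)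
    have "map_poly cnj [:c * z, 1:] * [:c * z, 1:] = [:c * c * (cnj z * z), c * (cnj z + z), 1:]"
      by (simp add: map_poly_pCons algebra_simps)
    also have "\<dots> = Polynomial.smult ((1 + r) / 2) ([:c, 1:] * [:c, 1:]) + Polynomial.smult ((1 - r) / 2) ([:- c, 1:] * [:- c, 1:])"
      unfolding zz by (simp add: field_simps)
    finally have "(\<nu> [:c * z, 1:])\<^sup>2 \<le> \<nu> (Polynomial.smult ((1 + r) / 2) ([:c, 1:] * [:c, 1:]))
        + \<nu> (Polynomial.smult ((1 - r) / 2) ([:- c, 1:] * [:- c, 1:]))"
      using add cstar[of "[:c * z, 1:]"] by metis
    also have "\<dots> = (1 + r) / 2 * \<nu> ([:c, 1:] * [:c, 1:]) + (1 - r) / 2 * \<nu> ([:- c, 1:] * [:- c, 1:])"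
    proof -
      have "- 1 \<le> r" "r \<le> 1" using r by linarith+
      then have "\<bar>(1 + r) / 2\<bar> = (1 + r) / 2" "\<bar>(1 - r) / 2\<bar> = (1 - r) / 2" by simp_all
      then show ?thesis by (simp only: scale norm_of_real)
    qed
    also have "\<dots> \<le> (1 + r) / 2 * c\<^sup>2 + (1 - r) / 2 * c\<^sup>2"
    proof -
      have square: "\<nu> (f * f) \<le> c\<^sup>2" if "\<nu> f \<le> c" for f
        unfolding power2_eq_square by (rule order_trans[OF mult mult_mono'[OF that that nonneg nonneg]])
      have "\<nu> ([:- complex_of_real c, 1:] * [:- complex_of_real c, 1:]) \<le> c\<^sup>2" by (rule square[OF minus])
      then have m: "\<nu> ([:complex_of_real (- c), 1:] * [:complex_of_real (- c), 1:]) \<le> c\<^sup>2"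
        by (simp only: of_real_minus)
      have "- 1 \<le> r" "r \<le> 1" using r by linarith+
      then have "0 \<le> (1 + r) / 2" "0 \<le> (1 - r) / 2" by simp_all
      then show ?thesis by (intro add_mono mult_left_mono m square[OF plus])
    qed
    also have "\<dots> = c\<^sup>2" by (simp add: field_simps)
    finally show ?thesis by (rule power2_le_imp_le) (use c in simp)
  qed
  have bound: "real n * \<nu> [:0, 1:] \<le> c" if n: "1 \<le> n" for n
  proof -
    \<comment> \<open>With \<open>n + 1\<close> roots of unity and the weight \<open>w\<^bsup>2k\<^esup>\<close>, only the term with \<open>n - j + 2 = n + 1\<close> survives.\<close>
    define N where "N = Suc n"
    define w where "w = cis (2 * pi / N)"
    have w: "cmod (w ^ k) = 1" for k by (simp add: w_def norm_power)
    have pw: "w ^ (k * (m + 2)) = w ^ (k * 2) * (w ^ k) ^ m" for k m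
      unfolding distrib_left power_add power_mult by (rule mult.commute)
    have "(\<Sum>k<N. Polynomial.smult (w ^ (k * 2)) ([:c * w ^ k, 1:] ^ n)) =
        (\<Sum>k<N. \<Sum>j\<le>n. monom (of_nat (n choose j) * c ^ (n - j) * w ^ (k * (n - j + 2))) j)"
      unfolding monic_linear_power smult_sum_right smult_monom
      by (intro sum.cong refl arg_cong2[where f = monom])
         (simp only: pw power_mult_distrib mult_ac of_real_mult of_real_power of_real_of_nat_eq)
    also have "\<dots> = (\<Sum>j\<le>n. monom (of_nat (n choose j) * c ^ (n - j) * (\<Sum>k<N. w ^ (k * (n - j + 2)))) j)"
      by (subst sum.swap) (simp add: monom_sum sum_distrib_left)
    also have "\<dots> = (\<Sum>j\<le>n. if j = 1 then monom (of_nat n * c ^ (n - 1) * of_nat N) 1 else 0)"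
    proof (rule sum.cong)
      fix j assume j: "j \<in> {..n}"
      have "N dvd (n - j + 2) \<longleftrightarrow> j = 1"
      proof
        assume "N dvd n - j + 2"
        then obtain q where q: "n - j + 2 = Suc n * q" by (auto simp: N_def dvd_def)
        show "j = 1"
        proof (cases q)
          case (Suc q')
          show ?thesis
          proof (cases q')
            case 0
            then show ?thesis using q Suc j by simp
          next
            case (Suc q'')
            then show ?thesis using q \<open>q = Suc q'\<close> n by (simp add: algebra_simps)
          qed
        qed (use q in simp)
      qed (use n in \<open>simp add: N_def\<close>)
      then show "monom (of_nat (n choose j) * c ^ (n - j) * (\<Sum>k<N. w ^ (k * (n - j + 2)))) j =
          (if j = 1 then monom (of_nat n * c ^ (n - 1) * of_nat N) 1 else 0)"
        unfolding w_def by (subst sum_root_unity_powers) (auto simp: N_def)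
    qed simp
    also have "\<dots> = Polynomial.smult (of_real (n * c ^ (n - 1) * N)) [:0, 1:]"
      using n by (simp add: sum.delta monom_altdef)
    finally have "n * c ^ (n - 1) * N * \<nu> [:0, 1:] = \<nu> (\<Sum>k<N. Polynomial.smult (w ^ (k * 2)) ([:c * w ^ k, 1:] ^ n))"
      using c by (simp only: scale norm_of_real) simp
    also have "\<dots> \<le> (\<Sum>k<N. c ^ n)"
    proof (rule order_trans[OF sum sum_mono])
      fix k
      have "\<nu> ([:c * w ^ k, 1:] ^ n) \<le> c ^ n"
        using pow[of "[:c * w ^ k, 1:]" n] power_mono[OF circle[OF w] nonneg, of k n] by linarith
      then show "\<nu> (Polynomial.smult (w ^ (k * 2)) ([:c * w ^ k, 1:] ^ n)) \<le> c ^ n" by (simp add: scale w)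
    qed
    also have "\<dots> = c * c ^ (n - 1) * N" using n by (cases n) auto
    finally have "(c ^ (n - 1) * N) * (n * \<nu> [:0, 1:]) \<le> (c ^ (n - 1) * N) * c" by (simp add: mult_ac)
    then show ?thesis using c by (simp add: N_def)
  qed
  have "\<nu> [:0, 1:] \<le> 0"
  proof (rule ccontr)
    assume "\<not> \<nu> [:0, 1:] \<le> 0"
    then obtain n where "c < of_nat n * \<nu> [:0, 1:]" using ex_less_of_nat_mult[of "\<nu> [:0, 1:]" c] by auto
    then show False using bound[of n] c by (cases n) auto
  qed
  then show ?thesis using nonneg[of "[:0, 1:]"] by simp
qed

section \<open>Projections with sum one\<close>

primrec horner :: "('b, 'm) cstar_scheme \<Rightarrow> 'b \<Rightarrow> 'b \<Rightarrow> complex list \<Rightarrow> 'b" where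
  "horner A e h [] = \<zero>\<^bsub>A\<^esub>"
| "horner A e h (a # as) = a \<odot>\<^bsub>A\<^esub> e \<oplus>\<^bsub>A\<^esub> h \<otimes>\<^bsub>A\<^esub> horner A e h as"

text \<open>
  The value of a polynomial at \<open>h\<close> in the corner with unit \<open>e\<close>, by Horner's scheme: the constant term
  \<open>a\<close> contributes \<open>a e\<close>.
\<close>
definition corner_eval :: "('b, 'm) cstar_scheme \<Rightarrow> 'b \<Rightarrow> 'b \<Rightarrow> complex poly \<Rightarrow> 'b" where
  "corner_eval A e h f = horner A e h (coeffs f)"

context unital_cstar_algebra
begin

lemmas star_closed [simp] = smult_closed cadj_closed

definition projection :: "'a \<Rightarrow> bool" where
  "projection e \<longleftrightarrow> e \<in> carrier A \<and> cadj A e = e \<and> e \<otimes> e = e"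

lemma projectionD: "projection e \<Longrightarrow> e \<in> carrier A" "projection e \<Longrightarrow> cadj A e = e"
  "projection e \<Longrightarrow> e \<otimes> e = e"
  by (auto simp: projection_def)

lemma minus_zero: "x \<in> carrier A \<Longrightarrow> x \<ominus> \<zero> = x"
  by (simp add: minus_eq)

lemma cnorm_projection_le:
  assumes "projection e" shows "cnorm A e \<le> 1"
proof -
  have "(cnorm A e)\<^sup>2 = cnorm A e" using cstar_identity[of e] projectionD[OF assms] by simp
  then have "cnorm A e = 0 \<or> cnorm A e = 1" by (simp add: power2_eq_square)
  then show ?thesis by auto
qed

lemma projection_one: "projection \<one>"
  by (simp add: projection_def cadj_one)

lemma cnorm_finsum_le:
  "finite I \<Longrightarrow> (\<And>i. i \<in> I \<Longrightarrow> f i \<in> carrier A) \<Longrightarrow> cnorm A (\<Oplus>i\<in>I. f i) \<le> (\<Sum>i\<in>I. cnorm A (f i))"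
proof (induction I rule: finite_induct)
  case (insert i I)
  then have "(\<Oplus>i\<in>insert i I. f i) = f i \<oplus> (\<Oplus>i\<in>I. f i)" by (intro finsum_insert) auto
  moreover have "(\<Oplus>i\<in>I. f i) \<in> carrier A" using insert.prems by (intro finsum_closed) auto
  ultimately show ?case
    using insert cnorm_add[of "f i" "\<Oplus>i\<in>I. f i"] by (force intro: order_trans)
qed (simp add: cnorm_zero)

lemma corner_eval_zero: "corner_eval A e h 0 = \<zero>"
  by (simp add: corner_eval_def)

context
  fixes e h assumes e: "projection e" and h: "h \<in> carrier A" "cadj A h = h" "e \<otimes> h = h" "h \<otimes> e = h"
begin

lemma corner_eval_pCons: "corner_eval A e h (pCons a f) = a \<odot> e \<oplus> h \<otimes> corner_eval A e h f"
  using h projectionD[OF e]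
  by (cases "a = 0 \<and> f = 0") (auto simp: corner_eval_def smult_zero_scalar coeffs_pCons_eq_cCons cCons_def)

lemma corner_eval_closed [simp]: "corner_eval A e h f \<in> carrier A"
  using h projectionD[OF e] by (induction f) (auto simp: corner_eval_zero corner_eval_pCons)

lemma corner_eval_unit: "e \<otimes> corner_eval A e h f = corner_eval A e h f"
  using h projectionD[OF e]
  by (induction f)
     (simp_all add: corner_eval_zero corner_eval_pCons r_distr smult_mult_right flip: m_assoc)

lemma corner_eval_add: "corner_eval A e h (f + g) = corner_eval A e h f \<oplus> corner_eval A e h g"
  using h projectionD[OF e]
  by (induction f g rule: poly_induct2)
     (simp_all add: corner_eval_zero corner_eval_pCons r_distr smult_add_scalar a_ac)

lemma corner_eval_smult: "corner_eval A e h (Polynomial.smult c f) = c \<odot> corner_eval A e h f"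
  using h projectionD[OF e]
  by (induction f)
     (simp_all add: corner_eval_zero corner_eval_pCons smult_smult smult_add smult_mult_right smult_zero)

lemma corner_eval_mult: "corner_eval A e h (f * g) = corner_eval A e h f \<otimes> corner_eval A e h g"
proof (induction f)
  case (pCons a f)
  have "corner_eval A e h (pCons a f * g) = a \<odot> corner_eval A e h g \<oplus> h \<otimes> (corner_eval A e h f \<otimes> corner_eval A e h g)"
    using pCons h projectionD[OF e]
    by (simp add: corner_eval_add corner_eval_smult corner_eval_pCons smult_zero_scalar)
  also have "a \<odot> corner_eval A e h g = (a \<odot> e) \<otimes> corner_eval A e h g"
    using projectionD[OF e] by (simp add: smult_mult_left corner_eval_unit)
  finally show ?case
    using h projectionD[OF e] by (simp add: corner_eval_pCons l_distr m_assoc)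
qed (simp add: corner_eval_zero)

lemma corner_eval_commute: "h \<otimes> corner_eval A e h f = corner_eval A e h f \<otimes> h"
proof (induction f)
  case (pCons a f)
  have "h \<otimes> (corner_eval A e h f \<otimes> h) = corner_eval A e h f \<otimes> (h \<otimes> h)"
    using pCons h by (simp flip: m_assoc)
  then show ?case
    using pCons h projectionD[OF e]
    by (simp add: corner_eval_pCons r_distr l_distr smult_mult_right smult_mult_left m_assoc)
qed (simp add: corner_eval_zero h)

lemma corner_eval_cadj: "cadj A (corner_eval A e h f) = corner_eval A e h (map_poly cnj f)"
  using h projectionD[OF e]
  by (induction f)
     (simp_all add: corner_eval_zero corner_eval_pCons map_poly_pCons cadj_zero cadj_add cadj_smult cadj_mult
       corner_eval_commute)

lemma selfadjoint_zero_if_bounds: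
  assumes c: "0 < c" and plus: "cnorm A (complex_of_real c \<odot> e \<oplus> h) \<le> c"
    and minus: "cnorm A (- complex_of_real c \<odot> e \<oplus> h) \<le> c"
  shows "h = \<zero>"
proof -
  have lin: "corner_eval A e h [:a, 1:] = a \<odot> e \<oplus> h" for a
    using h projectionD[OF e] by (simp add: corner_eval_zero corner_eval_pCons smult_one)
  have "cnorm A (corner_eval A e h [:0, 1:]) = 0"
  proof (rule poly_cstar_norm_zero[where \<nu> = "\<lambda>f. cnorm A (corner_eval A e h f)", OF _ _ _ _ c])
    show "cnorm A (corner_eval A e h (map_poly cnj f * f)) = (cnorm A (corner_eval A e h f))\<^sup>2" for f
      using cstar_identity[of "corner_eval A e h f"] by (simp add: corner_eval_mult corner_eval_cadj)
  qed (use plus minus in \<open>simp_all add: corner_eval_add corner_eval_smult corner_eval_mult cnorm_add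
      cnorm_smult cnorm_mult lin\<close>)
  then show ?thesis
    using h projectionD[OF e] by (simp add: lin smult_zero_scalar cnorm_eq_zero)
qed

end

text \<open>
  This says that \<open>efe\<close> lies between \<open>0\<close> and \<open>e\<close>.  It holds because \<open>efe - e/2\<close> is half the
  compression of the self-adjoint unitary \<open>2f - 1\<close>.
\<close>
lemma compressed_projection_bound:
  assumes e: "projection e" and f: "projection f"
  shows "cnorm A (e \<otimes> f \<otimes> e \<ominus> (1/2) \<odot> e) \<le> 1/2"
proof -
  note c = projectionD[OF e] projectionD[OF f]
  define u where "u = 2 \<odot> f \<oplus> \<ominus> \<one>"
  have uc: "u \<in> carrier A" using c by (simp add: u_def)
  have u_adj: "cadj A u = u" using c by (simp add: u_def cadj_add cadj_smult cadj_uminus cadj_one)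
  have "u \<otimes> u = \<one>"
  proof -
    define g where "g = 2 \<odot> f"
    have gc: "g \<in> carrier A" using c by (simp add: g_def)
    have "g \<otimes> g = (2 * 2) \<odot> f"
      using c by (simp only: g_def smult_mult_left smult_mult_right smult_closed smult_smult)
    also have "\<dots> = (2 + 2) \<odot> f" by simp
    also have "\<dots> = g \<oplus> g" using c by (simp only: g_def smult_add_scalar)
    finally have gg: "g \<otimes> g = g \<oplus> g" .
    have "u \<otimes> u = (g \<oplus> g) \<oplus> (\<ominus> g \<oplus> (\<ominus> g \<oplus> \<one>))"
      using gc by (simp add: u_def g_def[symmetric] l_distr r_distr gg l_minus r_minus minus_add a_ac)
    also have "\<dots> = g \<oplus> (g \<oplus> \<ominus> g) \<oplus> \<ominus> g \<oplus> \<one>" using gc by (simp only: a_assoc a_closed a_inv_closed one_closed)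
    also have "\<dots> = \<one>" using gc by (simp add: r_neg)
    finally show ?thesis .
  qed
  then have "(cnorm A u)\<^sup>2 \<le> 1"
    using cstar_identity[OF uc] u_adj cnorm_projection_le[OF projection_one] by simp
  then have u1: "cnorm A u \<le> 1" using cnorm_nonneg[OF uc] by (simp add: power_le_one_iff)
  have "e \<otimes> f \<otimes> e \<ominus> (1/2) \<odot> e = (1/2) \<odot> (e \<otimes> u \<otimes> e)"
    using c by (simp add: u_def l_distr r_distr smult_mult_left smult_mult_right smult_add
        l_minus r_minus smult_uminus minus_eq smult_smult[symmetric] smult_one)
  moreover have "cnorm A (e \<otimes> u \<otimes> e) \<le> 1 * 1 * 1"
    using c uc u1 cnorm_projection_le[OF e]
    by (intro order_trans[OF cnorm_mult] mult_mono cnorm_nonneg) (auto simp: cnorm_nonneg)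
  ultimately show ?thesis using c uc by (simp add: cnorm_smult)
qed

text \<open>
  Compressing the sum by \<open>P j\<close> gives \<open>\<Sum>\<^sub>k W k = P j\<close> for \<open>W k = P j P k P j\<close>, and \<open>W j = P j\<close>, so
  that the other \<open>W k\<close> are nonnegative with sum \<open>0\<close>.  Hence \<open>W i\<close> is also nonpositive, and it vanishes.
  Positivity is expressed by norm bounds as in \<open>compressed_projection_bound\<close>.
\<close>
lemma orthogonal_projections:
  assumes fin: "finite I" and P: "\<And>i. i \<in> I \<Longrightarrow> projection (P i)"
    and sum: "(\<Oplus>i\<in>I. P i) = \<one>" and ij: "i \<in> I" "j \<in> I" "i \<noteq> j"
  shows "P i \<otimes> P j = \<zero>"
proof -
  note c = projectionD[OF P]
  define e where "e = P j"
  have e: "projection e" using P ij(2) by (simp add: e_def)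
  note ec = projectionD[OF e]
  define W where "W k = e \<otimes> P k \<otimes> e" for k
  have Wc: "k \<in> I \<Longrightarrow> W k \<in> carrier A" for k using c ec by (simp add: W_def)
  define K where "K = I - {i, j}"
  have K: "finite K" "K \<subseteq> I" "i \<notin> K" "j \<notin> K" "I = insert i (insert j K)"
    using fin ij by (auto simp: K_def)
  let ?r = "\<lambda>L. complex_of_real (real (card L) / 2)"
  have bound: "cnorm A ((\<Oplus>k\<in>L. W k) \<ominus> ?r L \<odot> e) \<le> real (card L) / 2"
    if "finite L" "L \<subseteq> I" for L
    using that
  proof (induction L rule: finite_induct)
    case empty
    then show ?case using ec by (simp add: smult_zero_scalar minus_zero cnorm_zero)
  next
    case (insert k L)
    have Lc: "(\<Oplus>k\<in>L. W k) \<in> carrier A" using insert Wc by (intro finsum_closed) auto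
    have "(\<Oplus>k\<in>insert k L. W k) = W k \<oplus> (\<Oplus>k\<in>L. W k)" using insert Wc by (intro finsum_insert) auto
    moreover have "complex_of_real (real (card (insert k L)) / 2) = 1/2 + complex_of_real (real (card L) / 2)"
      using insert by (simp add: add_divide_distrib)
    ultimately have "(\<Oplus>k\<in>insert k L. W k) \<ominus> ?r (insert k L) \<odot> e =
        (W k \<ominus> (1/2) \<odot> e) \<oplus> ((\<Oplus>k\<in>L. W k) \<ominus> ?r L \<odot> e)"
      using insert Wc Lc ec by (simp only: smult_add_scalar) (simp add: minus_add_minus)
    then have "cnorm A ((\<Oplus>k\<in>insert k L. W k) \<ominus> ?r (insert k L) \<odot> e) \<le>
        cnorm A (W k \<ominus> (1/2) \<odot> e) + cnorm A ((\<Oplus>k\<in>L. W k) \<ominus> ?r L \<odot> e)"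
      using insert Wc Lc ec by (simp add: cnorm_add)
    moreover have "cnorm A (W k \<ominus> (1/2) \<odot> e) \<le> 1/2"
      using insert compressed_projection_bound[OF e P] by (simp add: W_def)
    ultimately show ?case using insert by (simp add: add_divide_distrib)
  qed
  have WK: "(\<Oplus>k\<in>K. W k) \<in> carrier A" using K Wc by (intro finsum_closed) auto
  have PI: "P \<in> I \<rightarrow> carrier A" using c by auto
  have "(\<Oplus>k\<in>I. W k) = e \<otimes> (\<Oplus>k\<in>I. P k) \<otimes> e"
    using ec PI unfolding W_def
    by (subst finsum_rdistr[OF fin]; simp add: Pi_iff)
       (subst finsum_ldistr[OF fin]; simp add: Pi_iff)
  then have "(\<Oplus>k\<in>I. W k) = e" using ec by (simp add: sum)
  moreover have "(\<Oplus>k\<in>I. W k) = W i \<oplus> (W j \<oplus> (\<Oplus>k\<in>K. W k))"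
    unfolding K(5) using K Wc ij by (simp add: finsum_insert Pi_iff subset_iff)
  moreover have "W j = e" using ec by (simp add: W_def flip: e_def)
  ultimately have "e = W i \<oplus> (e \<oplus> (\<Oplus>k\<in>K. W k))" by simp
  then have "e \<oplus> \<zero> = e \<oplus> (W i \<oplus> (\<Oplus>k\<in>K. W k))" using ec WK Wc ij by (simp add: a_ac)
  then have "\<ominus> e \<oplus> (e \<oplus> \<zero>) = \<ominus> e \<oplus> (e \<oplus> (W i \<oplus> (\<Oplus>k\<in>K. W k)))" by simp
  then have "W i \<oplus> (\<Oplus>k\<in>K. W k) = \<zero>"
    using ec WK Wc ij by (simp only: r_neg1 zero_closed a_closed)
  then have WKi: "(\<Oplus>k\<in>K. W k) = \<ominus> (W i)" using WK Wc ij by (metis a_comm minus_equality)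
  define m where "m = real (card K) / 2"
  have i1: "cnorm A (W i \<ominus> (1/2) \<odot> e) \<le> 1/2"
    using compressed_projection_bound[OF e P[OF ij(1)]] by (simp add: W_def)
  have i2: "cnorm A (W i \<oplus> complex_of_real m \<odot> e) \<le> m"
  proof -
    have "\<ominus> (W i) \<ominus> complex_of_real m \<odot> e = \<ominus> (W i \<oplus> complex_of_real m \<odot> e)"
      using ec Wc ij by (simp add: minus_eq minus_add)
    then show ?thesis
      using bound[OF K(1,2)] ec Wc ij by (simp add: WKi m_def cnorm_minus)
  qed
  have m0: "0 \<le> m" by (simp add: m_def)
  have "W i = \<zero>"
  proof (rule selfadjoint_zero_if_bounds[OF e])
    show "W i \<in> carrier A" using Wc ij by simp
    show "cadj A (W i) = W i" using ec c ij by (simp add: W_def cadj_mult m_assoc)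
    show "e \<otimes> W i = W i" using ec c ij by (simp add: W_def flip: m_assoc)
    show "W i \<otimes> e = W i" using ec c ij by (simp add: W_def m_assoc)
    show "0 < m + 1/2" using m0 by simp
    have e1: "cnorm A (r \<odot> e) \<le> cmod r" for r
      using cnorm_projection_le[OF e] ec by (simp add: cnorm_smult mult_left_le)
    have "complex_of_real (m + 1/2) \<odot> e \<oplus> W i = (1/2) \<odot> e \<oplus> (W i \<oplus> complex_of_real m \<odot> e)"
      using ec Wc ij by (simp add: smult_add_scalar a_ac)
    then show "cnorm A (complex_of_real (m + 1/2) \<odot> e \<oplus> W i) \<le> m + 1/2"
      using cnorm_add[of "(1/2) \<odot> e" "W i \<oplus> complex_of_real m \<odot> e"] e1[of "1/2"] i2 ec Wc ij by simp
    have "- complex_of_real (m + 1/2) = - complex_of_real m + (-1) * (1/2)" by simp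
    then have "- complex_of_real (m + 1/2) \<odot> e \<oplus> W i = (- complex_of_real m) \<odot> e \<oplus> (W i \<ominus> (1/2) \<odot> e)"
      using ec Wc ij by (simp only: smult_add_scalar smult_smult) (simp add: smult_minus_one minus_eq a_ac)
    then show "cnorm A (- complex_of_real (m + 1/2) \<odot> e \<oplus> W i) \<le> m + 1/2"
      using cnorm_add[of "(- complex_of_real m) \<odot> e" "W i \<ominus> (1/2) \<odot> e"] e1[of "- complex_of_real m"]
        i1 ec Wc ij m0 by simp
  qed
  then have "cadj A (P i \<otimes> P j) \<otimes> (P i \<otimes> P j) = \<zero>"
    using c ij m_assoc[of e "P i" "P i \<otimes> e"] m_assoc[of "P i" "P i" e]
    by (simp add: W_def cadj_mult m_assoc e_def)
  then have "(cnorm A (P i \<otimes> P j))\<^sup>2 = 0"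
    using cstar_identity[of "P i \<otimes> P j"] c ij by (simp add: cnorm_zero)
  then show ?thesis using c ij by (simp add: cnorm_eq_zero)
qed

end

section \<open>The quotient norm of an ideal\<close>

context unital_cstar_algebra
begin

definition quotient_norm :: "'a set \<Rightarrow> 'a \<Rightarrow> real" where
  "quotient_norm J x = (INF j\<in>J. cnorm A (x \<ominus> j))"

context
  fixes J assumes J: "ideal J A"
begin

interpretation J: ideal J A by (rule J)

lemma quotient_norm_le_diff:
  assumes "x \<in> carrier A" "j \<in> J" shows "quotient_norm J x \<le> cnorm A (x \<ominus> j)"
  unfolding quotient_norm_def
  by (rule cINF_lower[OF _ assms(2)]) (use assms J.Icarr in \<open>auto intro!: bdd_belowI[of _ 0] cnorm_nonneg\<close>)

lemma quotient_norm_le: "x \<in> carrier A \<Longrightarrow> quotient_norm J x \<le> cnorm A x"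
  using quotient_norm_le_diff[of x \<zero>] by (simp add: minus_zero)

lemma quotient_norm_greatest:
  assumes "0 \<le> k" "\<And>j. j \<in> J \<Longrightarrow> a \<le> k * cnorm A (x \<ominus> j)"
  shows "a \<le> k * quotient_norm J x"
proof (cases "k = 0")
  case True
  then show ?thesis using assms(2)[of \<zero>] by simp
next
  case False
  have "a / k \<le> quotient_norm J x"
    unfolding quotient_norm_def
  proof (rule cINF_greatest)
    show "J \<noteq> {}" using J.zero_closed by blast
    show "a / k \<le> cnorm A (x \<ominus> j)" if "j \<in> J" for j
      using assms(2)[OF that] assms(1) False by (simp add: field_simps)
  qed
  then show ?thesis using assms(1) False by (simp add: field_simps)
qed

lemma quotient_norm_nonneg: "x \<in> carrier A \<Longrightarrow> 0 \<le> quotient_norm J x"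
  using quotient_norm_greatest[of 1 0 x] by (simp add: cnorm_nonneg J.Icarr)

lemma quotient_norm_mult:
  assumes x: "x \<in> carrier A" and y: "y \<in> carrier A"
  shows "quotient_norm J (x \<otimes> y) \<le> quotient_norm J x * quotient_norm J y"
proof -
  have le: "quotient_norm J (x \<otimes> y) \<le> cnorm A (x \<ominus> i) * cnorm A (y \<ominus> j)" if ij: "i \<in> J" "j \<in> J" for i j
  proof -
    have c: "i \<in> carrier A" "j \<in> carrier A" using ij by (auto simp: J.Icarr)
    define k where "k = x \<otimes> j \<oplus> i \<otimes> (y \<ominus> j)"
    have "k \<in> J" 
      unfolding k_def using ij x y c by (intro J.a_closed J.I_l_closed J.I_r_closed) simp_all
    have "(x \<ominus> i) \<otimes> (y \<ominus> j) = x \<otimes> (y \<ominus> j) \<ominus> i \<otimes> (y \<ominus> j)"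
      using x y c by (simp add: minus_eq l_distr l_minus)
    also have "x \<otimes> (y \<ominus> j) = x \<otimes> y \<ominus> x \<otimes> j" using x y c by (simp add: minus_eq r_distr r_minus)
    also have "(x \<otimes> y \<ominus> x \<otimes> j) \<ominus> i \<otimes> (y \<ominus> j) = x \<otimes> y \<ominus> k"
      using x y c by (simp add: k_def minus_eq minus_add a_assoc)
    finally show ?thesis
      using quotient_norm_le_diff[of "x \<otimes> y" k] \<open>k \<in> J\<close> cnorm_mult[of "x \<ominus> i" "y \<ominus> j"] x y c by simp
  qed
  have "quotient_norm J (x \<otimes> y) \<le> quotient_norm J y * cnorm A (x \<ominus> i)" if i: "i \<in> J" for i
    using quotient_norm_greatest[of "cnorm A (x \<ominus> i)" "quotient_norm J (x \<otimes> y)" y] le i x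
    by (simp add: cnorm_nonneg J.Icarr mult.commute)
  then show ?thesis
    using quotient_norm_greatest[of "quotient_norm J y" "quotient_norm J (x \<otimes> y)" x] quotient_norm_nonneg[OF y]
    by (simp add: mult.commute)
qed

lemma quotient_norm_sandwich:
  assumes "a \<in> carrier A" "x \<in> carrier A" "b \<in> carrier A" "cnorm A a \<le> 1" "cnorm A b \<le> 1"
  shows "quotient_norm J (a \<otimes> x \<otimes> b) \<le> quotient_norm J x"
proof -
  have "quotient_norm J (a \<otimes> x \<otimes> b) \<le> quotient_norm J (a \<otimes> x) * quotient_norm J b"
    using assms by (intro quotient_norm_mult) auto
  also have "\<dots> \<le> (quotient_norm J a * quotient_norm J x) * 1"
    using assms quotient_norm_le[of b]
    by (intro mult_mono quotient_norm_mult) (auto intro!: mult_nonneg_nonneg quotient_norm_nonneg)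
  also have "\<dots> \<le> 1 * quotient_norm J x"
    using assms quotient_norm_le[of a] by (simp add: mult_left_le_one_le quotient_norm_nonneg)
  finally show ?thesis by simp
qed

text \<open>
  If \<open>\<parallel>1 - j\<parallel> < 1\<close> for some \<open>j \<in> J\<close>, then the elements \<open>1 - (1 - j)\<^sup>n\<close> of \<open>J\<close> tend to \<open>1\<close>.
\<close>
lemma quotient_norm_scalar:
  assumes closed: "closed_in_norm A J" and one: "\<one> \<notin> J"
  shows "cmod c \<le> quotient_norm J (c \<odot> \<one>)"
proof -
  have far: "1 \<le> cnorm A (\<one> \<ominus> j)" if j: "j \<in> J" for j
  proof (rule ccontr)
    assume small: "\<not> 1 \<le> cnorm A (\<one> \<ominus> j)"
    define t where "t = \<one> \<ominus> j"
    have jc: "j \<in> carrier A" using j by (rule J.Icarr)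
    then have tc: "t \<in> carrier A" by (simp add: t_def)
    have t0: "0 \<le> cnorm A t" by (rule cnorm_nonneg[OF tc])
    define f where "f n = \<one> \<ominus> t [^] n" for n :: nat
    have f: "f n \<in> J" for n
    proof (induction n)
      case 0
      then show ?case by (simp add: f_def minus_eq r_neg)
    next
      case (Suc n)
      have "f (Suc n) = f n \<oplus> t [^] n \<otimes> j"
        using tc jc by (simp add: f_def t_def minus_eq r_distr r_minus minus_add a_assoc)
      then show ?case using Suc j tc by (simp add: J.a_closed J.I_l_closed)
    qed
    have "cnorm A (f n \<ominus> \<one>) \<le> cnorm A t ^ n" for n
    proof -
      have "f n \<ominus> \<one> = \<ominus> (t [^] n)" using tc by (simp add: f_def minus_eq a_ac r_neg2)
      moreover have "cnorm A (t [^] n) \<le> cnorm A t ^ n"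
      proof (induction n)
        case (Suc n)
        have "cnorm A (t [^] n \<otimes> t) \<le> cnorm A (t [^] n) * cnorm A t" using tc by (simp add: cnorm_mult)
        also have "\<dots> \<le> cnorm A t ^ n * cnorm A t" by (rule mult_right_mono[OF Suc t0])
        finally show ?case by (simp add: mult.commute)
      qed (simp add: cnorm_projection_le[OF projection_one])
      ultimately show ?thesis using tc by (simp add: cnorm_minus)
    qed
    moreover have "(\<lambda>n. cnorm A t ^ n) \<longlonglongrightarrow> 0"
      using small t0 by (intro LIMSEQ_realpow_zero) (auto simp: t_def)
    ultimately have "norm_limit f \<one>"
      using f by (intro norm_limitI[of f \<one> "\<lambda>n. cnorm A t ^ n"]) (auto simp: J.Icarr)
    then show False using closed f one unfolding closed_in_norm_def norm_limit_def by blast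
  qed
  show ?thesis
  proof (cases "c = 0")
    case False
    have "cmod c \<le> 1 * quotient_norm J (c \<odot> \<one>)"
    proof (rule quotient_norm_greatest)
      fix j assume j: "j \<in> J"
      then have jc: "j \<in> carrier A" by (rule J.Icarr)
      have "(1/c) \<odot> j = ((1/c) \<odot> \<one>) \<otimes> j" using jc by (simp add: smult_mult_left)
      then have "(1/c) \<odot> j \<in> J" using j by (simp add: J.I_l_closed)
      moreover have "c \<odot> (\<one> \<ominus> (1/c) \<odot> j) = c \<odot> \<one> \<ominus> j"
        using jc False by (simp add: minus_eq smult_add smult_uminus smult_smult[symmetric] smult_one)
      moreover have "cnorm A (c \<odot> (\<one> \<ominus> (1/c) \<odot> j)) = cmod c * cnorm A (\<one> \<ominus> (1/c) \<odot> j)"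
        using jc by (simp add: cnorm_smult)
      ultimately show "cmod c \<le> 1 * cnorm A (c \<odot> \<one> \<ominus> j)"
        using mult_left_mono[OF far[of "(1/c) \<odot> j"], of "cmod c"] by simp
    qed simp
    then show ?thesis by simp
  qed (simp add: quotient_norm_nonneg)
qed

end

lemma smult_finsum:
  "finite K \<Longrightarrow> (\<And>k. k \<in> K \<Longrightarrow> F k \<in> carrier A) \<Longrightarrow> c \<odot> (\<Oplus>k\<in>K. F k) = (\<Oplus>k\<in>K. c \<odot> F k)"
proof (induction K rule: finite_induct)
  case (insert k K)
  moreover have "(\<Oplus>k\<in>K. F k) \<in> carrier A" using insert by (intro finsum_closed) auto
  ultimately show ?case by (simp add: finsum_insert smult_add Pi_iff)
qed (simp add: smult_zero)

lemma cadj_finsum: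
  "finite K \<Longrightarrow> (\<And>k. k \<in> K \<Longrightarrow> F k \<in> carrier A) \<Longrightarrow> cadj A (\<Oplus>k\<in>K. F k) = (\<Oplus>k\<in>K. cadj A (F k))"
proof (induction K rule: finite_induct)
  case (insert k K)
  moreover have "(\<Oplus>k\<in>K. F k) \<in> carrier A" using insert by (intro finsum_closed) auto
  ultimately show ?case by (simp add: finsum_insert cadj_add Pi_iff)
qed (simp add: cadj_zero)

lemma finsum_linear_combinations:
  assumes "finite I" "finite K" and F: "\<And>k. k \<in> K \<Longrightarrow> F k \<in> carrier A"
  shows "(\<Oplus>i\<in>I. c i \<odot> (\<Oplus>k\<in>K. B i k \<odot> F k)) = (\<Oplus>k\<in>K. (\<Sum>i\<in>I. c i * B i k) \<odot> F k)"
  using assms(1)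
proof (induction I rule: finite_induct)
  case empty
  show ?case using F by (simp add: smult_zero_scalar cong: finsum_cong)
next
  case (insert i I)
  have cl: "(\<Oplus>k\<in>K. B i k \<odot> F k) \<in> carrier A" for i using F by (intro finsum_closed) auto
  have "(\<Oplus>i\<in>insert i I. c i \<odot> (\<Oplus>k\<in>K. B i k \<odot> F k)) =
      c i \<odot> (\<Oplus>k\<in>K. B i k \<odot> F k) \<oplus> (\<Oplus>i\<in>I. c i \<odot> (\<Oplus>k\<in>K. B i k \<odot> F k))"
    using insert cl by (intro finsum_insert) auto
  also have "c i \<odot> (\<Oplus>k\<in>K. B i k \<odot> F k) = (\<Oplus>k\<in>K. (c i * B i k) \<odot> F k)"
    using F assms(2) by (subst smult_finsum) (auto simp: smult_smult intro!: finsum_cong')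
  also have "\<dots> \<oplus> (\<Oplus>i\<in>I. c i \<odot> (\<Oplus>k\<in>K. B i k \<odot> F k)) =
      (\<Oplus>k\<in>K. (c i * B i k) \<odot> F k \<oplus> (\<Sum>i\<in>I. c i * B i k) \<odot> F k)"
    unfolding insert.IH using F by (intro finsum_addf[symmetric]) auto
  also have "\<dots> = (\<Oplus>k\<in>K. (\<Sum>i\<in>insert i I. c i * B i k) \<odot> F k)"
    using F insert by (intro finsum_cong') (auto simp: smult_add_scalar)
  finally show ?case .
qed

lemma finsum_delta:
  "finite I \<Longrightarrow> i \<in> I \<Longrightarrow> F i \<in> carrier A \<Longrightarrow> (\<And>j. j \<in> I \<Longrightarrow> j \<noteq> i \<Longrightarrow> F j = \<zero>) \<Longrightarrow> (\<Oplus>j\<in>I. F j) = F i"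
proof -
  assume a: "finite I" "i \<in> I" "F i \<in> carrier A" "\<And>j. j \<in> I \<Longrightarrow> j \<noteq> i \<Longrightarrow> F j = \<zero>"
  have c: "F \<in> I \<rightarrow> carrier A" using a by (metis Pi_I zero_closed)
  have "(\<Oplus>j\<in>I. F j) = (\<Oplus>j\<in>I. if i = j then F j else \<zero>)"
    using a c by (intro finsum_cong') auto
  also have "\<dots> = F i" by (rule finsum_singleton[OF a(2,1) c])
  finally show ?thesis .
qed

end

lemma (in unital_cstar_algebra) finsum_sandwich:
  assumes "finite K" "\<And>k. k \<in> K \<Longrightarrow> F k \<in> carrier A" "a \<in> carrier A" "b \<in> carrier A"
  shows "a \<otimes> (\<Oplus>k\<in>K. F k) \<otimes> b = (\<Oplus>k\<in>K. a \<otimes> F k \<otimes> b)"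
proof -
  have "a \<otimes> (\<Oplus>k\<in>K. F k) = (\<Oplus>k\<in>K. a \<otimes> F k)"
    using assms by (intro finsum_rdistr) auto
  moreover have "(\<Oplus>k\<in>K. a \<otimes> F k) \<otimes> b = (\<Oplus>k\<in>K. a \<otimes> F k \<otimes> b)"
    using assms by (intro finsum_ldistr) auto
  ultimately show ?thesis by simp
qed

section \<open>The diagonal of a \<open>\<lambda>\<close>-family\<close>

locale lambda_family_algebra = unital_cstar_algebra A for A (structure) +
  fixes \<Lambda> :: "(int \<Rightarrow> 'c::finite) set" and S :: "'c \<Rightarrow> 'a" and E :: "nat \<Rightarrow> 'c list set \<Rightarrow> 'a"
  assumes family: "lambda_family \<Lambda> A S E"
begin

lemma S_closed [simp]: "S \<alpha> \<in> carrier A"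
  using family by (simp add: lambda_family_def)

lemma S_partial_isometry: "S \<alpha> \<otimes> (cadj A (S \<alpha>) \<otimes> S \<alpha>) = S \<alpha>"
  using family by (simp add: lambda_family_def m_assoc[symmetric])

lemma S_partial_isometry': "cadj A (S \<alpha>) \<otimes> (S \<alpha> \<otimes> cadj A (S \<alpha>)) = cadj A (S \<alpha>)"
proof -
  have "cadj A (S \<alpha> \<otimes> (cadj A (S \<alpha>) \<otimes> S \<alpha>)) = cadj A (S \<alpha>)" by (simp only: S_partial_isometry)
  then show ?thesis by (simp add: cadj_mult cadj_cadj m_assoc)
qed

lemma projection_E: "v \<in> vertices \<Lambda> l \<Longrightarrow> projection (E l v)"
  using family unfolding lambda_family_def projection_def by blast

lemma E_closed [simp]: "v \<in> vertices \<Lambda> l \<Longrightarrow> E l v \<in> carrier A"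
  using projectionD(1)[OF projection_E] .

lemma sum_E: "(\<Oplus>v\<in>vertices \<Lambda> l. E l v) = \<one>"
  using family by (simp add: lambda_family_def)

lemma E_orthogonal: "u \<in> vertices \<Lambda> l \<Longrightarrow> v \<in> vertices \<Lambda> l \<Longrightarrow> u \<noteq> v \<Longrightarrow> E l u \<otimes> E l v = \<zero>"
  by (rule orthogonal_projections[OF finite_vertices projection_E sum_E])

lemma sum_S: "(\<Oplus>\<beta>\<in>UNIV. S \<beta> \<otimes> cadj A (S \<beta>)) = \<one>"
  using family by (simp add: lambda_family_def)

lemma S_orthogonal:
  assumes "\<alpha> \<noteq> \<beta>" shows "cadj A (S \<alpha>) \<otimes> S \<beta> = \<zero>"
proof -
  have "projection (S \<gamma> \<otimes> cadj A (S \<gamma>))" for \<gamma>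
    by (simp add: projection_def cadj_mult cadj_cadj m_assoc S_partial_isometry')
  from orthogonal_projections[OF finite this sum_S UNIV_I UNIV_I assms]
  have 0: "S \<alpha> \<otimes> cadj A (S \<alpha>) \<otimes> (S \<beta> \<otimes> cadj A (S \<beta>)) = \<zero>" .
  have "cadj A (S \<alpha>) \<otimes> S \<beta> = cadj A (S \<alpha>) \<otimes> (S \<alpha> \<otimes> cadj A (S \<alpha>)) \<otimes> (S \<beta> \<otimes> (cadj A (S \<beta>) \<otimes> S \<beta>))"
    by (simp only: S_partial_isometry S_partial_isometry')
  also have "\<dots> = cadj A (S \<alpha>) \<otimes> (S \<alpha> \<otimes> cadj A (S \<alpha>) \<otimes> (S \<beta> \<otimes> cadj A (S \<beta>))) \<otimes> S \<beta>"
    by (simp add: m_assoc)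
  also have "\<dots> = \<zero>" by (simp add: 0)
  finally show ?thesis .
qed

text \<open>
  The linear combinations of the vertex projections of level \<open>l\<close>, with coefficients read off from words.
  In this form the relations are transparent: \<open>diag_elt_refine\<close> is the passage to the next level, and
  \<open>diag_elt_edge\<close> says that conjugation by a letter prepends this letter to the argument.
\<close>
definition diag_elt :: "nat \<Rightarrow> ('c list \<Rightarrow> complex) \<Rightarrow> 'a" where
  "diag_elt l g = (\<Oplus>v\<in>vertices \<Lambda> l. g (vertex_word v) \<odot> E l v)"

lemma diag_elt_closed [simp]: "diag_elt l g \<in> carrier A"
  unfolding diag_elt_def by (intro finsum_closed) auto

lemma diag_elt_cong: "(\<And>\<mu>. \<mu> \<in> synchronizing_words \<Lambda> l \<Longrightarrow> g \<mu> = h \<mu>) \<Longrightarrow> diag_elt l g = diag_elt l h"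
  unfolding diag_elt_def by (intro finsum_cong') (auto simp: vertex_word(1))

lemma diag_elt_one: "diag_elt l (\<lambda>_. 1) = \<one>"
  unfolding diag_elt_def sum_E[of l, symmetric] by (intro finsum_cong') (auto simp: smult_one)

lemma diag_elt_add: "diag_elt l (\<lambda>\<mu>. g \<mu> + h \<mu>) = diag_elt l g \<oplus> diag_elt l h"
proof -
  have "diag_elt l (\<lambda>\<mu>. g \<mu> + h \<mu>) =
      (\<Oplus>v\<in>vertices \<Lambda> l. g (vertex_word v) \<odot> E l v \<oplus> h (vertex_word v) \<odot> E l v)"
    unfolding diag_elt_def by (intro finsum_cong') (auto simp: smult_add_scalar)
  then show ?thesis unfolding diag_elt_def by (simp add: finsum_addf)
qed

lemma diag_elt_smult: "diag_elt l (\<lambda>\<mu>. c * g \<mu>) = c \<odot> diag_elt l g"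
  unfolding diag_elt_def
  by (subst smult_finsum[OF finite_vertices]) (auto simp: smult_smult intro!: finsum_cong')

lemma diag_elt_cadj: "diag_elt l (\<lambda>\<mu>. cnj (g \<mu>)) = cadj A (diag_elt l g)"
  unfolding diag_elt_def
  by (subst cadj_finsum[OF finite_vertices])
     (auto simp: cadj_smult projectionD(2)[OF projection_E] intro!: finsum_cong')

lemma E_mult_diag_elt: "v \<in> vertices \<Lambda> l \<Longrightarrow> E l v \<otimes> diag_elt l g = g (vertex_word v) \<odot> E l v"
proof -
  assume v: "v \<in> vertices \<Lambda> l"
  have "E l v \<otimes> diag_elt l g = (\<Oplus>w\<in>vertices \<Lambda> l. E l v \<otimes> (g (vertex_word w) \<odot> E l w))"
    unfolding diag_elt_def using v by (intro finsum_rdistr finite_vertices) auto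
  also have "\<dots> = E l v \<otimes> (g (vertex_word v) \<odot> E l v)"
    using v by (intro finsum_delta finite_vertices) (auto simp: smult_mult_right E_orthogonal smult_zero)
  finally show ?thesis using v by (simp add: smult_mult_right projectionD(3)[OF projection_E])
qed

lemma diag_elt_mult: "diag_elt l g \<otimes> diag_elt l h = diag_elt l (\<lambda>\<mu>. g \<mu> * h \<mu>)"
proof -
  have "diag_elt l g \<otimes> diag_elt l h = (\<Oplus>v\<in>vertices \<Lambda> l. g (vertex_word v) \<odot> E l v \<otimes> diag_elt l h)"
    by (subst (1) diag_elt_def) (intro finsum_ldistr finite_vertices diag_elt_closed, auto)
  also have "\<dots> = diag_elt l (\<lambda>\<mu>. g \<mu> * h \<mu>)"
    unfolding diag_elt_def[of l "\<lambda>\<mu>. g \<mu> * h \<mu>"]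
    by (intro finsum_cong') (auto simp: smult_mult_left E_mult_diag_elt smult_smult)
  finally show ?thesis .
qed

lemma diag_elt_of_class:
  assumes "u \<in> vertices \<Lambda> l"
  shows "diag_elt l (\<lambda>\<mu>. if past_class \<Lambda> l \<mu> = u then 1 else 0) = E l u"
proof -
  have "diag_elt l (\<lambda>\<mu>. if past_class \<Lambda> l \<mu> = u then 1 else 0) =
      (if past_class \<Lambda> l (vertex_word u) = u then 1 else 0) \<odot> E l u"
    unfolding diag_elt_def using assms
    by (intro finsum_delta finite_vertices) (auto simp: smult_zero_scalar vertex_word(2))
  then show ?thesis using assms by (simp add: vertex_word smult_one)
qed

lemma sum_over_class:
  assumes "past_invariant \<Lambda> l g" "\<nu> \<in> synchronizing_words \<Lambda> l"
  shows "(\<Sum>u\<in>vertices \<Lambda> l. g (vertex_word u) * (if past_class \<Lambda> l \<nu> = u then 1 else 0)) = g \<nu>"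
proof -
  have "(\<Sum>u\<in>vertices \<Lambda> l. g (vertex_word u) * (if past_class \<Lambda> l \<nu> = u then 1 else 0)) =
      (\<Sum>u\<in>vertices \<Lambda> l. if past_class \<Lambda> l \<nu> = u then g (vertex_word u) else 0)"
    by (intro sum.cong) auto
  then show ?thesis
    using past_class_in_vertices[OF assms(2)] past_invariantD[OF assms]
    by (simp add: sum.delta' finite_vertices)
qed

lemma diag_elt_refine:
  assumes g: "past_invariant \<Lambda> l g"
  shows "diag_elt l g = diag_elt (Suc l) g"
proof -
  have "diag_elt l g = (\<Oplus>u\<in>vertices \<Lambda> l. g (vertex_word u) \<odot>
      (\<Oplus>v\<in>vertices \<Lambda> (Suc l). I_entry \<Lambda> l u v \<odot> E (Suc l) v))"
    unfolding diag_elt_def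
  proof (intro finsum_cong')
    fix u assume u: "u \<in> vertices \<Lambda> l"
    have "E l u = (\<Oplus>v\<in>vertices \<Lambda> (Suc l). I_entry \<Lambda> l u v \<odot> E (Suc l) v)"
      using family u by (simp add: lambda_family_def)
    then show "g (vertex_word u) \<odot> E l u =
        g (vertex_word u) \<odot> (\<Oplus>v\<in>vertices \<Lambda> (Suc l). I_entry \<Lambda> l u v \<odot> E (Suc l) v)" by simp
  qed (auto intro!: finsum_closed)
  also have "\<dots> = (\<Oplus>v\<in>vertices \<Lambda> (Suc l).
      (\<Sum>u\<in>vertices \<Lambda> l. g (vertex_word u) * I_entry \<Lambda> l u v) \<odot> E (Suc l) v)"
    by (intro finsum_linear_combinations finite_vertices) auto
  also have "\<dots> = diag_elt (Suc l) g"
    unfolding diag_elt_def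
  proof (intro finsum_cong')
    fix v assume v: "v \<in> vertices \<Lambda> (Suc l)"
    note w = vertex_word[OF v]
    have "iota \<Lambda> l v = past_class \<Lambda> l (vertex_word v)"
      using iota_past_class[OF w(1)] w(2) by simp
    then have "(\<Sum>u\<in>vertices \<Lambda> l. g (vertex_word u) * I_entry \<Lambda> l u v) = g (vertex_word v)"
      using sum_over_class[OF g] w(1) synchronizing_words_antimono[of \<Lambda> l] by (auto simp: I_entry_def)
    then show "(\<Sum>u\<in>vertices \<Lambda> l. g (vertex_word u) * I_entry \<Lambda> l u v) \<odot> E (Suc l) v =
        g (vertex_word v) \<odot> E (Suc l) v" by simp
  qed auto
  finally show ?thesis .
qed

lemma A_entry_past_class:
  assumes v: "v \<in> vertices \<Lambda> (Suc l)"
  shows "A_entry \<Lambda> l u \<alpha> v =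
    (if \<alpha> # vertex_word v \<in> words \<Lambda> \<and> past_class \<Lambda> l (\<alpha> # vertex_word v) = u then 1 else 0)"
proof -
  note w = vertex_word[OF v]
  show ?thesis
    using labeled_edge_past_class[OF w(1), of u \<alpha>] by (simp add: A_entry_def w(2))
qed

lemma diag_elt_edge:
  assumes g: "past_invariant \<Lambda> l g"
  shows "cadj A (S \<alpha>) \<otimes> diag_elt l g \<otimes> S \<alpha> = diag_elt (Suc l) (prepend \<Lambda> [\<alpha>] g)"
proof -
  have "cadj A (S \<alpha>) \<otimes> diag_elt l g \<otimes> S \<alpha> =
      (\<Oplus>u\<in>vertices \<Lambda> l. cadj A (S \<alpha>) \<otimes> (g (vertex_word u) \<odot> E l u) \<otimes> S \<alpha>)"
    unfolding diag_elt_def by (intro finsum_sandwich finite_vertices) auto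
  also have "\<dots> = (\<Oplus>u\<in>vertices \<Lambda> l. g (vertex_word u) \<odot>
      (\<Oplus>v\<in>vertices \<Lambda> (Suc l). A_entry \<Lambda> l u \<alpha> v \<odot> E (Suc l) v))"
  proof (intro finsum_cong')
    fix u assume u: "u \<in> vertices \<Lambda> l"
    have "cadj A (S \<alpha>) \<otimes> E l u \<otimes> S \<alpha> = (\<Oplus>v\<in>vertices \<Lambda> (Suc l). A_entry \<Lambda> l u \<alpha> v \<odot> E (Suc l) v)"
      using family u unfolding lambda_family_def by blast
    then show "cadj A (S \<alpha>) \<otimes> (g (vertex_word u) \<odot> E l u) \<otimes> S \<alpha> = g (vertex_word u) \<odot>
        (\<Oplus>v\<in>vertices \<Lambda> (Suc l). A_entry \<Lambda> l u \<alpha> v \<odot> E (Suc l) v)"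
      using u by (simp add: smult_mult_left smult_mult_right)
  qed (auto intro!: finsum_closed)
  also have "\<dots> = (\<Oplus>v\<in>vertices \<Lambda> (Suc l).
      (\<Sum>u\<in>vertices \<Lambda> l. g (vertex_word u) * A_entry \<Lambda> l u \<alpha> v) \<odot> E (Suc l) v)"
    by (intro finsum_linear_combinations finite_vertices) auto
  also have "\<dots> = diag_elt (Suc l) (prepend \<Lambda> [\<alpha>] g)"
    unfolding diag_elt_def
  proof (intro finsum_cong')
    fix v assume v: "v \<in> vertices \<Lambda> (Suc l)"
    have "(\<Sum>u\<in>vertices \<Lambda> l. g (vertex_word u) * A_entry \<Lambda> l u \<alpha> v) = prepend \<Lambda> [\<alpha>] g (vertex_word v)"
      using sum_over_class[OF g synchronizing_words_Cons'[OF vertex_word(1)[OF v], of \<alpha>]]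
      by (auto simp: A_entry_past_class[OF v] prepend_def)
    then show "(\<Sum>u\<in>vertices \<Lambda> l. g (vertex_word u) * A_entry \<Lambda> l u \<alpha> v) \<odot> E (Suc l) v =
        prepend \<Lambda> [\<alpha>] g (vertex_word v) \<odot> E (Suc l) v" by simp
  qed auto
  finally show ?thesis .
qed

end

context lambda_family_algebra
begin

primrec S_word :: "'c list \<Rightarrow> 'a" where
  "S_word [] = \<one>"
| "S_word (\<alpha> # \<mu>) = S \<alpha> \<otimes> S_word \<mu>"

abbreviation S_adj :: "'c list \<Rightarrow> 'a" where
  "S_adj \<mu> \<equiv> cadj A (S_word \<mu>)"

lemma S_word_closed [simp]: "S_word \<mu> \<in> carrier A"
  by (induction \<mu>) auto

lemma S_word_append: "S_word (\<mu> @ \<nu>) = S_word \<mu> \<otimes> S_word \<nu>"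
  by (induction \<mu>) (auto simp: m_assoc)

lemma cnorm_S_le: "cnorm A (S \<alpha>) \<le> 1"
proof -
  have "projection (cadj A (S \<alpha>) \<otimes> S \<alpha>)"
    by (simp add: projection_def cadj_mult cadj_cadj m_assoc S_partial_isometry)
  from cnorm_projection_le[OF this] have "(cnorm A (S \<alpha>))\<^sup>2 \<le> 1" by (simp add: cstar_identity)
  then show ?thesis using cnorm_nonneg[of "S \<alpha>"] by (simp add: power_le_one_iff)
qed

lemma cnorm_mult_le_one:
  "x \<in> carrier A \<Longrightarrow> y \<in> carrier A \<Longrightarrow> cnorm A x \<le> 1 \<Longrightarrow> cnorm A y \<le> 1 \<Longrightarrow> cnorm A (x \<otimes> y) \<le> 1"
proof -
  assume c: "x \<in> carrier A" "y \<in> carrier A" and le: "cnorm A x \<le> 1" "cnorm A y \<le> 1"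
  show ?thesis by (rule order_trans[OF cnorm_mult[OF c] mult_le_one[OF le(1) cnorm_nonneg[OF c(2)] le(2)]])
qed

lemma cnorm_S_word_le: "cnorm A (S_word \<mu>) \<le> 1"
proof (induction \<mu>)
  case (Cons \<alpha> \<mu>)
  show ?case using cnorm_mult_le_one[OF S_closed S_word_closed cnorm_S_le Cons] by simp
qed (simp add: cnorm_projection_le[OF projection_one])

definition diag :: "nat \<Rightarrow> 'a set" where
  "diag l = diag_elt l ` {g. past_invariant \<Lambda> l g}"

lemma diagI: "past_invariant \<Lambda> l g \<Longrightarrow> diag_elt l g \<in> diag l"
  by (simp add: diag_def)

lemma diagE:
  assumes "a \<in> diag l" obtains g where "past_invariant \<Lambda> l g" "a = diag_elt l g"
  using assms by (auto simp: diag_def)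

lemma diag_closed: "a \<in> diag l \<Longrightarrow> a \<in> carrier A"
  by (auto simp: diag_def)

lemma diag_one: "\<one> \<in> diag l"
  using diagI[of l "\<lambda>_. 1"] by (simp add: past_invariant_const diag_elt_one)

lemma diag_smult: "a \<in> diag l \<Longrightarrow> c \<odot> a \<in> diag l"
proof (elim diagE)
  fix g assume g: "past_invariant \<Lambda> l g" "a = diag_elt l g"
  show ?thesis
    unfolding g(2) diag_elt_smult[symmetric] by (rule diagI[OF past_invariant_binary[OF g(1,1)]])
qed

lemma diag_zero: "\<zero> \<in> diag l"
  using diag_smult[OF diag_one, of 0 l] by (simp add: smult_zero_scalar)

lemma diag_add: "a \<in> diag l \<Longrightarrow> b \<in> diag l \<Longrightarrow> a \<oplus> b \<in> diag l"
proof (elim diagE)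
  fix g h assume gh: "past_invariant \<Lambda> l g" "a = diag_elt l g" "past_invariant \<Lambda> l h" "b = diag_elt l h"
  show ?thesis
    unfolding gh(2,4) diag_elt_add[symmetric] by (rule diagI[OF past_invariant_binary[OF gh(1,3)]])
qed

lemma diag_mult: "a \<in> diag l \<Longrightarrow> b \<in> diag l \<Longrightarrow> a \<otimes> b \<in> diag l"
proof (elim diagE)
  fix g h assume gh: "past_invariant \<Lambda> l g" "a = diag_elt l g" "past_invariant \<Lambda> l h" "b = diag_elt l h"
  show ?thesis
    unfolding gh(2,4) diag_elt_mult by (rule diagI[OF past_invariant_binary[OF gh(1,3)]])
qed

lemma diag_cadj: "a \<in> diag l \<Longrightarrow> cadj A a \<in> diag l"
proof (elim diagE)
  fix g assume g: "past_invariant \<Lambda> l g" "a = diag_elt l g"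
  show ?thesis
    unfolding g(2) diag_elt_cadj[symmetric] by (rule diagI[OF past_invariant_binary[OF g(1,1)]])
qed

lemma diag_E: "v \<in> vertices \<Lambda> l \<Longrightarrow> E l v \<in> diag l"
proof -
  assume v: "v \<in> vertices \<Lambda> l"
  have "past_invariant \<Lambda> l (\<lambda>\<mu>. if past_class \<Lambda> l \<mu> = v then 1 else 0)"
    unfolding past_invariant_def using past_class_eq_iff by metis
  from diagI[OF this] show ?thesis by (simp only: diag_elt_of_class[OF v])
qed

lemma diag_mono: "l \<le> l' \<Longrightarrow> diag l \<subseteq> diag l'"
proof (rule lift_Suc_mono_le[of diag])
  show "diag l \<subseteq> diag (Suc l)" for l
  proof
    fix a assume "a \<in> diag l"
    then obtain g where g: "past_invariant \<Lambda> l g" "a = diag_elt l g" by (rule diagE)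
    show "a \<in> diag (Suc l)"
      unfolding g(2) diag_elt_refine[OF g(1)] by (rule diagI[OF past_invariant_Suc[OF g(1)]])
  qed
qed

lemma finsum_mem:
  "finite I \<Longrightarrow> \<zero> \<in> X \<Longrightarrow> (\<And>x y. x \<in> X \<Longrightarrow> y \<in> X \<Longrightarrow> x \<oplus> y \<in> X) \<Longrightarrow> X \<subseteq> carrier A \<Longrightarrow>
    (\<And>i. i \<in> I \<Longrightarrow> f i \<in> X) \<Longrightarrow> (\<Oplus>i\<in>I. f i) \<in> X"
proof (induction I rule: finite_induct)
  case (insert i I)
  then have "(\<Oplus>i\<in>insert i I. f i) = f i \<oplus> (\<Oplus>i\<in>I. f i)" by (intro finsum_insert) auto
  then show ?case using insert by auto
qed simp

lemma diag_commute_range: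
  assumes "a \<in> diag l" shows "a \<otimes> (S \<alpha> \<otimes> cadj A (S \<alpha>)) = S \<alpha> \<otimes> cadj A (S \<alpha>) \<otimes> a"
proof -
  obtain g where a: "a = diag_elt l g" using assms by (rule diagE)
  let ?p = "S \<alpha> \<otimes> cadj A (S \<alpha>)"
  have E: "?p \<otimes> E l v = E l v \<otimes> ?p" if "v \<in> vertices \<Lambda> l" for v
  proof -
    have "S \<alpha> \<otimes> cadj A (S \<alpha>) \<otimes> E l v = E l v \<otimes> S \<alpha> \<otimes> cadj A (S \<alpha>)"
      using family that unfolding lambda_family_def by blast
    then show ?thesis using that by (simp add: m_assoc)
  qed
  have "a \<otimes> ?p = (\<Oplus>v\<in>vertices \<Lambda> l. g (vertex_word v) \<odot> E l v \<otimes> ?p)"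
    unfolding a diag_elt_def by (intro finsum_ldistr finite_vertices) auto
  also have "\<dots> = (\<Oplus>v\<in>vertices \<Lambda> l. ?p \<otimes> (g (vertex_word v) \<odot> E l v))"
    by (intro finsum_cong') (auto simp: smult_mult_left smult_mult_right E)
  also have "\<dots> = ?p \<otimes> a"
    unfolding a diag_elt_def by (intro finsum_rdistr[symmetric] finite_vertices) auto
  finally show ?thesis .
qed

text \<open>
  Diagonal elements commute with the range projections of the letters.
\<close>
lemma diag_S:
  assumes "a \<in> diag l"
  shows "a \<otimes> S \<alpha> = S \<alpha> \<otimes> (cadj A (S \<alpha>) \<otimes> a \<otimes> S \<alpha>)"
    and "cadj A (S \<alpha>) \<otimes> a \<otimes> S \<alpha> \<in> diag (Suc l)"
    and "\<alpha> \<noteq> \<beta> \<Longrightarrow> cadj A (S \<alpha>) \<otimes> a \<otimes> S \<beta> = \<zero>"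
proof -
  have ac: "a \<in> carrier A" using assms by (rule diag_closed)
  have i: "a \<otimes> S \<alpha> = S \<alpha> \<otimes> (cadj A (S \<alpha>) \<otimes> a \<otimes> S \<alpha>)" for \<alpha>
  proof -
    have "a \<otimes> S \<alpha> = a \<otimes> (S \<alpha> \<otimes> cadj A (S \<alpha>)) \<otimes> S \<alpha>" using ac by (simp add: m_assoc S_partial_isometry)
    then show ?thesis using ac by (simp add: diag_commute_range[OF assms] m_assoc)
  qed
  then show "a \<otimes> S \<alpha> = S \<alpha> \<otimes> (cadj A (S \<alpha>) \<otimes> a \<otimes> S \<alpha>)" .
  show "cadj A (S \<alpha>) \<otimes> a \<otimes> S \<alpha> \<in> diag (Suc l)"
  proof -
    obtain g where g: "past_invariant \<Lambda> l g" "a = diag_elt l g" using assms by (rule diagE)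
    show ?thesis
      unfolding g(2) diag_elt_edge[OF g(1)] by (rule diagI[OF past_invariant_prepend[OF g(1)]])
  qed
  assume "\<alpha> \<noteq> \<beta>"
  have "cadj A (S \<alpha>) \<otimes> a \<otimes> S \<beta> = cadj A (S \<alpha>) \<otimes> (a \<otimes> S \<beta>)" using ac by (simp add: m_assoc)
  also have "\<dots> = (cadj A (S \<alpha>) \<otimes> S \<beta>) \<otimes> (cadj A (S \<beta>) \<otimes> a \<otimes> S \<beta>)"
    by (subst i) (use ac in \<open>simp add: m_assoc\<close>)
  also have "\<dots> = \<zero>" using ac by (simp add: S_orthogonal[OF \<open>\<alpha> \<noteq> \<beta>\<close>])
  finally show "cadj A (S \<alpha>) \<otimes> a \<otimes> S \<beta> = \<zero>" .
qed

lemma diag_S_word: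
  assumes "a \<in> diag l"
  shows "a \<otimes> S_word \<mu> = S_word \<mu> \<otimes> (S_adj \<mu> \<otimes> a \<otimes> S_word \<mu>)"
  using assms
proof (induction \<mu> arbitrary: l a)
  case Nil
  then show ?case by (simp add: cadj_one diag_closed)
next
  case (Cons \<alpha> \<mu>)
  have ac: "a \<in> carrier A" using Cons.prems by (rule diag_closed)
  have "a \<otimes> S_word (\<alpha> # \<mu>) = S \<alpha> \<otimes> ((cadj A (S \<alpha>) \<otimes> a \<otimes> S \<alpha>) \<otimes> S_word \<mu>)"
    using ac diag_S(1)[OF Cons.prems, of \<alpha>] by (simp flip: m_assoc)
  also have "\<dots> = S \<alpha> \<otimes> (S_word \<mu> \<otimes> (S_adj \<mu> \<otimes> (cadj A (S \<alpha>) \<otimes> a \<otimes> S \<alpha>) \<otimes> S_word \<mu>))"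
    using Cons.IH[OF diag_S(2)[OF Cons.prems]] by simp
  finally show ?case using ac by (simp add: cadj_mult m_assoc)
qed

lemma S_word_partial_isometry: "S_word \<mu> \<otimes> (S_adj \<mu> \<otimes> S_word \<mu>) = S_word \<mu>"
  using diag_S_word[OF diag_one[of 0], of \<mu>] by simp

lemma diag_elt_S_word:
  "past_invariant \<Lambda> l g \<Longrightarrow>
    S_adj \<omega> \<otimes> diag_elt l g \<otimes> S_word \<omega> = diag_elt (l + length \<omega>) (prepend \<Lambda> \<omega> g)"
proof (induction \<omega> arbitrary: l g)
  case Nil
  then show ?case by (auto simp: cadj_one prepend_def synchronizing_words_def intro!: diag_elt_cong)
next
  case (Cons \<alpha> \<omega>)
  have "S_adj (\<alpha> # \<omega>) \<otimes> diag_elt l g \<otimes> S_word (\<alpha> # \<omega>) =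
      S_adj \<omega> \<otimes> (cadj A (S \<alpha>) \<otimes> diag_elt l g \<otimes> S \<alpha>) \<otimes> S_word \<omega>"
    by (simp add: cadj_mult m_assoc)
  also have "\<dots> = diag_elt (Suc l + length \<omega>) (prepend \<Lambda> \<omega> (prepend \<Lambda> [\<alpha>] g))"
    by (simp only: diag_elt_edge[OF Cons.prems] Cons.IH[OF past_invariant_prepend[OF Cons.prems]])
  also have "prepend \<Lambda> \<omega> (prepend \<Lambda> [\<alpha>] g) = prepend \<Lambda> (\<alpha> # \<omega>) g"
    using words_append_right[of "[\<alpha>]"] by (auto simp: prepend_def fun_eq_iff)
  finally show ?case by simp
qed

text \<open>
  By \<open>diag_elt_S_word\<close> the coefficient of the compression at \<open>\<zeta>\<close> is \<open>g (\<nu> @ \<eta> @ \<zeta>)\<close>.  It is defined for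
  all \<open>\<zeta>\<close> since \<open>\<nu> @ \<eta>\<close> is universal, and it is \<open>g \<nu>\<close> since \<open>\<nu>\<close> is synchronizing.
\<close>
lemma universal_compression:
  assumes g: "past_invariant \<Lambda> l g" and \<nu>: "\<nu> \<in> synchronizing_words \<Lambda> l"
    and u: "\<nu> @ \<eta> \<in> universal_words \<Lambda>"
  shows "S_adj (\<nu> @ \<eta>) \<otimes> diag_elt l g \<otimes> S_word (\<nu> @ \<eta>) = g \<nu> \<odot> \<one>"
proof -
  have "diag_elt (l + length (\<nu> @ \<eta>)) (prepend \<Lambda> (\<nu> @ \<eta>) g) = diag_elt (l + length (\<nu> @ \<eta>)) (\<lambda>_. g \<nu> * 1)"
  proof (rule diag_elt_cong)
    fix \<zeta> assume "\<zeta> \<in> synchronizing_words \<Lambda> (l + length (\<nu> @ \<eta>))"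
    then have w: "\<nu> @ (\<eta> @ \<zeta>) \<in> words \<Lambda>" using u by (simp add: universal_words_def synchronizing_words_def)
    then have "g (\<nu> @ (\<eta> @ \<zeta>)) = g \<nu>"
      using g \<nu> synchronizing_words_extend[OF \<nu> w] unfolding past_invariant_def by blast
    then show "prepend \<Lambda> (\<nu> @ \<eta>) g \<zeta> = g \<nu> * 1" using w by (simp add: prepend_def)
  qed
  then show ?thesis
    using diag_elt_S_word[OF g, of "\<nu> @ \<eta>"] diag_elt_smult[of _ "g \<nu>" "\<lambda>_. 1"] by (simp add: diag_elt_one)
qed

lemma S_word_orthogonal:
  "length \<mu> = length \<kappa> \<Longrightarrow> \<mu> \<noteq> \<kappa> \<Longrightarrow> S_adj \<mu> \<otimes> S_word \<kappa> = \<zero>"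
proof (induction \<mu> \<kappa> rule: list_induct2)
  case (Cons \<alpha> \<mu> \<beta> \<kappa>)
  have "S_adj (\<alpha> # \<mu>) \<otimes> S_word (\<beta> # \<kappa>) =
      S_adj \<mu> \<otimes> (cadj A (S \<alpha>) \<otimes> S \<beta>) \<otimes> S_word \<kappa>"
    by (simp add: cadj_mult m_assoc)
  also have "\<dots> = \<zero>"
  proof (cases "\<alpha> = \<beta>")
    case True
    have "cadj A (S \<beta>) \<otimes> S \<beta> \<in> diag 1"
      using diag_S(2)[OF diag_one[of 0], of \<beta>] by simp
    note i = diag_S_word[OF this, of \<kappa>]
    have "S_adj \<mu> \<otimes> (cadj A (S \<alpha>) \<otimes> S \<beta>) \<otimes> S_word \<kappa> =
        S_adj \<mu> \<otimes> ((cadj A (S \<beta>) \<otimes> S \<beta>) \<otimes> S_word \<kappa>)"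
      using True by (simp add: m_assoc)
    also have "\<dots> = (S_adj \<mu> \<otimes> S_word \<kappa>) \<otimes>
        (S_adj \<kappa> \<otimes> (cadj A (S \<beta>) \<otimes> S \<beta>) \<otimes> S_word \<kappa>)"
      by (subst i) (simp add: m_assoc)
    finally show ?thesis using Cons True by simp
  qed (simp add: S_orthogonal)
  finally show ?case .
qed simp

lemma S_word_incomparable:
  assumes "length \<omega> \<le> length \<kappa>" "take (length \<omega>) \<kappa> \<noteq> \<omega>"
  shows "S_adj \<omega> \<otimes> S_word \<kappa> = \<zero>"
proof -
  have "S_word \<kappa> = S_word (take (length \<omega>) \<kappa>) \<otimes> S_word (drop (length \<omega>) \<kappa>)"
    by (simp flip: S_word_append)
  then have "S_adj \<omega> \<otimes> S_word \<kappa> =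
      (S_adj \<omega> \<otimes> S_word (take (length \<omega>) \<kappa>)) \<otimes> S_word (drop (length \<omega>) \<kappa>)"
    by (simp add: m_assoc)
  moreover have "S_adj \<omega> \<otimes> S_word (take (length \<omega>) \<kappa>) = \<zero>"
    using assms by (intro S_word_orthogonal) auto
  ultimately show ?thesis by simp
qed

definition words_len :: "nat \<Rightarrow> 'c list set" where
  "words_len n = {\<kappa>. length \<kappa> = n}"

lemma finite_words_len: "finite (words_len n)"
  using finite_lists_length_eq[of "UNIV :: 'c set" n] by (simp add: words_len_def)

lemma words_len_Suc: "words_len (Suc n) = (\<Union>\<alpha>. (#) \<alpha> ` words_len n)"
  by (auto simp: words_len_def length_Suc_conv image_def)

lemma sum_words: "(\<Oplus>\<kappa>\<in>words_len n. S_word \<kappa> \<otimes> S_adj \<kappa>) = \<one>"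
proof (induction n)
  case 0
  have "words_len 0 = {[]}" by (auto simp: words_len_def)
  then show ?case by (simp add: cadj_one)
next
  case (Suc n)
  let ?F = "\<lambda>\<kappa>. S_word \<kappa> \<otimes> S_adj \<kappa>"
  have "(\<Oplus>\<kappa>\<in>words_len (Suc n). ?F \<kappa>) = (\<Oplus>\<alpha>\<in>UNIV. \<Oplus>\<kappa>\<in>(#) \<alpha> ` words_len n. ?F \<kappa>)"
    unfolding words_len_Suc
    by (intro add.finprod_UN_disjoint) (auto simp: finite_words_len pairwise_def disjnt_def)
  also have "\<dots> = (\<Oplus>\<alpha>\<in>UNIV. S \<alpha> \<otimes> cadj A (S \<alpha>))"
  proof (intro finsum_cong')
    fix \<alpha>
    have "(\<Oplus>\<kappa>\<in>(#) \<alpha> ` words_len n. ?F \<kappa>) = (\<Oplus>\<kappa>\<in>words_len n. ?F (\<alpha> # \<kappa>))"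
      by (intro finsum_reindex) (auto simp: inj_on_def)
    also have "\<dots> = (\<Oplus>\<kappa>\<in>words_len n. S \<alpha> \<otimes> ?F \<kappa> \<otimes> cadj A (S \<alpha>))"
      by (intro finsum_cong') (auto simp: cadj_mult m_assoc)
    also have "\<dots> = S \<alpha> \<otimes> (\<Oplus>\<kappa>\<in>words_len n. ?F \<kappa>) \<otimes> cadj A (S \<alpha>)"
      by (intro finsum_sandwich[symmetric] finite_words_len) auto
    finally show "(\<Oplus>\<kappa>\<in>(#) \<alpha> ` words_len n. ?F \<kappa>) = S \<alpha> \<otimes> cadj A (S \<alpha>)" by (simp add: Suc)
  qed auto
  finally show ?case by (simp add: sum_S)
qed

text \<open>
  This expands a product as a product of matrices indexed by the words of length \<open>n\<close>.
\<close>
lemma insert_sum_words: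
  assumes "x \<in> carrier A" "y \<in> carrier A"
  shows "x \<otimes> y = (\<Oplus>\<kappa>\<in>words_len n. x \<otimes> S_word \<kappa> \<otimes> (S_adj \<kappa> \<otimes> y))"
proof -
  have "x \<otimes> y = x \<otimes> (\<Oplus>\<kappa>\<in>words_len n. S_word \<kappa> \<otimes> S_adj \<kappa>) \<otimes> y"
    using assms by (simp add: sum_words)
  also have "\<dots> = (\<Oplus>\<kappa>\<in>words_len n. x \<otimes> (S_word \<kappa> \<otimes> S_adj \<kappa>) \<otimes> y)"
    using assms by (intro finsum_sandwich finite_words_len) auto
  finally show ?thesis using assms by (simp add: m_assoc)
qed

end

section \<open>Matrix blocks and compression by a universal word\<close>

context unital_cstar_algebra
begin

definition iter_square :: "nat \<Rightarrow> 'a \<Rightarrow> 'a" where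
  "iter_square j x = ((\<lambda>x. x \<otimes> x) ^^ j) x"

lemma iter_square_0 [simp]: "iter_square 0 x = x"
  and iter_square_Suc [simp]: "iter_square (Suc j) x = iter_square j x \<otimes> iter_square j x"
  by (simp_all add: iter_square_def)

lemma iter_square_closed [simp]: "x \<in> carrier A \<Longrightarrow> iter_square j x \<in> carrier A"
  by (induction j) auto

lemma iter_square_cadj: "x \<in> carrier A \<Longrightarrow> cadj A x = x \<Longrightarrow> cadj A (iter_square j x) = iter_square j x"
  by (induction j) (auto simp: cadj_mult)

lemma cnorm_iter_square:
  assumes "x \<in> carrier A" "cadj A x = x"
  shows "cnorm A (iter_square j x) = cnorm A x ^ 2 ^ j"
proof (induction j)
  case (Suc j)
  have "cnorm A (iter_square (Suc j) x) = (cnorm A (iter_square j x))\<^sup>2"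
    using cstar_identity[of "iter_square j x"] assms by (simp add: iter_square_cadj)
  then show ?case by (simp add: Suc power2_eq_square mult_2 power_add)
qed simp

lemma quotient_norm_iter_square:
  assumes "ideal J A" "x \<in> carrier A"
  shows "quotient_norm J (iter_square j x) \<le> quotient_norm J x ^ 2 ^ j"
proof (induction j)
  case (Suc j)
  have c: "iter_square j x \<in> carrier A" using assms by simp
  have "quotient_norm J (iter_square (Suc j) x) \<le> quotient_norm J (iter_square j x) * quotient_norm J (iter_square j x)"
    using quotient_norm_mult[OF assms(1) c c] by simp
  also have "\<dots> \<le> quotient_norm J x ^ 2 ^ j * quotient_norm J x ^ 2 ^ j"
    using Suc quotient_norm_nonneg[OF assms(1)] c assms(2) by (intro mult_mono zero_le_power) auto
  finally show ?case by (simp add: mult_2 power_add)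
qed simp

end

context lambda_family_algebra
begin

text \<open>
  The elements of degree \<open>i - j\<close> that are given by a matrix over the diagonal of level \<open>l\<close>, with rows
  indexed by the words of length \<open>i\<close> and columns by the words of length \<open>j\<close>.
\<close>
definition block :: "nat \<Rightarrow> nat \<Rightarrow> nat \<Rightarrow> 'a set" where
  "block i j l = {y \<in> carrier A. \<forall>\<mu>\<in>words_len i. \<forall>\<nu>\<in>words_len j.
     S_adj \<mu> \<otimes> y \<otimes> S_word \<nu> \<in> diag l}"

lemma block_closed: "y \<in> block i j l \<Longrightarrow> y \<in> carrier A"
  by (simp add: block_def)

lemma blockD: "y \<in> block i j l \<Longrightarrow> length \<mu> = i \<Longrightarrow> length \<nu> = j \<Longrightarrow>
    S_adj \<mu> \<otimes> y \<otimes> S_word \<nu> \<in> diag l"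
  by (simp add: block_def words_len_def)

lemma block_zero: "\<zero> \<in> block i j l"
  by (simp add: block_def diag_zero)

lemma block_add: "x \<in> block i j l \<Longrightarrow> y \<in> block i j l \<Longrightarrow> x \<oplus> y \<in> block i j l"
  by (simp add: block_def r_distr l_distr diag_add)

lemma block_cadj:
  assumes "y \<in> block i j l" shows "cadj A y \<in> block j i l"
proof -
  have "S_adj \<mu> \<otimes> cadj A y \<otimes> S_word \<nu> \<in> diag l" if "length \<mu> = j" "length \<nu> = i" for \<mu> \<nu>
    using diag_cadj[OF blockD[OF assms that(2,1)]] block_closed[OF assms]
    by (simp add: cadj_mult cadj_cadj m_assoc)
  then show ?thesis using block_closed[OF assms] by (simp add: block_def words_len_def)
qed

lemma block_mono: "l \<le> l' \<Longrightarrow> block i j l \<subseteq> block i j l'"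
  using diag_mono[of l l'] by (auto simp: block_def)

lemma block_Suc: "block i j l \<subseteq> block (Suc i) (Suc j) (Suc l)"
proof
  fix y assume y: "y \<in> block i j l"
  note yc = block_closed[OF y]
  have "S_adj \<mu>' \<otimes> y \<otimes> S_word \<nu>' \<in> diag (Suc l)"
    if len: "length \<mu>' = Suc i" "length \<nu>' = Suc j" for \<mu>' \<nu>'
  proof -
    obtain \<mu> \<alpha> where \<mu>: "\<mu>' = \<mu> @ [\<alpha>]" "length \<mu> = i" using len(1) by (auto simp: length_Suc_conv_rev)
    obtain \<nu> \<beta> where \<nu>: "\<nu>' = \<nu> @ [\<beta>]" "length \<nu> = j" using len(2) by (auto simp: length_Suc_conv_rev)
    have "S_adj \<mu>' \<otimes> y \<otimes> S_word \<nu>' =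
        cadj A (S \<alpha>) \<otimes> (S_adj \<mu> \<otimes> y \<otimes> S_word \<nu>) \<otimes> S \<beta>"
      using yc by (simp add: \<mu> \<nu> S_word_append cadj_mult m_assoc)
    then show ?thesis
      using diag_S(2,3)[OF blockD[OF y \<mu>(2) \<nu>(2)]] diag_zero by (cases "\<alpha> = \<beta>") auto
  qed
  then show "y \<in> block (Suc i) (Suc j) (Suc l)" using yc by (simp add: block_def words_len_def)
qed

lemma block_shift: "block i j l \<subseteq> block (i + d) (j + d) (l + d)"
proof (induction d)
  case (Suc d)
  then show ?case using block_Suc[of "i + d" "j + d" "l + d"] by auto
qed simp

lemma block_mult:
  assumes y: "y \<in> block i j l" and z: "z \<in> block j k l" shows "y \<otimes> z \<in> block i k l"
proof -
  note c = block_closed[OF y] block_closed[OF z]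
  have "S_adj \<mu> \<otimes> (y \<otimes> z) \<otimes> S_word \<nu> \<in> diag l" if "length \<mu> = i" "length \<nu> = k" for \<mu> \<nu>
  proof -
    have "S_adj \<mu> \<otimes> (y \<otimes> z) \<otimes> S_word \<nu> = (S_adj \<mu> \<otimes> y) \<otimes> (z \<otimes> S_word \<nu>)"
      using c by (simp add: m_assoc)
    also have "\<dots> = (\<Oplus>\<kappa>\<in>words_len j. S_adj \<mu> \<otimes> y \<otimes> S_word \<kappa> \<otimes>
        (S_adj \<kappa> \<otimes> (z \<otimes> S_word \<nu>)))"
      using c by (intro insert_sum_words) auto
    also have "\<dots> \<in> diag l"
    proof (rule finsum_mem[OF finite_words_len diag_zero diag_add])
      fix \<kappa> assume "\<kappa> \<in> words_len j"
      then have \<kappa>: "length \<kappa> = j" by (simp add: words_len_def)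
      have "S_adj \<kappa> \<otimes> (z \<otimes> S_word \<nu>) \<in> diag l"
        using blockD[OF z \<kappa> that(2)] c by (simp add: m_assoc)
      then show "S_adj \<mu> \<otimes> y \<otimes> S_word \<kappa> \<otimes> (S_adj \<kappa> \<otimes> (z \<otimes> S_word \<nu>)) \<in> diag l"
        by (rule diag_mult[OF blockD[OF y that(1) \<kappa>]])
    qed (auto simp: diag_closed)
    finally show ?thesis .
  qed
  then show ?thesis using c by (simp add: block_def words_len_def)
qed

lemma cnorm_le_entries:
  assumes x: "x \<in> carrier A"
    and C: "\<And>\<mu> \<nu>. length \<mu> = n \<Longrightarrow> length \<nu> = n \<Longrightarrow> cnorm A (S_adj \<mu> \<otimes> x \<otimes> S_word \<nu>) \<le> C"
  shows "cnorm A x \<le> real (card (words_len n)) * (real (card (words_len n)) * C)"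
proof -
  let ?c = "real (card (words_len n))"
  have one: "cnorm A (S_adj \<mu>) \<le> 1" for \<mu> by (simp add: cnorm_cadj cnorm_S_word_le)
  \<comment> \<open>The matrix is first expanded along its columns, then along its rows.\<close>
  have row: "cnorm A (S_adj \<mu> \<otimes> x) \<le> ?c * C" if "length \<mu> = n" for \<mu>
  proof -
    have "S_adj \<mu> \<otimes> x =
        (\<Oplus>\<nu>\<in>words_len n. S_adj \<mu> \<otimes> x \<otimes> S_word \<nu> \<otimes> S_adj \<nu>)"
      using insert_sum_words[of "S_adj \<mu> \<otimes> x" \<one> n] x by simp
    also have "cnorm A \<dots> \<le> (\<Sum>\<nu>\<in>words_len n. cnorm A (S_adj \<mu> \<otimes> x \<otimes> S_word \<nu> \<otimes> S_adj \<nu>))"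
      using x by (intro cnorm_finsum_le finite_words_len) auto
    also have "\<dots> \<le> (\<Sum>\<nu>\<in>words_len n. C)"
    proof (intro sum_mono)
      fix \<nu> assume "\<nu> \<in> words_len n"
      then have le: "cnorm A (S_adj \<mu> \<otimes> x \<otimes> S_word \<nu>) \<le> C"
        using C that by (simp add: words_len_def)
      have "cnorm A (S_adj \<mu> \<otimes> x \<otimes> S_word \<nu> \<otimes> S_adj \<nu>) \<le>
          cnorm A (S_adj \<mu> \<otimes> x \<otimes> S_word \<nu>) * cnorm A (S_adj \<nu>)"
        using x by (intro cnorm_mult) auto
      also have "\<dots> \<le> cnorm A (S_adj \<mu> \<otimes> x \<otimes> S_word \<nu>)"
        using one[of \<nu>] x by (intro mult_left_le) (auto simp: cnorm_nonneg)
      finally show "cnorm A (S_adj \<mu> \<otimes> x \<otimes> S_word \<nu> \<otimes> S_adj \<nu>) \<le> C" using le by simp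
    qed
    finally show ?thesis by simp
  qed
  have "x = (\<Oplus>\<mu>\<in>words_len n. S_word \<mu> \<otimes> (S_adj \<mu> \<otimes> x))"
    using insert_sum_words[of \<one> x n] x by simp
  then have "cnorm A x = cnorm A (\<Oplus>\<mu>\<in>words_len n. S_word \<mu> \<otimes> (S_adj \<mu> \<otimes> x))" by simp
  also have "\<dots> \<le> (\<Sum>\<mu>\<in>words_len n. cnorm A (S_word \<mu> \<otimes> (S_adj \<mu> \<otimes> x)))"
    using x by (intro cnorm_finsum_le finite_words_len) auto
  also have "\<dots> \<le> (\<Sum>\<mu>\<in>words_len n. ?c * C)"
  proof (intro sum_mono)
    fix \<mu> assume \<mu>: "\<mu> \<in> words_len n"
    have "cnorm A (S_word \<mu> \<otimes> (S_adj \<mu> \<otimes> x)) \<le> cnorm A (S_word \<mu>) * cnorm A (S_adj \<mu> \<otimes> x)"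
      using x by (intro cnorm_mult) auto
    also have "\<dots> \<le> cnorm A (S_adj \<mu> \<otimes> x)"
      using cnorm_S_word_le[of \<mu>] x by (intro mult_left_le_one_le) (auto simp: cnorm_nonneg)
    finally show "cnorm A (S_word \<mu> \<otimes> (S_adj \<mu> \<otimes> x)) \<le> ?c * C"
      using row[of \<mu>] \<mu> by (simp add: words_len_def)
  qed
  finally show ?thesis by simp
qed

text \<open>
  The entry is a diagonal element multiplied by some \<open>S\<^sub>\<rho>\<close> or its adjoint, with \<open>\<rho>\<close> of length
  \<open>\<bar>i - n\<bar>\<close>.  Diagonal elements commute with the range projection of \<open>\<omega>\<close>, so a factor
  \<open>S\<^sub>\<omega>\<^sup>* S\<^sub>\<rho> S\<^sub>\<omega>\<close> or its adjoint splits off.  It vanishes unless \<open>\<omega>\<close> is a prefix of \<open>\<rho> @ \<omega>\<close>, that is,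
  unless \<open>\<omega>\<close> has the period \<open>length \<rho>\<close>.
\<close>
lemma off_diagonal_vanishes:
  assumes y: "y \<in> block i n l" and len: "length \<mu> = n" "length \<nu> = n"
    and \<omega>: "no_period_upto D \<omega>" and d: "i \<noteq> n" "i \<le> n + D" "n \<le> i + D"
  shows "S_adj \<omega> \<otimes> (S_adj \<mu> \<otimes> y \<otimes> S_word \<nu>) \<otimes> S_word \<omega> = \<zero>"
proof -
  note yc = block_closed[OF y]
  have shift: "S_adj \<omega> \<otimes> (S_word \<rho> \<otimes> S_word \<omega>) = \<zero>" if "0 < length \<rho>" "length \<rho> \<le> D" for \<rho>
    using S_word_incomparable[of \<omega> "\<rho> @ \<omega>"] no_period_upto_shift[OF \<omega> that] by (simp add: S_word_append)
  show ?thesis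
  proof (cases "i < n")
    case True
    define \<mu>1 \<mu>2 where "\<mu>1 = take i \<mu>" "\<mu>2 = drop i \<mu>"
    have \<mu>: "\<mu> = \<mu>1 @ \<mu>2" "length \<mu>1 = i" "0 < length \<mu>2" "length \<mu>2 \<le> D"
      using True len(1) d(3) by (auto simp: \<mu>1_\<mu>2_def)
    define a where "a = S_adj \<mu>1 \<otimes> y \<otimes> S_word \<nu>"
    have a: "a \<in> diag l" unfolding a_def by (rule blockD[OF y \<mu>(2) len(2)])
    note ac = diag_closed[OF a]
    have "cadj A (S_adj \<omega> \<otimes> (S_word \<mu>2 \<otimes> S_word \<omega>)) = cadj A \<zero>" by (simp only: shift[OF \<mu>(3,4)])
    then have 0: "S_adj \<omega> \<otimes> (S_adj \<mu>2 \<otimes> S_word \<omega>) = \<zero>"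
      by (simp add: cadj_mult cadj_cadj cadj_zero m_assoc)
    have "S_adj \<omega> \<otimes> (S_adj \<mu> \<otimes> y \<otimes> S_word \<nu>) \<otimes> S_word \<omega> =
        S_adj \<omega> \<otimes> (S_adj \<mu>2 \<otimes> (a \<otimes> S_word \<omega>))"
      using yc by (simp add: \<mu>(1) a_def S_word_append cadj_mult m_assoc)
    also have "\<dots> = (S_adj \<omega> \<otimes> (S_adj \<mu>2 \<otimes> S_word \<omega>)) \<otimes> (S_adj \<omega> \<otimes> a \<otimes> S_word \<omega>)"
      by (subst diag_S_word[OF a]) (use ac in \<open>simp add: m_assoc\<close>)
    also have "\<dots> = \<zero>" using ac by (simp add: 0)
    finally show ?thesis .
  next
    case False
    define k where "k = i - n"
    have k: "0 < k" "k \<le> D" "i = n + k" using False d by (auto simp: k_def)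
    define x where "x = S_adj \<mu> \<otimes> y \<otimes> S_word \<nu>"
    have xc: "x \<in> carrier A" using yc by (simp add: x_def)
    have "S_adj \<omega> \<otimes> x \<otimes> S_word \<omega> = S_adj \<omega> \<otimes> (x \<otimes> S_word \<omega>)"
      using xc by (simp add: m_assoc)
    also have "\<dots> = (\<Oplus>\<rho>\<in>words_len k. S_adj \<omega> \<otimes> S_word \<rho> \<otimes> (S_adj \<rho> \<otimes> (x \<otimes> S_word \<omega>)))"
      using xc by (intro insert_sum_words) auto
    also have "\<dots> = (\<Oplus>\<rho>\<in>words_len k. \<zero>)"
    proof (intro finsum_cong')
      fix \<rho> assume "\<rho> \<in> words_len k"
      then have \<rho>: "length \<rho> = k" by (simp add: words_len_def)
      define a where "a = S_adj (\<mu> @ \<rho>) \<otimes> y \<otimes> S_word \<nu>"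
      have a: "a \<in> diag l" unfolding a_def using len k(3) \<rho> by (intro blockD[OF y]) auto
      note ac = diag_closed[OF a]
      have "S_adj \<omega> \<otimes> S_word \<rho> \<otimes> (S_adj \<rho> \<otimes> (x \<otimes> S_word \<omega>)) =
          S_adj \<omega> \<otimes> (S_word \<rho> \<otimes> (a \<otimes> S_word \<omega>))"
        using yc by (simp add: a_def x_def S_word_append cadj_mult m_assoc)
      also have "\<dots> = (S_adj \<omega> \<otimes> (S_word \<rho> \<otimes> S_word \<omega>)) \<otimes> (S_adj \<omega> \<otimes> a \<otimes> S_word \<omega>)"
        by (subst diag_S_word[OF a]) (use ac in \<open>simp add: m_assoc\<close>)
      also have "\<dots> = \<zero>" using ac shift[of \<rho>] \<rho> k by simp
      finally show "S_adj \<omega> \<otimes> S_word \<rho> \<otimes> (S_adj \<rho> \<otimes> (x \<otimes> S_word \<omega>)) = \<zero>" .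
    qed auto
    also have "\<dots> = \<zero>" by simp
    finally show ?thesis by (simp only: x_def)
  qed
qed

text \<open>
  The projection onto the sum of the ranges of \<open>S\<^sub>\<kappa> S\<^sub>\<omega>\<close>, where \<open>\<kappa>\<close> runs through the words of length \<open>n\<close>.
\<close>
definition marked :: "nat \<Rightarrow> 'c list \<Rightarrow> 'a" where
  "marked n \<omega> = (\<Oplus>\<kappa>\<in>words_len n. S_word (\<kappa> @ \<omega>) \<otimes> S_adj (\<kappa> @ \<omega>))"

lemma marked_closed [simp]: "marked n \<omega> \<in> carrier A"
  unfolding marked_def by (intro finsum_closed) auto

lemma marked_mult_S_word:
  assumes "length \<kappa> = n"
  shows "marked n \<omega> \<otimes> S_word (\<kappa> @ \<omega>) = S_word (\<kappa> @ \<omega>)"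
proof -
  have "marked n \<omega> \<otimes> S_word (\<kappa> @ \<omega>) =
      (\<Oplus>\<kappa>'\<in>words_len n. S_word (\<kappa>' @ \<omega>) \<otimes> S_adj (\<kappa>' @ \<omega>) \<otimes> S_word (\<kappa> @ \<omega>))"
    unfolding marked_def by (intro finsum_ldistr finite_words_len) auto
  also have "\<dots> = S_word (\<kappa> @ \<omega>) \<otimes> S_adj (\<kappa> @ \<omega>) \<otimes> S_word (\<kappa> @ \<omega>)"
    using assms
    by (intro finsum_delta finite_words_len) (auto simp: words_len_def m_assoc S_word_orthogonal)
  finally show ?thesis by (simp add: m_assoc S_word_partial_isometry)
qed

lemma mult_marked:
  assumes "x \<in> carrier A" "y \<in> carrier A"
    and "\<And>\<kappa>. length \<kappa> = n \<Longrightarrow> x \<otimes> S_word (\<kappa> @ \<omega>) = y \<otimes> S_word (\<kappa> @ \<omega>)"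
  shows "x \<otimes> marked n \<omega> = y \<otimes> marked n \<omega>"
proof -
  have *: "x \<otimes> marked n \<omega> = (\<Oplus>\<kappa>\<in>words_len n. x \<otimes> S_word (\<kappa> @ \<omega>) \<otimes> S_adj (\<kappa> @ \<omega>))"
    if "x \<in> carrier A" for x
  proof -
    have "x \<otimes> marked n \<omega> = (\<Oplus>\<kappa>\<in>words_len n. x \<otimes> (S_word (\<kappa> @ \<omega>) \<otimes> S_adj (\<kappa> @ \<omega>)))"
      unfolding marked_def using that by (intro finsum_rdistr finite_words_len) auto
    also have "\<dots> = (\<Oplus>\<kappa>\<in>words_len n. x \<otimes> S_word (\<kappa> @ \<omega>) \<otimes> S_adj (\<kappa> @ \<omega>))"
      using that by (intro finsum_cong') (auto simp: m_assoc)
    finally show ?thesis .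
  qed
  show ?thesis
    unfolding *[OF assms(1)] *[OF assms(2)] using assms by (intro finsum_cong') (auto simp: words_len_def)
qed

lemma projection_marked: "projection (marked n \<omega>)"
  unfolding projection_def
proof (intro conjI)
  show "cadj A (marked n \<omega>) = marked n \<omega>"
    unfolding marked_def
    by (subst cadj_finsum[OF finite_words_len]) (auto simp: cadj_mult cadj_cadj intro!: finsum_cong')
  show "marked n \<omega> \<otimes> marked n \<omega> = marked n \<omega>"
    using mult_marked[of "marked n \<omega>" \<one> n \<omega>] by (simp add: marked_mult_S_word)
qed simp

text \<open>
  The entries of \<open>f\<close> are diagonal and commute with the range projection of \<open>\<omega>\<close>, so that \<open>f\<close> leaves the
  range of \<open>marked n \<omega>\<close> invariant.
\<close>
lemma marked_compression:
  assumes f: "f \<in> block n n l"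
  shows "f \<otimes> marked n \<omega> = marked n \<omega> \<otimes> f \<otimes> marked n \<omega>"
proof (rule mult_marked)
  note fc = block_closed[OF f]
  fix \<kappa> :: "'c list" assume \<kappa>: "length \<kappa> = n"
  let ?q = "marked n \<omega>"
  define b where "b \<mu> = S_adj \<omega> \<otimes> (S_adj \<mu> \<otimes> f \<otimes> S_word \<kappa>) \<otimes> S_word \<omega>" for \<mu>
  have bc: "b \<mu> \<in> carrier A" for \<mu> using fc by (simp add: b_def)
  have "f \<otimes> S_word (\<kappa> @ \<omega>) = (\<Oplus>\<mu>\<in>words_len n. S_word \<mu> \<otimes> (S_adj \<mu> \<otimes> (f \<otimes> S_word (\<kappa> @ \<omega>))))"
    using insert_sum_words[of \<one> "f \<otimes> S_word (\<kappa> @ \<omega>)" n] fc by simp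
  also have "\<dots> = (\<Oplus>\<mu>\<in>words_len n. S_word (\<mu> @ \<omega>) \<otimes> b \<mu>)"
  proof (intro finsum_cong')
    fix \<mu> assume "\<mu> \<in> words_len n"
    then have a: "S_adj \<mu> \<otimes> f \<otimes> S_word \<kappa> \<in> diag l"
      using \<kappa> by (intro blockD[OF f]) (auto simp: words_len_def)
    have "S_word \<mu> \<otimes> (S_adj \<mu> \<otimes> (f \<otimes> S_word (\<kappa> @ \<omega>))) =
        S_word \<mu> \<otimes> ((S_adj \<mu> \<otimes> f \<otimes> S_word \<kappa>) \<otimes> S_word \<omega>)"
      using fc by (simp add: S_word_append m_assoc)
    also have "\<dots> = S_word \<mu> \<otimes> (S_word \<omega> \<otimes> b \<mu>)"
      unfolding b_def by (subst diag_S_word[OF a]) simp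
    finally show "S_word \<mu> \<otimes> (S_adj \<mu> \<otimes> (f \<otimes> S_word (\<kappa> @ \<omega>))) = S_word (\<mu> @ \<omega>) \<otimes> b \<mu>"
      using bc by (simp add: S_word_append m_assoc)
  qed (auto simp: bc)
  finally have e: "f \<otimes> S_word (\<kappa> @ \<omega>) = (\<Oplus>\<mu>\<in>words_len n. S_word (\<mu> @ \<omega>) \<otimes> b \<mu>)" .
  have "?q \<otimes> (\<Oplus>\<mu>\<in>words_len n. S_word (\<mu> @ \<omega>) \<otimes> b \<mu>) = (\<Oplus>\<mu>\<in>words_len n. ?q \<otimes> (S_word (\<mu> @ \<omega>) \<otimes> b \<mu>))"
    using bc by (intro finsum_rdistr finite_words_len) auto
  also have "\<dots> = (\<Oplus>\<mu>\<in>words_len n. S_word (\<mu> @ \<omega>) \<otimes> b \<mu>)"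
    using bc by (intro finsum_cong') (auto simp: words_len_def marked_mult_S_word m_assoc[symmetric])
  finally show "f \<otimes> S_word (\<kappa> @ \<omega>) = ?q \<otimes> f \<otimes> S_word (\<kappa> @ \<omega>)"
    using fc by (simp add: m_assoc flip: e)
qed (use block_closed[OF f] in auto)

lemma marked_off_diagonal:
  assumes y: "y \<in> block i n l"
    and \<omega>: "no_period_upto D \<omega>" and d: "i \<noteq> n" "i \<le> n + D" "n \<le> i + D"
  shows "marked n \<omega> \<otimes> y \<otimes> marked n \<omega> = \<zero>"
proof -
  note yc = block_closed[OF y]
  have 0: "S_adj (\<mu> @ \<omega>) \<otimes> (y \<otimes> S_word (\<kappa> @ \<omega>)) = \<zero>" if "length \<mu> = n" "length \<kappa> = n" for \<mu> \<kappa>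
    using off_diagonal_vanishes[OF y that \<omega> d] yc by (simp add: S_word_append cadj_mult m_assoc)
  have "(marked n \<omega> \<otimes> y) \<otimes> marked n \<omega> = \<zero> \<otimes> marked n \<omega>"
  proof (rule mult_marked)
    fix \<kappa> :: "'c list" assume \<kappa>: "length \<kappa> = n"
    have "marked n \<omega> \<otimes> (y \<otimes> S_word (\<kappa> @ \<omega>)) =
        (\<Oplus>\<mu>\<in>words_len n. S_word (\<mu> @ \<omega>) \<otimes> S_adj (\<mu> @ \<omega>) \<otimes> (y \<otimes> S_word (\<kappa> @ \<omega>)))"
      unfolding marked_def using yc by (intro finsum_ldistr finite_words_len) auto
    also have "\<dots> = (\<Oplus>\<mu>\<in>words_len n. \<zero>)"
      using yc by (intro finsum_cong') (auto simp: words_len_def m_assoc 0[OF _ \<kappa>])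
    finally show "marked n \<omega> \<otimes> y \<otimes> S_word (\<kappa> @ \<omega>) = \<zero> \<otimes> S_word (\<kappa> @ \<omega>)" using yc by (simp add: m_assoc)
  qed (use yc in auto)
  then show ?thesis by simp
qed

end

section \<open>The grading and the quotient norm\<close>

context lambda_family_algebra
begin

definition graded :: "int \<Rightarrow> 'a set" where
  "graded k = {y. \<exists>i j l. y \<in> block i j l \<and> int i - int j = k}"

lemma graded_closed: "y \<in> graded k \<Longrightarrow> y \<in> carrier A"
  by (auto simp: graded_def block_closed)

lemma block_graded: "y \<in> block i j l \<Longrightarrow> y \<in> graded (int i - int j)"
  by (auto simp: graded_def)

text \<open>
  An element of a block belongs to all blocks that are sufficiently far out in the same degree, because
  words on both sides can be prolonged together.  Finitely many elements can therefore
  be treated in blocks with a common \<open>n\<close> and \<open>l\<close>.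
\<close>
lemma graded_block:
  assumes "y \<in> graded k"
  obtains N where "\<And>n l. N \<le> n \<Longrightarrow> n + N \<le> l \<Longrightarrow> y \<in> block (nat (int n + k)) n l"
    "\<And>n. N \<le> n \<Longrightarrow> 0 \<le> int n + k"
proof -
  obtain i j l where y: "y \<in> block i j l" and k: "int i - int j = k"
    using assms by (auto simp: graded_def)
  have "y \<in> block (nat (int n + k)) n l'" if "max j l \<le> n" "n + max j l \<le> l'" for n l'
  proof -
    have "y \<in> block (i + (n - j)) (j + (n - j)) (l + (n - j))" using y block_shift by blast
    moreover have "i + (n - j) = nat (int n + k)" "j + (n - j) = n" "l + (n - j) \<le> l'"
      using that k by auto
    ultimately show ?thesis using block_mono by (metis subsetD)
  qed
  then show ?thesis using that[of "max j l"] k by auto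
qed

lemma graded_zero: "\<zero> \<in> graded k"
proof -
  have "int (nat k) - int (nat (- k)) = k" by simp
  then show ?thesis using block_graded[OF block_zero, of "nat k" "nat (- k)"] by metis
qed

lemma graded_add:
  assumes "x \<in> graded k" "y \<in> graded k" shows "x \<oplus> y \<in> graded k"
proof -
  obtain M where M: "\<And>n l. M \<le> n \<Longrightarrow> n + M \<le> l \<Longrightarrow> x \<in> block (nat (int n + k)) n l"
    "\<And>n. M \<le> n \<Longrightarrow> 0 \<le> int n + k" using assms(1) by (rule graded_block) blast
  obtain N where N: "\<And>n l. N \<le> n \<Longrightarrow> n + N \<le> l \<Longrightarrow> y \<in> block (nat (int n + k)) n l"
    using assms(2) by (rule graded_block) blast
  define n where "n = M + N"
  have "x \<oplus> y \<in> block (nat (int n + k)) n (n + n)"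
    by (intro block_add M(1) N) (auto simp: n_def)
  then have "x \<oplus> y \<in> graded (int (nat (int n + k)) - int n)" by (rule block_graded)
  then show ?thesis using M(2)[of n] by (simp add: n_def)
qed

lemma graded_mult:
  assumes "x \<in> graded k" "y \<in> graded m" shows "x \<otimes> y \<in> graded (k + m)"
proof -
  obtain M where M: "\<And>n l. M \<le> n \<Longrightarrow> n + M \<le> l \<Longrightarrow> x \<in> block (nat (int n + k)) n l"
    "\<And>n. M \<le> n \<Longrightarrow> 0 \<le> int n + k" using assms(1) by (rule graded_block) blast
  obtain N where N: "\<And>n l. N \<le> n \<Longrightarrow> n + N \<le> l \<Longrightarrow> y \<in> block (nat (int n + m)) n l"
    "\<And>n. N \<le> n \<Longrightarrow> 0 \<le> int n + m" using assms(2) by (rule graded_block) blast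
  \<comment> \<open>The left factor needs columns of length \<open>n'\<close>, the number of rows of the right one, and \<open>\<bar>m\<bar>\<close> keeps \<open>n'\<close> large enough for it.\<close>
  define n where "n = M + N + nat \<bar>m\<bar>"
  define n' where "n' = nat (int n + m)"
  have n': "M \<le> n'" "int n' = int n + m" by (auto simp: n'_def n_def)
  define l where "l = n + n' + M + N"
  have "x \<in> block (nat (int n' + k)) n' l" by (rule M(1)[OF n'(1)]) (simp add: l_def)
  moreover have "y \<in> block n' n l" unfolding n'_def by (rule N(1)) (auto simp: n_def l_def)
  ultimately have "x \<otimes> y \<in> graded (int (nat (int n' + k)) - int n)"
    by (intro block_graded[OF block_mult])
  then show ?thesis using M(2)[OF n'(1)] n'(2) by (simp add: algebra_simps)
qed

lemma graded_cadj: "x \<in> graded k \<Longrightarrow> cadj A x \<in> graded (- k)"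
  unfolding graded_def using block_cadj by fastforce

lemma diag_graded: "a \<in> diag l \<Longrightarrow> a \<in> graded 0"
  using block_graded[of a 0 0 l] by (simp add: block_def words_len_def cadj_one diag_closed)

lemma S_graded: "S \<alpha> \<in> graded 1"
proof -
  have "S_adj \<mu> \<otimes> S \<alpha> \<in> diag 1" if len: "length \<mu> = Suc 0" for \<mu>
  proof -
    obtain \<beta> where "\<mu> = [\<beta>]" using len by (cases \<mu>) auto
    then show ?thesis
      using diag_S(2)[OF diag_one[of 0], of \<alpha>] diag_zero S_orthogonal[of \<beta> \<alpha>] by (cases "\<beta> = \<alpha>") auto
  qed
  then have "S \<alpha> \<in> block 1 0 1" by (simp add: block_def words_len_def)
  then show ?thesis using block_graded by fastforce
qed

text \<open>
  For \<open>h = f\<^sup>* f\<close> and \<open>q = marked n \<omega>\<close>, invariance of the range of \<open>q\<close> gives \<open>h\<^sup>m q = (h q)\<^sup>m\<close>, while \<open>q f q = q y q\<close> gives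
  \<open>\<parallel>h q\<parallel>\<^sub>J \<le> \<parallel>f\<parallel> \<parallel>q f q\<parallel>\<^sub>J \<le> \<parallel>f\<parallel> \<parallel>y\<parallel>\<^sub>J\<close>.  So the coefficients of \<open>h\<^sup>m\<close>, which appear as scalars under
  compression by \<open>S\<^sub>\<omega>\<close>, are at most \<open>(\<parallel>f\<parallel> \<parallel>y\<parallel>\<^sub>J)\<^sup>m\<close>.  All \<open>h\<^sup>m\<close> lie in one block, where the norm is
  bounded by a fixed multiple of the largest coefficient.  Comparing with \<open>\<parallel>h\<^sup>m\<parallel> = \<parallel>f\<parallel>\<^bsup>2m\<^esup>\<close> for
  \<open>m = 2\<^sup>j\<close> gives \<open>\<parallel>f\<parallel>\<^sup>2 \<le> \<parallel>f\<parallel> \<parallel>y\<parallel>\<^sub>J\<close>.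
\<close>
lemma norm_le_of_compressions:
  assumes J: "ideal J A" and closed: "closed_in_norm A J" and one: "\<one> \<notin> J"
    and f: "f \<in> block n n l" and y: "y \<in> carrier A"
    and \<omega>: "\<And>v. v \<in> vertices \<Lambda> l \<Longrightarrow> \<exists>\<eta> w. w = vertex_word v @ \<eta> \<and>
      w \<in> universal_words \<Lambda> \<and> marked n w \<otimes> y \<otimes> marked n w = marked n w \<otimes> f \<otimes> marked n w"
  shows "cnorm A f \<le> quotient_norm J y"
proof -
  let ?N = "quotient_norm J"
  note fc = block_closed[OF f]
  define h where "h = cadj A f \<otimes> f"
  have hb: "h \<in> block n n l" unfolding h_def by (rule block_mult[OF block_cadj[OF f] f])
  note hc = block_closed[OF hb]
  have hadj: "cadj A h = h" using fc by (simp add: h_def cadj_mult cadj_cadj)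
  have hn: "cnorm A h = (cnorm A f)\<^sup>2" unfolding h_def by (rule cstar_identity[OF fc])
  define B where "B = cnorm A f * ?N y"
  have B0: "0 \<le> B" using fc y by (simp add: B_def cnorm_nonneg quotient_norm_nonneg[OF J])
  have hj: "iter_square j h \<in> block n n l" for j
    by (induction j) (auto intro: hb block_mult)
  have coeff: "cmod (g (vertex_word v)) \<le> B ^ 2 ^ j"
    if v: "v \<in> vertices \<Lambda> l" and g: "past_invariant \<Lambda> l g" and len: "length \<mu> = n" "length \<nu> = n"
      and e: "S_adj \<mu> \<otimes> iter_square j h \<otimes> S_word \<nu> = diag_elt l g" for v g \<mu> \<nu> j
  proof -
    obtain \<eta> w where w: "w = vertex_word v @ \<eta>" "w \<in> universal_words \<Lambda>"
      and y_f: "marked n w \<otimes> y \<otimes> marked n w = marked n w \<otimes> f \<otimes> marked n w" using \<omega>[OF v] by blast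
    define q where "q = marked n w"
    have qy: "q \<otimes> y \<otimes> q = q \<otimes> f \<otimes> q" using y_f by (simp add: q_def)
    have q: "projection q" unfolding q_def by (rule projection_marked)
    have qc: "q \<in> carrier A" by (rule projectionD(1)[OF q])
    note q1 = cnorm_projection_le[OF q]
    have "h \<otimes> q = q \<otimes> cadj A f \<otimes> (q \<otimes> f \<otimes> q)"
    proof -
      have "h \<otimes> q = q \<otimes> (cadj A f \<otimes> (f \<otimes> q))"
        using marked_compression[OF hb, where \<omega> = w] fc qc by (simp add: q_def h_def m_assoc)
      also have "f \<otimes> q = q \<otimes> f \<otimes> q" unfolding q_def by (rule marked_compression[OF f])
      finally show ?thesis using fc qc by (simp add: m_assoc)
    qed
    then have "?N (h \<otimes> q) \<le> ?N (q \<otimes> cadj A f) * ?N (q \<otimes> y \<otimes> q)"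
      using quotient_norm_mult[OF J, of "q \<otimes> cadj A f" "q \<otimes> f \<otimes> q"] fc qc by (simp add: qy)
    also have "\<dots> \<le> cnorm A f * ?N y"
    proof (intro mult_mono)
      have "?N (q \<otimes> cadj A f) \<le> cnorm A (q \<otimes> cadj A f)" using fc qc by (intro quotient_norm_le[OF J]) auto
      also have "\<dots> \<le> cnorm A q * cnorm A (cadj A f)" using fc qc by (intro cnorm_mult) auto
      also have "\<dots> \<le> cnorm A f" using q1 fc qc by (simp add: cnorm_cadj cnorm_nonneg mult_left_le_one_le)
      finally show "?N (q \<otimes> cadj A f) \<le> cnorm A f" .
      show "?N (q \<otimes> y \<otimes> q) \<le> ?N y" by (rule quotient_norm_sandwich[OF J qc y qc q1 q1])
    qed (use fc qc y in \<open>auto simp: cnorm_nonneg quotient_norm_nonneg[OF J]\<close>)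
    finally have hq: "?N (h \<otimes> q) \<le> B" by (simp add: B_def)
    have sq: "iter_square j (h \<otimes> q) = iter_square j h \<otimes> q"
    proof (induction j)
      case (Suc j)
      have c: "iter_square j h \<in> carrier A" using hc by simp
      have "iter_square (Suc j) (h \<otimes> q) = iter_square j h \<otimes> (q \<otimes> iter_square j h \<otimes> q)"
        using Suc c qc by (simp add: m_assoc)
      also have "\<dots> = iter_square j h \<otimes> (iter_square j h \<otimes> q)"
        using marked_compression[OF hj, where \<omega> = w] by (simp add: q_def)
      finally show ?case using c qc by (simp add: m_assoc)
    qed simp
    define s where "s \<kappa> = S_word (\<kappa> @ w)" for \<kappa>
    have sc: "s \<kappa> \<in> carrier A" "cnorm A (s \<kappa>) \<le> 1" "cnorm A (cadj A (s \<kappa>)) \<le> 1" for \<kappa>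
      by (simp_all add: s_def cnorm_S_word_le cnorm_cadj)
    have qs: "q \<otimes> s \<nu> = s \<nu>" unfolding q_def s_def by (rule marked_mult_S_word[OF len(2)])
    have "g (vertex_word v) \<odot> \<one> = cadj A (S_word w) \<otimes> diag_elt l g \<otimes> S_word w"
      unfolding w(1) by (rule universal_compression[OF g vertex_word(1)[OF v] w(2)[unfolded w(1)], symmetric])
    also have "\<dots> = cadj A (s \<mu>) \<otimes> iter_square j h \<otimes> (q \<otimes> s \<nu>)"
      unfolding e[symmetric] qs using hc by (simp add: s_def S_word_append cadj_mult m_assoc)
    also have "\<dots> = cadj A (s \<mu>) \<otimes> iter_square j (h \<otimes> q) \<otimes> s \<nu>"
      using hc qc sc by (simp add: sq m_assoc)
    finally have "?N (g (vertex_word v) \<odot> \<one>) \<le> ?N (iter_square j (h \<otimes> q))"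
      using quotient_norm_sandwich[OF J _ _ sc(1) sc(3)[of \<mu>] sc(2)[of \<nu>], of "iter_square j (h \<otimes> q)"] hc qc sc
      by simp
    also have "\<dots> \<le> ?N (h \<otimes> q) ^ 2 ^ j" using hc qc by (intro quotient_norm_iter_square[OF J]) simp
    also have "\<dots> \<le> B ^ 2 ^ j" using hq hc qc by (intro power_mono quotient_norm_nonneg[OF J]) auto
    finally show ?thesis using quotient_norm_scalar[OF J closed one, of "g (vertex_word v)"] by simp
  qed
  define C where "C = real (card (words_len n)) * (real (card (words_len n)) * real (card (vertices \<Lambda> l)))"
  have C0: "0 \<le> C" by (simp add: C_def)
  have "(cnorm A f)\<^sup>2 \<le> B"
  proof (rule power_growth_le[OF B0])
    fix j
    have entry: "cnorm A (S_adj \<mu> \<otimes> iter_square j h \<otimes> S_word \<nu>) \<le> real (card (vertices \<Lambda> l)) * B ^ 2 ^ j"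
      if len: "length \<mu> = n" "length \<nu> = n" for \<mu> \<nu>
    proof -
      obtain g where g: "past_invariant \<Lambda> l g" "S_adj \<mu> \<otimes> iter_square j h \<otimes> S_word \<nu> = diag_elt l g"
        using blockD[OF hj len] by (rule diagE)
      have "cnorm A (diag_elt l g) \<le> (\<Sum>v\<in>vertices \<Lambda> l. cnorm A (g (vertex_word v) \<odot> E l v))"
        unfolding diag_elt_def by (intro cnorm_finsum_le finite_vertices) auto
      also have "\<dots> \<le> (\<Sum>v\<in>vertices \<Lambda> l. B ^ 2 ^ j)"
      proof (rule sum_mono)
        fix v assume v: "v \<in> vertices \<Lambda> l"
        have "cnorm A (g (vertex_word v) \<odot> E l v) \<le> cmod (g (vertex_word v))"
          using v cnorm_projection_le[OF projection_E[OF v]] by (simp add: cnorm_smult mult_left_le)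
        then show "cnorm A (g (vertex_word v) \<odot> E l v) \<le> B ^ 2 ^ j"
          using coeff[OF v g(1) len g(2)] by simp
      qed
      finally show ?thesis by (simp add: g(2))
    qed
    have "(cnorm A f)\<^sup>2 ^ 2 ^ j = cnorm A (iter_square j h)"
      using cnorm_iter_square[OF hc hadj] hn by simp
    also have "\<dots> \<le> C * B ^ 2 ^ j"
      using cnorm_le_entries[OF block_closed[OF hj] entry] by (simp add: C_def mult.assoc)
    also have "\<dots> \<le> C * 2 ^ j * B ^ 2 ^ j"
      using C0 B0 by (intro mult_right_mono) (auto simp: mult_le_cancel_left1)
    finally show "(cnorm A f)\<^sup>2 ^ 2 ^ j \<le> C * 2 ^ j * B ^ 2 ^ j" .
  qed
  then show ?thesis
    using cnorm_nonneg[OF fc] quotient_norm_nonneg[OF J y]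
    by (cases "cnorm A f = 0") (auto simp: B_def power2_eq_square)
qed

end

context lambda_family_algebra
begin

lemma graded_smult: "x \<in> graded k \<Longrightarrow> c \<odot> x \<in> graded k"
  using graded_mult[OF diag_graded[OF diag_smult[OF diag_one[of 0]]], of x k c]
  by (simp add: smult_mult_left graded_closed)

text \<open>
  A universal word without periods up to all occurring degrees separates the summand of degree zero from
  the other ones.
\<close>
lemma norm_le_graded_sum:
  assumes J: "ideal J A" and closed: "closed_in_norm A J" and one: "\<one> \<notin> J"
    and st: "synchronizingly_transitive \<Lambda>" and ab: "a \<noteq> b" "[a] \<in> words \<Lambda>" "[b] \<in> words \<Lambda>"
    and I: "finite I" and z: "\<And>i. i \<in> I \<Longrightarrow> z i \<in> graded (d i)"
    and i0: "i0 \<in> I" "d i0 = 0" and d: "\<And>i. i \<in> I \<Longrightarrow> i \<noteq> i0 \<Longrightarrow> d i \<noteq> 0"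
  shows "cnorm A (z i0) \<le> quotient_norm J (\<Oplus>i\<in>I. z i)"
proof -
  have zc: "z i \<in> carrier A" if "i \<in> I" for i using z[OF that] by (rule graded_closed)
  have "\<forall>i\<in>I. \<exists>N. (\<forall>n l. N \<le> n \<longrightarrow> n + N \<le> l \<longrightarrow> z i \<in> block (nat (int n + d i)) n l) \<and>
      (\<forall>n. N \<le> n \<longrightarrow> 0 \<le> int n + d i)"
    using z by (meson graded_block)
  then obtain N where N: "\<And>i n l. i \<in> I \<Longrightarrow> N i \<le> n \<Longrightarrow> n + N i \<le> l \<Longrightarrow> z i \<in> block (nat (int n + d i)) n l"
    "\<And>i n. i \<in> I \<Longrightarrow> N i \<le> n \<Longrightarrow> 0 \<le> int n + d i" by metis
  define n where "n = (\<Sum>i\<in>I. N i)"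
  define D where "D = (\<Sum>i\<in>I. nat \<bar>d i\<bar>)"
  have Nn: "N i \<le> n" if "i \<in> I" for i unfolding n_def by (rule member_le_sum[OF that _ I]) simp
  have dD: "nat \<bar>d i\<bar> \<le> D" if "i \<in> I" for i unfolding D_def by (rule member_le_sum[OF that _ I]) simp
  have zb: "z i \<in> block (nat (int n + d i)) n (n + n)" "0 \<le> int n + d i" if "i \<in> I" for i
    using N[OF that] Nn[OF that] by auto
  show ?thesis
  proof (rule norm_le_of_compressions[OF J closed one])
    show "z i0 \<in> block n n (n + n)" using zb(1)[OF i0(1)] i0(2) by simp
    show "(\<Oplus>i\<in>I. z i) \<in> carrier A" using zc by (intro finsum_closed) auto
    fix v assume "v \<in> vertices \<Lambda> (n + n)"
    then have "vertex_word v \<in> words \<Lambda>"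
      using vertex_word(1) by (auto simp: synchronizing_words_def)
    then obtain \<eta> where \<eta>: "vertex_word v @ \<eta> \<in> universal_words \<Lambda>" "no_period_upto D (vertex_word v @ \<eta>)"
      using universal_word_without_period[OF st ab] by blast
    define w where "w = vertex_word v @ \<eta>"
    let ?q = "marked n w"
    have "?q \<otimes> (\<Oplus>i\<in>I. z i) \<otimes> ?q = (\<Oplus>i\<in>I. ?q \<otimes> z i \<otimes> ?q)"
      using I zc by (intro finsum_sandwich) auto
    also have "\<dots> = ?q \<otimes> z i0 \<otimes> ?q"
    proof (rule finsum_delta[OF I i0(1)])
      fix i assume i: "i \<in> I" "i \<noteq> i0"
      show "?q \<otimes> z i \<otimes> ?q = \<zero>"
        using d[OF i] dD[OF i(1)] zb(2)[OF i(1)] by (intro marked_off_diagonal[OF zb(1)[OF i(1)] \<eta>(2)[folded w_def]]) auto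
    qed (use zc i0 in simp)
    finally show "\<exists>\<eta> w. w = vertex_word v @ \<eta> \<and> w \<in> universal_words \<Lambda> \<and>
        marked n w \<otimes> (\<Oplus>i\<in>I. z i) \<otimes> marked n w = marked n w \<otimes> z i0 \<otimes> marked n w"
      using \<eta>(1) w_def by blast
  qed
qed

inductive_set graded_span :: "nat \<Rightarrow> 'a set" for N :: nat where
  homogeneous: "x \<in> graded k \<Longrightarrow> \<bar>k\<bar> \<le> int N \<Longrightarrow> x \<in> graded_span N"
| add: "x \<in> graded_span N \<Longrightarrow> y \<in> graded_span N \<Longrightarrow> x \<oplus> y \<in> graded_span N"

lemma graded_span_closed: "x \<in> graded_span N \<Longrightarrow> x \<in> carrier A"
  by (induction rule: graded_span.induct) (auto simp: graded_closed)

lemma graded_span_mono: "x \<in> graded_span M \<Longrightarrow> M \<le> N \<Longrightarrow> x \<in> graded_span N"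
  by (induction rule: graded_span.induct) (auto intro: graded_span.intros)

lemma graded_span_cadj: "x \<in> graded_span N \<Longrightarrow> cadj A x \<in> graded_span N"
proof (induction rule: graded_span.induct)
  case (homogeneous x k)
  then show ?case using graded_span.homogeneous[OF graded_cadj, of x k N] by simp
qed (auto simp: cadj_add graded_span_closed intro: graded_span.intros)

lemma graded_span_smult: "x \<in> graded_span N \<Longrightarrow> c \<odot> x \<in> graded_span N"
  by (induction rule: graded_span.induct)
     (auto simp: smult_add graded_span_closed intro: graded_span.intros graded_smult)

lemma graded_span_mult:
  assumes "x \<in> graded_span M" "y \<in> graded_span N" shows "x \<otimes> y \<in> graded_span (M + N)"
  using assms
proof (induction rule: graded_span.induct)
  case (homogeneous x k)
  from homogeneous(3) show ?case
  proof (induction rule: graded_span.induct)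
    case hom: (homogeneous y m)
    show ?case
      using homogeneous(2) hom(2) by (intro graded_span.homogeneous[OF graded_mult[OF homogeneous(1) hom(1)]]) auto
  next
    case (add y z)
    then show ?case
      using graded_span_closed graded_closed[OF homogeneous(1)] by (auto simp: r_distr intro: graded_span.add)
  qed
next
  case (add x z)
  then show ?case using graded_span_closed by (auto simp: l_distr intro: graded_span.add)
qed

lemma graded_span_decompose:
  assumes "x \<in> graded_span N"
  shows "\<exists>y. (\<forall>k. y k \<in> graded k) \<and> x = (\<Oplus>k\<in>{- int N..int N}. y k)"
  using assms
proof (induction rule: graded_span.induct)
  case (homogeneous x k)
  define y where "y m = (if m = k then x else \<zero>)" for m
  have y: "y m \<in> graded m" for m using homogeneous(1) graded_zero by (simp add: y_def)
  have "(\<Oplus>m\<in>{- int N..int N}. y m) = y k"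
    using homogeneous(2) graded_closed[OF homogeneous(1)] by (intro finsum_delta) (auto simp: y_def)
  then show ?case using y by (intro exI[of _ y]) (simp add: y_def)
next
  case (add x x')
  then obtain y y' where y: "\<And>k. y k \<in> graded k" "x = (\<Oplus>k\<in>{- int N..int N}. y k)"
    and y': "\<And>k. y' k \<in> graded k" "x' = (\<Oplus>k\<in>{- int N..int N}. y' k)" by blast
  have "x \<oplus> x' = (\<Oplus>k\<in>{- int N..int N}. y k \<oplus> y' k)"
    unfolding y(2) y'(2) using graded_closed y(1) y'(1) by (intro finsum_addf[symmetric]) auto
  then show ?case using graded_add[OF y(1) y'(1)] by (intro exI[of _ "\<lambda>k. y k \<oplus> y' k"]) simp
qed

lemma iter_square_graded_span: "x \<in> graded_span N \<Longrightarrow> iter_square j x \<in> graded_span (N * 2 ^ j)"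
proof (induction j)
  case (Suc j)
  have "N * 2 ^ j + N * 2 ^ j = N * 2 ^ Suc j" by simp
  then show ?case
    using graded_span_mult[OF Suc.IH[OF Suc.prems] Suc.IH[OF Suc.prems]] by (simp only: iter_square_Suc)
qed simp

text \<open>
  The summand \<open>y\<^sub>m\<close> of degree \<open>m\<close> satisfies \<open>\<parallel>y\<^sub>m\<parallel>\<^sup>2 \<le> \<parallel>y\<^sub>m\<^sup>* x\<parallel>\<^sub>J \<le> \<parallel>y\<^sub>m\<parallel> \<parallel>x\<parallel>\<^sub>J\<close>, because
  \<open>y\<^sub>m\<^sup>* y\<^sub>m\<close> is the degree zero summand of \<open>y\<^sub>m\<^sup>* x\<close>.
\<close>
lemma norm_le_graded_span:
  assumes J: "ideal J A" and closed: "closed_in_norm A J" and one: "\<one> \<notin> J"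
    and st: "synchronizingly_transitive \<Lambda>" and ab: "a \<noteq> b" "[a] \<in> words \<Lambda>" "[b] \<in> words \<Lambda>"
    and x: "x \<in> graded_span N"
  shows "cnorm A x \<le> real (2 * N + 1) * quotient_norm J x"
proof -
  let ?n = "quotient_norm J x" and ?I = "{- int N..int N}"
  obtain y where y: "\<And>k. y k \<in> graded k" "x = (\<Oplus>k\<in>?I. y k)"
    using graded_span_decompose[OF x] by blast
  note yc = graded_closed[OF y(1)]
  have xc: "x \<in> carrier A" using x by (rule graded_span_closed)
  have part: "cnorm A (y m) \<le> ?n" if m: "m \<in> ?I" for m
  proof -
    have "cnorm A (cadj A (y m) \<otimes> y m) \<le> quotient_norm J (\<Oplus>k\<in>?I. cadj A (y m) \<otimes> y k)"
    proof (rule norm_le_graded_sum[OF J closed one st ab, where d = "\<lambda>k. k - m"])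
      show "cadj A (y m) \<otimes> y k \<in> graded (k - m)" for k
        using graded_mult[OF graded_cadj[OF y(1)[of m]] y(1)[of k]] by simp
    qed (use m in auto)
    also have "(\<Oplus>k\<in>?I. cadj A (y m) \<otimes> y k) = cadj A (y m) \<otimes> x"
      unfolding y(2) using yc by (intro finsum_rdistr[symmetric]) auto
    also have "quotient_norm J (cadj A (y m) \<otimes> x) \<le> quotient_norm J (cadj A (y m)) * ?n"
      using yc xc by (intro quotient_norm_mult[OF J]) auto
    also have "\<dots> \<le> cnorm A (y m) * ?n"
      using quotient_norm_le[OF J, of "cadj A (y m)"] yc xc
      by (intro mult_right_mono quotient_norm_nonneg[OF J]) (auto simp: cnorm_cadj)
    finally have "cnorm A (y m) * cnorm A (y m) \<le> cnorm A (y m) * ?n"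
      using cstar_identity[OF yc[of m]] by (simp add: power2_eq_square)
    then show ?thesis
      using cnorm_nonneg[OF yc[of m]] quotient_norm_nonneg[OF J xc] by (cases "cnorm A (y m) = 0") auto
  qed
  have "cnorm A x \<le> (\<Sum>k\<in>?I. cnorm A (y k))"
    unfolding y(2) using yc by (intro cnorm_finsum_le) auto
  also have "\<dots> \<le> (\<Sum>k\<in>?I. ?n)" by (rule sum_mono) (rule part)
  finally show ?thesis by (simp add: nat_add_distrib nat_mult_distrib algebra_simps)
qed

text \<open>
  The factor in \<open>norm_le_graded_span\<close> is linear in the degree, and the degree of \<open>(x\<^sup>* x)\<^sup>m\<close> is linear in
  \<open>m\<close>, so the factor disappears on comparing high powers.
\<close>
theorem norm_le_quotient_norm:
  assumes J: "ideal J A" and closed: "closed_in_norm A J" and one: "\<one> \<notin> J"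
    and st: "synchronizingly_transitive \<Lambda>" and ab: "a \<noteq> b" "[a] \<in> words \<Lambda>" "[b] \<in> words \<Lambda>"
    and x: "x \<in> graded_span N"
  shows "cnorm A x \<le> quotient_norm J x"
proof -
  let ?N = "quotient_norm J"
  have xc: "x \<in> carrier A" using x by (rule graded_span_closed)
  define h where "h = cadj A x \<otimes> x"
  have hs: "h \<in> graded_span (N + N)" unfolding h_def by (rule graded_span_mult[OF graded_span_cadj[OF x] x])
  have hc: "h \<in> carrier A" and hadj: "cadj A h = h" using xc by (simp_all add: h_def cadj_mult cadj_cadj)
  have n0: "0 \<le> cnorm A x" "0 \<le> ?N x" using xc by (simp_all add: cnorm_nonneg quotient_norm_nonneg[OF J])
  have qh: "?N h \<le> cnorm A x * ?N x"
  proof -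
    have "?N h \<le> ?N (cadj A x) * ?N x" unfolding h_def using xc by (intro quotient_norm_mult[OF J]) auto
    also have "\<dots> \<le> cnorm A x * ?N x"
      using quotient_norm_le[OF J, of "cadj A x"] n0 xc by (intro mult_right_mono) (auto simp: cnorm_cadj)
    finally show ?thesis .
  qed
  have "(cnorm A x)\<^sup>2 \<le> cnorm A x * ?N x"
  proof (rule power_growth_le)
    fix j
    have "(cnorm A x)\<^sup>2 ^ 2 ^ j = cnorm A (iter_square j h)"
      using cnorm_iter_square[OF hc hadj] cstar_identity[OF xc] by (simp add: h_def)
    also have "\<dots> \<le> real (2 * ((N + N) * 2 ^ j) + 1) * ?N (iter_square j h)"
      by (rule norm_le_graded_span[OF J closed one st ab iter_square_graded_span[OF hs]])
    also have "\<dots> \<le> real (4 * N + 1) * 2 ^ j * ?N h ^ 2 ^ j"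
    proof (intro mult_mono)
      show "real (2 * ((N + N) * 2 ^ j) + 1) \<le> real (4 * N + 1) * 2 ^ j" by (simp add: algebra_simps)
      show "?N (iter_square j h) \<le> ?N h ^ 2 ^ j" by (rule quotient_norm_iter_square[OF J hc])
    qed (use hc in \<open>auto intro: quotient_norm_nonneg[OF J]\<close>)
    also have "\<dots> \<le> real (4 * N + 1) * 2 ^ j * (cnorm A x * ?N x) ^ 2 ^ j"
      using qh hc by (intro mult_left_mono power_mono quotient_norm_nonneg[OF J]) auto
    finally show "(cnorm A x)\<^sup>2 ^ 2 ^ j \<le> real (4 * N + 1) * 2 ^ j * (cnorm A x * ?N x) ^ 2 ^ j" .
  qed (use n0 in simp)
  then show ?thesis using n0 by (cases "cnorm A x = 0") (auto simp: power2_eq_square)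
qed

theorem closed_ideal_trivial:
  assumes J: "ideal J A" and closed: "closed_in_norm A J"
    and st: "synchronizingly_transitive \<Lambda>" and ab: "a \<noteq> b" "[a] \<in> words \<Lambda>" "[b] \<in> words \<Lambda>"
    and dense: "\<And>x e. x \<in> carrier A \<Longrightarrow> 0 < e \<Longrightarrow> \<exists>N. \<exists>y\<in>graded_span N. cnorm A (x \<ominus> y) < e"
  shows "J = {\<zero>} \<or> J = carrier A"
proof (cases "\<one> \<in> J")
  case True
  then show ?thesis using ideal.one_imp_carrier[OF J] by blast
next
  case one: False
  interpret J: ideal J A by (rule J)
  have "x = \<zero>" if x: "x \<in> J" for x
  proof -
    have xc: "x \<in> carrier A" using x by (rule J.Icarr)
    have "cnorm A x \<le> 0 + e" if pos: "0 < e" for e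
    proof -
      obtain N y where y: "y \<in> graded_span N" "cnorm A (x \<ominus> y) < e / 2"
        using dense[OF xc, of "e / 2"] pos by auto
      have yc: "y \<in> carrier A" using y(1) by (rule graded_span_closed)
      have "cnorm A y \<le> quotient_norm J y" by (rule norm_le_quotient_norm[OF J closed one st ab y(1)])
      also have "\<dots> \<le> cnorm A (y \<ominus> x)" by (rule quotient_norm_le_diff[OF J yc x])
      finally have "cnorm A y < e / 2" using y(2) minus_commute_norm[OF xc yc] by simp
      then show ?thesis
        using minus_triangle[OF xc yc zero_closed] y(2) xc yc by (simp add: minus_zero)
    qed
    then have "cnorm A x \<le> 0" by (rule field_le_epsilon)
    then show ?thesis using cnorm_nonneg[OF xc] cnorm_eq_zero[OF xc] by simp
  qed
  then show ?thesis using J.zero_closed by blast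
qed

end

section \<open>Representations by partial bijections\<close>

definition l2_norm :: "('x \<Rightarrow> complex) \<Rightarrow> real" where
  "l2_norm v = L2_set (\<lambda>a. cmod (v a)) {a. v a \<noteq> 0}"

definition l2_inner :: "('x \<Rightarrow> complex) \<Rightarrow> ('x \<Rightarrow> complex) \<Rightarrow> complex" where
  "l2_inner u v = (\<Sum>a\<in>{a. u a \<noteq> 0}. cnj (u a) * v a)"

lemma l2_norm_superset:
  "finite F \<Longrightarrow> {a. v a \<noteq> 0} \<subseteq> F \<Longrightarrow> l2_norm v = L2_set (\<lambda>a. cmod (v a)) F"
  unfolding l2_norm_def L2_set_def by (intro arg_cong[where f = sqrt] sum.mono_neutral_left) auto

lemma l2_inner_superset:
  "finite F \<Longrightarrow> {a. u a \<noteq> 0} \<subseteq> F \<Longrightarrow> l2_inner u v = (\<Sum>a\<in>F. cnj (u a) * v a)"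
  unfolding l2_inner_def by (intro sum.mono_neutral_left) auto

lemma l2_norm_nonneg: "0 \<le> l2_norm v"
  by (simp add: l2_norm_def L2_set_nonneg)

lemma l2_inner_self: "l2_inner v v = complex_of_real ((l2_norm v)\<^sup>2)"
proof -
  have "(l2_norm v)\<^sup>2 = (\<Sum>a\<in>{a. v a \<noteq> 0}. (cmod (v a))\<^sup>2)"
    by (simp add: l2_norm_def L2_set_def sum_nonneg)
  then show ?thesis by (simp only: l2_inner_def of_real_sum complex_norm_square mult.commute)
qed

lemma l2_cauchy_schwarz:
  assumes "finite {a. u a \<noteq> 0}" "finite {a. v a \<noteq> 0}"
  shows "cmod (l2_inner u v) \<le> l2_norm u * l2_norm v"
proof -
  let ?F = "{a. u a \<noteq> 0} \<union> {a. v a \<noteq> 0}"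
  have "cmod (l2_inner u v) \<le> (\<Sum>a\<in>?F. \<bar>cmod (u a)\<bar> * \<bar>cmod (v a)\<bar>)"
    using assms by (subst l2_inner_superset[of ?F]) (auto intro!: order_trans[OF norm_sum] simp: norm_mult)
  also have "\<dots> \<le> L2_set (\<lambda>a. cmod (u a)) ?F * L2_set (\<lambda>a. cmod (v a)) ?F" by (rule L2_set_mult_ineq)
  finally show ?thesis using assms by (simp add: l2_norm_superset[of ?F])
qed

lemma l2_norm_add:
  assumes "finite {a. u a \<noteq> 0}" "finite {a. v a \<noteq> 0}"
  shows "l2_norm (\<lambda>a. u a + v a) \<le> l2_norm u + l2_norm v"
proof -
  let ?F = "{a. u a \<noteq> 0} \<union> {a. v a \<noteq> 0}"
  have "l2_norm (\<lambda>a. u a + v a) = L2_set (\<lambda>a. cmod (u a + v a)) ?F"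
    using assms by (intro l2_norm_superset) auto
  also have "\<dots> \<le> L2_set (\<lambda>a. cmod (u a) + cmod (v a)) ?F"
    by (intro L2_set_mono norm_triangle_ineq) auto
  also have "\<dots> \<le> L2_set (\<lambda>a. cmod (u a)) ?F + L2_set (\<lambda>a. cmod (v a)) ?F" by (rule L2_set_triangle_ineq)
  finally show ?thesis using assms by (simp add: l2_norm_superset[of ?F])
qed

lemma l2_norm_scale: "l2_norm (\<lambda>a. c * v a) = cmod c * l2_norm v"
proof (cases "c = 0")
  case False
  then show ?thesis
    by (simp add: l2_norm_def norm_mult L2_set_def power_mult_distrib real_sqrt_mult flip: sum_distrib_left)
qed (simp add: l2_norm_def)

text \<open>
  Each generator acts on the points as a partial bijection between subsets of \<open>D\<close>.  The induced
  operators on finitely supported functions, together with their operator norm, give a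
  \<open>C\<^sup>*\<close>-seminorm on the free algebra.
\<close>
locale partial_bijections =
  fixes D :: "'x set" and fwd bwd :: "'g \<Rightarrow> 'x \<Rightarrow> 'x option"
  assumes inverse: "fwd g x = Some y \<longleftrightarrow> bwd g y = Some x"
    and domain: "fwd g x = Some y \<Longrightarrow> x \<in> D \<and> y \<in> D"
begin

text \<open>
  Operators act by composition with the inverse map, so a point is traced back through a word, beginning
  with the first letter.
\<close>
fun pull :: "('g \<times> bool) list \<Rightarrow> 'x \<Rightarrow> 'x option" where
  "pull [] a = Some a"
| "pull ((g, b) # w) a = Option.bind (if b then fwd g a else bwd g a) (pull w)"

lemma pull_append: "pull (u @ w) a = Option.bind (pull u a) (pull w)"
proof (induction u arbitrary: a)
  case (Cons l u)
  obtain g b where l: "l = (g, b)" by (cases l)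
  show ?case by (cases "if b then fwd g a else bwd g a") (simp_all add: l Cons)
qed simp

lemma pull_inverse: "pull w a = Some b \<longleftrightarrow> pull (rev (map (\<lambda>(g, c). (g, \<not> c)) w)) b = Some a"
  by (induction w arbitrary: a)
     (auto simp: pull_append bind_eq_Some_conv inverse split: if_splits)

lemma pull_domain: "pull w a = Some b \<Longrightarrow> a \<in> D \<longleftrightarrow> b \<in> D"
proof (induction w arbitrary: a)
  case (Cons l w)
  obtain g c where l: "l = (g, c)" by (cases l)
  obtain a' where a': "(if c then fwd g a else bwd g a) = Some a'" "pull w a' = Some b"
    using Cons.prems by (auto simp: l bind_eq_Some_conv)
  then have "a \<in> D \<and> a' \<in> D" using domain inverse by (metis (full_types))
  then show ?case using Cons.IH[OF a'(2)] by simp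
qed simp

primrec word_op :: "'g star_word \<Rightarrow> ('x \<Rightarrow> complex) \<Rightarrow> 'x \<Rightarrow> complex" where
  "word_op (Star_Word w) v = (\<lambda>a. case pull w a of None \<Rightarrow> 0 | Some b \<Rightarrow> v b)"

lemma word_op_plus: "word_op (u + w) v = word_op u (word_op w v)"
  by (cases u; cases w) (auto simp: fun_eq_iff pull_append split: option.splits)

lemma word_op_zero: "word_op 0 v = v"
  by (simp add: zero_star_word_def)

lemma word_op_add: "word_op w (\<lambda>a. u a + v a) = (\<lambda>a. word_op w u a + word_op w v a)"
  and word_op_scale: "word_op w (\<lambda>a. c * v a) = (\<lambda>a. c * word_op w v a)"
  by (cases w; auto simp: fun_eq_iff split: option.splits)+

definition vectors :: "('x \<Rightarrow> complex) set" where
  "vectors = {v. finite {a. v a \<noteq> 0} \<and> {a. v a \<noteq> 0} \<subseteq> D}"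

lemma vectors_finite: "v \<in> vectors \<Longrightarrow> finite {a. v a \<noteq> 0}"
  by (simp add: vectors_def)

lemma vectors_zero_outside: "v \<in> vectors \<Longrightarrow> a \<notin> D \<Longrightarrow> v a = 0"
  by (auto simp: vectors_def)

lemma vectors_add: "u \<in> vectors \<Longrightarrow> v \<in> vectors \<Longrightarrow> (\<lambda>a. u a + v a) \<in> vectors"
proof -
  assume uv: "u \<in> vectors" "v \<in> vectors"
  have sub: "{a. u a + v a \<noteq> 0} \<subseteq> {a. u a \<noteq> 0} \<union> {a. v a \<noteq> 0}" by auto
  show ?thesis
    using finite_subset[OF sub] sub uv unfolding vectors_def by blast
qed

lemma vectors_scale: "v \<in> vectors \<Longrightarrow> (\<lambda>a. c * v a) \<in> vectors"
proof -
  assume v: "v \<in> vectors"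
  have sub: "{a. c * v a \<noteq> 0} \<subseteq> {a. v a \<noteq> 0}" by auto
  show ?thesis
    using finite_subset[OF sub] sub v unfolding vectors_def by blast
qed

lemma word_op_support:
  "{a. word_op (Star_Word w) v a \<noteq> 0} = {a. \<exists>b. pull w a = Some b \<and> v b \<noteq> 0}"
  by (auto split: option.splits)

lemma pull_inj: "pull w a = Some b \<Longrightarrow> pull w a' = Some b \<Longrightarrow> a = a'"
  using pull_inverse by (metis option.inject)

lemma word_op_vectors:
  assumes "v \<in> vectors" shows "word_op w v \<in> vectors"
proof -
  obtain l where w: "w = Star_Word l" by (cases w)
  have "inj_on (\<lambda>a. the (pull l a)) {a. word_op w v a \<noteq> 0}"
    unfolding w word_op_support by (auto intro!: inj_onI dest: pull_inj)
  moreover have "(\<lambda>a. the (pull l a)) ` {a. word_op w v a \<noteq> 0} \<subseteq> {b. v b \<noteq> 0}"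
    unfolding w word_op_support by auto
  ultimately have "finite {a. word_op w v a \<noteq> 0}"
    using vectors_finite[OF assms] by (metis finite_imageD finite_subset)
  moreover have "{a. word_op w v a \<noteq> 0} \<subseteq> D"
    unfolding w word_op_support using pull_domain assms by (auto simp: vectors_def)
  ultimately show ?thesis by (simp add: vectors_def)
qed

lemma word_op_adjoint:
  assumes "u \<in> vectors"
  shows "l2_inner (word_op w u) v = l2_inner u (word_op (word_adj w) v)"
proof -
  obtain l where w: "w = Star_Word l" by (cases w)
  define l' where "l' = rev (map (\<lambda>(g, c). (g, \<not> c)) l)"
  have inv: "pull l a = Some b \<longleftrightarrow> pull l' b = Some a" for a b unfolding l'_def by (rule pull_inverse)
  have "l2_inner (word_op w u) v = (\<Sum>a\<in>{a. \<exists>b. pull l a = Some b \<and> u b \<noteq> 0}. cnj (word_op w u a) * v a)"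
    unfolding l2_inner_def w word_op_support by simp
  also have "\<dots> = (\<Sum>b\<in>{b. u b \<noteq> 0 \<and> (\<exists>a. pull l' b = Some a)}. cnj (u b) * word_op (word_adj w) v b)"
  proof (rule sum.reindex_bij_witness[where i = "\<lambda>b. the (pull l' b)" and j = "\<lambda>a. the (pull l a)"])
    fix a assume "a \<in> {a. \<exists>b. pull l a = Some b \<and> u b \<noteq> 0}"
    then obtain b where b: "pull l a = Some b" "u b \<noteq> 0" by blast
    have b': "pull l' b = Some a" using inv b(1) by blast
    show "the (pull l' (the (pull l a))) = a" "the (pull l a) \<in> {b. u b \<noteq> 0 \<and> (\<exists>a. pull l' b = Some a)}"
      using b b' by simp_all
    show "cnj (u (the (pull l a))) * word_op (word_adj w) v (the (pull l a)) = cnj (word_op w u a) * v a"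
      by (simp add: w b b' flip: l'_def)
  next
    fix b assume "b \<in> {b. u b \<noteq> 0 \<and> (\<exists>a. pull l' b = Some a)}"
    then obtain a where a: "pull l' b = Some a" "u b \<noteq> 0" by blast
    have a': "pull l a = Some b" using inv a(1) by blast
    show "the (pull l (the (pull l' b))) = b" "the (pull l' b) \<in> {a. \<exists>b. pull l a = Some b \<and> u b \<noteq> 0}"
      using a a' by simp_all
  qed
  also have "\<dots> = l2_inner u (word_op (word_adj w) v)"
    unfolding l2_inner_def using vectors_finite[OF assms]
    by (intro sum.mono_neutral_left) (auto simp: w l'_def[symmetric] split: option.splits)
  finally show ?thesis .
qed

lemma word_op_norm:
  assumes "v \<in> vectors" shows "l2_norm (word_op w v) \<le> l2_norm v"
proof -
  note v' = word_op_vectors[OF assms, of w]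
  have "(l2_norm (word_op w v))\<^sup>2 = cmod (l2_inner (word_op w v) (word_op w v))"
    by (simp add: l2_inner_self norm_power l2_norm_nonneg)
  also have "\<dots> = cmod (l2_inner v (word_op (word_adj w) (word_op w v)))"
    by (simp add: word_op_adjoint[OF assms])
  also have "l2_inner v (word_op (word_adj w) (word_op w v)) =
      (\<Sum>a\<in>{a. v a \<noteq> 0 \<and> word_op (word_adj w) (word_op w v) a \<noteq> 0}. cnj (v a) * v a)"
  proof -
    obtain l where w: "w = Star_Word l" by (cases w)
    have "word_op (word_adj w) (word_op w v) a = v a \<or> word_op (word_adj w) (word_op w v) a = 0" for a
      using pull_inverse[of l] by (auto simp: w split: option.splits dest: pull_inj)
    then show ?thesis
      unfolding l2_inner_def using vectors_finite[OF assms]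
      by (intro sum.mono_neutral_cong_right) auto
  qed
  also have "cmod \<dots> \<le>
      (\<Sum>a\<in>{a. v a \<noteq> 0 \<and> word_op (word_adj w) (word_op w v) a \<noteq> 0}. (cmod (v a))\<^sup>2)"
    by (rule order_trans[OF norm_sum]) (simp add: norm_mult power2_eq_square)
  also have "\<dots> \<le> (\<Sum>a\<in>{a. v a \<noteq> 0}. (cmod (v a))\<^sup>2)"
    by (rule sum_mono2) (use vectors_finite[OF assms] in auto)
  also have "\<dots> = (l2_norm v)\<^sup>2" by (simp add: l2_norm_def L2_set_def sum_nonneg)
  finally show ?thesis by (rule power2_le_imp_le) (rule l2_norm_nonneg)
qed

definition rep :: "'g free_star_algebra \<Rightarrow> ('x \<Rightarrow> complex) \<Rightarrow> 'x \<Rightarrow> complex" where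
  "rep x v = (\<lambda>a. \<Sum>w\<in>Poly_Mapping.keys x. Poly_Mapping.lookup x w * word_op w v a)"

lemma rep_superset:
  "finite K \<Longrightarrow> Poly_Mapping.keys x \<subseteq> K \<Longrightarrow> rep x v a = (\<Sum>w\<in>K. Poly_Mapping.lookup x w * word_op w v a)"
  unfolding rep_def by (intro sum.mono_neutral_left) (auto simp: in_keys_iff)

lemma rep_single: "rep (Poly_Mapping.single w c) v = (\<lambda>a. c * word_op w v a)"
  by (rule ext) (subst rep_superset[of "{w}"]; simp)

lemma rep_add: "rep (x + y) v = (\<lambda>a. rep x v a + rep y v a)"
proof
  fix a
  let ?K = "Poly_Mapping.keys x \<union> Poly_Mapping.keys y"
  show "rep (x + y) v a = rep x v a + rep y v a"
    using keys_add[of x y]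
    by (simp add: rep_superset[of ?K] lookup_add distrib_right sum.distrib)
qed

lemma rep_zero: "rep 0 v = (\<lambda>_. 0)"
  by (simp add: rep_def)

lemma rep_sum: "rep (\<Sum>i\<in>I. f i) v = (\<lambda>a. \<Sum>i\<in>I. rep (f i) v a)"
  by (induction I rule: infinite_finite_induct) (auto simp: rep_zero rep_add)

lemma rep_scale: "rep (free_scale c x) v = (\<lambda>a. c * rep x v a)"
  by (induction x rule: free_algebra_induct)
     (simp_all add: free_scale_eq_mult mult_single rep_single rep_add distrib_left mult.assoc)

lemma rep_diff: "rep (x - y) v = (\<lambda>a. rep x v a - rep y v a)"
  using rep_add[of x "free_scale (-1) y" v] by (simp add: rep_scale[of "-1", unfolded free_scale_minus_one] free_scale_minus_one)

lemma rep_one: "rep 1 v = v"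
  using rep_single[of 0 1 v] by (simp add: word_op_zero)

lemma rep_vector_scale: "rep x (\<lambda>a. c * v a) = (\<lambda>a. c * rep x v a)"
  by (simp add: rep_def word_op_scale sum_distrib_left mult.left_commute)

lemma rep_mult: "rep (x * y) v = rep x (rep y v)"
proof (induction x rule: free_algebra_induct)
  case (single w c)
  show ?case
    by (induction y rule: free_algebra_induct)
       (simp_all add: mult_single rep_single word_op_plus word_op_scale word_op_add rep_add distrib_left mult.assoc)
qed (simp add: distrib_right rep_add)

lemma rep_vectors: "v \<in> vectors \<Longrightarrow> rep x v \<in> vectors"
  by (induction x rule: free_algebra_induct)
     (simp_all add: rep_single rep_add vectors_add vectors_scale word_op_vectors)

lemma l2_inner_add_left:
  assumes "finite {a. u a \<noteq> 0}" "finite {a. v a \<noteq> 0}"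
  shows "l2_inner (\<lambda>a. u a + v a) z = l2_inner u z + l2_inner v z"
proof -
  let ?F = "{a. u a \<noteq> 0} \<union> {a. v a \<noteq> 0}"
  have "l2_inner (\<lambda>a. u a + v a) z = (\<Sum>a\<in>?F. cnj (u a + v a) * z a)"
    using assms by (intro l2_inner_superset) auto
  also have "\<dots> = (\<Sum>a\<in>?F. cnj (u a) * z a) + (\<Sum>a\<in>?F. cnj (v a) * z a)"
    by (simp add: distrib_right sum.distrib)
  also have "(\<Sum>a\<in>?F. cnj (u a) * z a) = l2_inner u z"
    using assms by (intro l2_inner_superset[symmetric]) auto
  also have "(\<Sum>a\<in>?F. cnj (v a) * z a) = l2_inner v z"
    using assms by (intro l2_inner_superset[symmetric]) auto
  finally show ?thesis .
qed

lemma l2_inner_scale_left: "l2_inner (\<lambda>a. c * u a) z = cnj c * l2_inner u z"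
  by (cases "c = 0") (simp_all add: l2_inner_def sum_distrib_left mult.assoc)

lemma l2_inner_add_right: "l2_inner u (\<lambda>a. v a + z a) = l2_inner u v + l2_inner u z"
  and l2_inner_scale_right: "l2_inner u (\<lambda>a. c * v a) = c * l2_inner u v"
  by (simp_all add: l2_inner_def distrib_left sum.distrib sum_distrib_left mult.left_commute)

lemma rep_adjoint: "u \<in> vectors \<Longrightarrow> l2_inner (rep x u) v = l2_inner u (rep (free_adj x) v)"
  by (induction x rule: free_algebra_induct)
     (simp_all add: rep_single rep_add free_adj_single free_adj_add l2_inner_scale_left l2_inner_scale_right
       l2_inner_add_left l2_inner_add_right word_op_adjoint vectors_finite rep_vectors)

definition rep_norm :: "'g free_star_algebra \<Rightarrow> real" where
  "rep_norm x = (SUP v\<in>{v \<in> vectors. l2_norm v \<le> 1}. l2_norm (rep x v))"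

lemma rep_bounded: "\<exists>M\<ge>0. \<forall>v\<in>vectors. l2_norm (rep x v) \<le> M * l2_norm v"
proof (induction x rule: free_algebra_induct)
  case (single w c)
  show ?case
    by (intro exI[of _ "cmod c"])
       (simp add: rep_single l2_norm_scale word_op_norm mult_left_mono)
next
  case (add x y)
  then obtain M N where M: "0 \<le> M" "\<And>v. v \<in> vectors \<Longrightarrow> l2_norm (rep x v) \<le> M * l2_norm v"
    and N: "0 \<le> N" "\<And>v. v \<in> vectors \<Longrightarrow> l2_norm (rep y v) \<le> N * l2_norm v" by blast
  have "l2_norm (rep (x + y) v) \<le> (M + N) * l2_norm v" if v: "v \<in> vectors" for v
    using l2_norm_add[of "rep x v" "rep y v"] M(2)[OF v] N(2)[OF v] v
    by (simp add: rep_add vectors_finite rep_vectors distrib_right)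
  then show ?case using M(1) N(1) by (intro exI[of _ "M + N"]) simp
qed

lemma vectors_null: "(\<lambda>_. 0) \<in> vectors"
  by (simp add: vectors_def)

lemma rep_norm_bdd: "bdd_above ((\<lambda>v. l2_norm (rep x v)) ` {v \<in> vectors. l2_norm v \<le> 1})"
proof -
  obtain M where M: "0 \<le> M" "\<And>v. v \<in> vectors \<Longrightarrow> l2_norm (rep x v) \<le> M * l2_norm v"
    using rep_bounded by blast
  then show ?thesis by (auto intro!: bdd_aboveI[of _ M] intro: order_trans[OF _ mult_left_le])
qed

lemma rep_norm_upper:
  assumes v: "v \<in> vectors" shows "l2_norm (rep x v) \<le> rep_norm x * l2_norm v"
proof -
  obtain M where M: "0 \<le> M" "\<And>v. v \<in> vectors \<Longrightarrow> l2_norm (rep x v) \<le> M * l2_norm v"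
    using rep_bounded by blast
  show ?thesis
  proof (cases "l2_norm v = 0")
    case True
    then show ?thesis using M(2)[OF v] by simp
  next
    case False
    define r where "r = l2_norm v"
    have r: "0 < r" using False l2_norm_nonneg[of v] by (simp add: r_def)
    define u where "u = (\<lambda>a. complex_of_real (1 / r) * v a)"
    have u: "u \<in> vectors" unfolding u_def by (rule vectors_scale[OF v])
    have u1: "l2_norm u \<le> 1"
      unfolding u_def l2_norm_scale using r by (simp add: norm_divide r_def[symmetric])
    have "l2_norm (rep x u) \<le> rep_norm x"
      unfolding rep_norm_def using u u1 by (intro cSUP_upper rep_norm_bdd) auto
    moreover have "l2_norm (rep x u) = l2_norm (rep x v) / r"
      using r unfolding u_def rep_vector_scale l2_norm_scale by (simp add: norm_divide)
    ultimately show ?thesis using r by (simp add: r_def field_simps)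
  qed
qed

lemma rep_norm_least:
  "0 \<le> M \<Longrightarrow> (\<And>v. v \<in> vectors \<Longrightarrow> l2_norm (rep x v) \<le> M * l2_norm v) \<Longrightarrow> rep_norm x \<le> M"
  unfolding rep_norm_def
proof (rule cSUP_least)
  show "{v \<in> vectors. l2_norm v \<le> 1} \<noteq> {}" using vectors_null by (auto simp: l2_norm_def)
  fix v assume "0 \<le> M" "\<And>v. v \<in> vectors \<Longrightarrow> l2_norm (rep x v) \<le> M * l2_norm v"
    "v \<in> {v \<in> vectors. l2_norm v \<le> 1}"
  then show "l2_norm (rep x v) \<le> M"
    by (auto intro: order_trans[OF _ mult_left_le])
qed

lemma rep_norm_nonneg: "0 \<le> rep_norm x"
proof -
  have "l2_norm (rep x (\<lambda>_. 0)) \<le> rep_norm x"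
    unfolding rep_norm_def using vectors_null by (intro cSUP_upper rep_norm_bdd) (auto simp: l2_norm_def)
  then show ?thesis using l2_norm_nonneg order_trans by blast
qed

lemma cstar_seminorm_rep_norm: "cstar_seminorm rep_norm"
proof -
  have add: "rep_norm (x + y) \<le> rep_norm x + rep_norm y" for x y
  proof (rule rep_norm_least)
    fix v assume v: "v \<in> vectors"
    show "l2_norm (rep (x + y) v) \<le> (rep_norm x + rep_norm y) * l2_norm v"
      using l2_norm_add[of "rep x v" "rep y v"] rep_norm_upper[OF v, of x] rep_norm_upper[OF v, of y] v
      by (simp add: rep_add vectors_finite rep_vectors distrib_right)
  qed (simp add: rep_norm_nonneg)
  have scale_le: "rep_norm (free_scale c x) \<le> cmod c * rep_norm x" for c x
    by (rule rep_norm_least)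
       (auto simp: rep_norm_nonneg rep_scale l2_norm_scale mult.assoc intro!: mult_left_mono rep_norm_upper)
  have scale: "rep_norm (free_scale c x) = cmod c * rep_norm x" for c x
  proof (cases "c = 0")
    case True
    then show ?thesis using scale_le[of c x] rep_norm_nonneg[of "free_scale c x"] by simp
  next
    case False
    have "rep_norm x \<le> cmod (1/c) * rep_norm (free_scale c x)"
      using scale_le[of "1/c" "free_scale c x"] False by (simp add: free_scale_scale)
    then have "cmod c * rep_norm x \<le> rep_norm (free_scale c x)"
      using False by (simp add: norm_divide field_simps)
    with scale_le[of c x] show ?thesis by simp
  qed
  have mult: "rep_norm (x * y) \<le> rep_norm x * rep_norm y" for x y
  proof (rule rep_norm_least)
    fix v assume v: "v \<in> vectors"
    have "l2_norm (rep (x * y) v) \<le> rep_norm x * l2_norm (rep y v)"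
      unfolding rep_mult by (rule rep_norm_upper[OF rep_vectors[OF v]])
    also have "\<dots> \<le> rep_norm x * (rep_norm y * l2_norm v)"
      by (intro mult_left_mono rep_norm_upper v rep_norm_nonneg)
    finally show "l2_norm (rep (x * y) v) \<le> rep_norm x * rep_norm y * l2_norm v" by (simp add: mult.assoc)
  qed (simp add: rep_norm_nonneg)
  have square: "(l2_norm (rep x v))\<^sup>2 \<le> l2_norm v * l2_norm (rep (free_adj x) (rep x v))"
    if v: "v \<in> vectors" for x v
  proof -
    have "(l2_norm (rep x v))\<^sup>2 = cmod (l2_inner (rep x v) (rep x v))"
      by (simp add: l2_inner_self norm_power l2_norm_nonneg)
    also have "\<dots> \<le> l2_norm v * l2_norm (rep (free_adj x) (rep x v))"
      unfolding rep_adjoint[OF v] using v by (intro l2_cauchy_schwarz vectors_finite rep_vectors)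
    finally show ?thesis .
  qed
  have adj: "rep_norm x \<le> rep_norm (free_adj x)" for x
  proof (rule rep_norm_least[OF rep_norm_nonneg])
    fix v assume v: "v \<in> vectors"
    have "(l2_norm (rep x v))\<^sup>2 \<le> l2_norm v * (rep_norm (free_adj x) * l2_norm (rep x v))"
      using square[OF v, of x] mult_left_mono[OF rep_norm_upper[OF rep_vectors[OF v]] l2_norm_nonneg]
      by (rule order_trans)
    then show "l2_norm (rep x v) \<le> rep_norm (free_adj x) * l2_norm v"
      using l2_norm_nonneg[of "rep x v"] l2_norm_nonneg[of v] rep_norm_nonneg[of "free_adj x"]
      by (cases "l2_norm (rep x v) = 0") (auto simp: power2_eq_square mult_ac)
  qed
  have cstar: "rep_norm (free_adj x * x) = (rep_norm x)\<^sup>2" for x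
  proof (rule antisym)
    have "rep_norm (free_adj x * x) \<le> rep_norm (free_adj x) * rep_norm x" by (rule mult)
    also have "\<dots> \<le> rep_norm x * rep_norm x"
      using adj[of "free_adj x"] by (intro mult_right_mono rep_norm_nonneg) simp
    finally show "rep_norm (free_adj x * x) \<le> (rep_norm x)\<^sup>2" by (simp add: power2_eq_square)
    have "rep_norm x \<le> sqrt (rep_norm (free_adj x * x))"
    proof (rule rep_norm_least)
      fix v assume v: "v \<in> vectors"
      have "(l2_norm (rep x v))\<^sup>2 \<le> l2_norm v * (rep_norm (free_adj x * x) * l2_norm v)"
        using square[OF v, of x] mult_left_mono[OF rep_norm_upper[OF v, of "free_adj x * x"] l2_norm_nonneg[of v]]
        by (simp add: rep_mult)
      then have "l2_norm (rep x v) \<le> sqrt (rep_norm (free_adj x * x) * (l2_norm v)\<^sup>2)"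
        by (intro real_le_rsqrt) (simp add: power2_eq_square mult_ac)
      then show "l2_norm (rep x v) \<le> sqrt (rep_norm (free_adj x * x)) * l2_norm v"
        by (simp add: real_sqrt_mult l2_norm_nonneg)
    qed (simp add: rep_norm_nonneg)
    then have "(rep_norm x)\<^sup>2 \<le> (sqrt (rep_norm (free_adj x * x)))\<^sup>2"
      by (intro power_mono rep_norm_nonneg)
    then show "(rep_norm x)\<^sup>2 \<le> rep_norm (free_adj x * x)" by (simp add: rep_norm_nonneg)
  qed
  show ?thesis unfolding cstar_seminorm_def using add scale mult cstar by blast
qed

lemma rep_norm_one: "D \<noteq> {} \<Longrightarrow> 1 \<le> rep_norm 1"
proof -
  assume "D \<noteq> {}"
  then obtain d where d: "d \<in> D" by blast
  define v where "v a = (if a = d then 1 else 0 :: complex)" for a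
  have s: "{a. v a \<noteq> 0} = {d}" by (auto simp: v_def)
  have "v \<in> vectors" "l2_norm v = 1" using d by (simp_all add: vectors_def s l2_norm_def L2_set_def) (simp add: v_def)
  then show ?thesis using rep_norm_upper[of v 1] by (simp add: rep_one)
qed

lemma rep_norm_relation:
  assumes "\<And>v a. v \<in> vectors \<Longrightarrow> a \<in> D \<Longrightarrow> rep x v a = rep y v a"
  shows "rep_norm (x - y) = 0"
proof (rule antisym[OF rep_norm_least rep_norm_nonneg])
  fix v assume v: "v \<in> vectors"
  have "rep (x - y) v a = 0" for a
    using assms[OF v, of a] vectors_zero_outside[OF rep_vectors[OF v], of a] by (cases "a \<in> D") (auto simp: rep_diff)
  then show "l2_norm (rep (x - y) v) \<le> 0 * l2_norm v" by (simp add: l2_norm_def)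
qed simp

lemma rep_gen: "rep (free_gen g) v a = (case bwd g a of None \<Rightarrow> 0 | Some b \<Rightarrow> v b)"
  by (simp add: free_gen_def rep_single split: option.splits)

lemma rep_gen_adj: "rep (free_adj (free_gen g)) v a = (case fwd g a of None \<Rightarrow> 0 | Some b \<Rightarrow> v b)"
  by (simp add: free_gen_def free_adj_single rep_single split: option.splits)

end

section \<open>The representation on synchronizing rays\<close>

lemma map_upt_split: "k \<le> k' \<Longrightarrow> map x [0..<k'] = map x [0..<k] @ map x [k..<k']" for k k' :: nat
  using upt_add_eq_append[of 0 k "k' - k"] by simp

lemma map_case_nat_upt: "map (case_nat a x) [0..<Suc k] = a # map x [0..<k]"
  "map (case_nat a x) [Suc i..<Suc k] = map x [i..<k]"
proof -
  show *: "map (case_nat a x) [Suc i..<Suc k] = map x [i..<k]" for i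
    by (simp add: map_Suc_upt[symmetric] comp_def del: map_Suc_upt upt_Suc)
  show "map (case_nat a x) [0..<Suc k] = a # map x [0..<k]"
    using *[of 0] by (simp add: upt_conv_Cons del: upt_Suc)
qed

lemma case_nat_tail: "x 0 = a \<Longrightarrow> case_nat a (x \<circ> Suc) = x"
  by (auto simp: fun_eq_iff split: nat.splits)

lemma sync_rays_words: "x \<in> sync_rays \<Lambda> \<Longrightarrow> map x [0..<k] \<in> words \<Lambda>"
  by (simp add: sync_rays_def)

lemma sync_rays_sync: "x \<in> sync_rays \<Lambda> \<Longrightarrow> \<exists>k. map x [i..<k] \<in> synchronizing_words \<Lambda> l"
  by (simp add: sync_rays_def)

lemma sync_rays_tail:
  assumes x: "x \<in> sync_rays \<Lambda>" shows "x \<circ> Suc \<in> sync_rays \<Lambda>"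
proof -
  have seg: "map (x \<circ> Suc) [i..<k] = map x [Suc i..<Suc k]" for i k
    by (simp add: map_Suc_upt[symmetric] del: map_Suc_upt upt_Suc)
  have "map (x \<circ> Suc) [0..<k] \<in> words \<Lambda>" for k
    using words_append_right[of "[x 0]" "map x [1..<Suc k]"] sync_rays_words[OF x, of "Suc k"]
    by (simp add: seg upt_conv_Cons del: upt_Suc)
  moreover have "\<exists>k. map (x \<circ> Suc) [i..<k] \<in> synchronizing_words \<Lambda> l" for i l
  proof -
    obtain k where "map x [Suc i..<k] \<in> synchronizing_words \<Lambda> l" using sync_rays_sync[OF x] by blast
    moreover have "map x [Suc i..<k] = map (x \<circ> Suc) [i..<k - 1]"
      unfolding seg by (cases k) auto
    ultimately show ?thesis by metis
  qed
  ultimately show ?thesis by (simp add: sync_rays_def)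
qed

lemma sync_prefix_extend:
  assumes x: "x \<in> sync_rays \<Lambda>" and k: "map x [0..<k] \<in> synchronizing_words \<Lambda> l" "k \<le> k'"
  shows "map x [0..<k'] \<in> synchronizing_words \<Lambda> l"
    and "predecessors \<Lambda> l (map x [0..<k']) = predecessors \<Lambda> l (map x [0..<k])"
  using synchronizing_words_extend[OF k(1), of "map x [k..<k']"] sync_rays_words[OF x, of k']
  by (simp_all add: map_upt_split[OF k(2)])

lemma ray_in_vertex:
  assumes x: "x \<in> sync_rays \<Lambda>" and k: "map x [0..<k] \<in> synchronizing_words \<Lambda> l"
    and v: "v \<in> vertices \<Lambda> l"
  shows "(\<exists>k. map x [0..<k] \<in> v) \<longleftrightarrow> past_class \<Lambda> l (map x [0..<k]) = v"
proof
  assume "\<exists>k. map x [0..<k] \<in> v"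
  then obtain k' where k': "map x [0..<k'] \<in> synchronizing_words \<Lambda> l" "past_class \<Lambda> l (map x [0..<k']) = v"
    using mem_vertex[OF v] by blast
  have "predecessors \<Lambda> l (map x [0..<k]) = predecessors \<Lambda> l (map x [0..<k'])"
    using sync_prefix_extend(2)[OF x k] sync_prefix_extend(2)[OF x k'(1)] by (metis nat_le_linear)
  then show "past_class \<Lambda> l (map x [0..<k]) = v" using past_class_eq_iff[OF k k'(1)] k'(2) by simp
next
  assume "past_class \<Lambda> l (map x [0..<k]) = v"
  then show "\<exists>k. map x [0..<k] \<in> v" using mem_vertex[OF v] k by blast
qed

text \<open>
  Whether a letter may precede a ray is decided by any prefix that is synchronizing at a positive level.
\<close>
lemma ray_Cons:
  assumes x: "x \<in> sync_rays \<Lambda>" and k: "map x [0..<k] \<in> synchronizing_words \<Lambda> (Suc l)"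
  shows "case_nat a x \<in> sync_rays \<Lambda> \<longleftrightarrow> a # map x [0..<k] \<in> words \<Lambda>"
proof
  assume "case_nat a x \<in> sync_rays \<Lambda>"
  then show "a # map x [0..<k] \<in> words \<Lambda>" using sync_rays_words map_case_nat_upt(1) by metis
next
  assume w: "a # map x [0..<k] \<in> words \<Lambda>"
  have aw: "a # map x [0..<m] \<in> words \<Lambda>" for m
  proof (cases "m \<le> k")
    case True
    then show ?thesis
      using w words_append_left[of "a # map x [0..<m]" "map x [m..<k]" \<Lambda>] map_upt_split[of m k x] by simp
  next
    case False
    then have p: "predecessors \<Lambda> (Suc l) (map x [0..<m]) = predecessors \<Lambda> (Suc l) (map x [0..<k])"
      by (intro sync_prefix_extend(2)[OF x k]) simp
    show ?thesis using predecessors_eq_Cons(1)[OF p, of a] w by blast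
  qed
  have "map (case_nat a x) [0..<m] \<in> words \<Lambda>" for m
    using aw map_case_nat_upt(1)[of a x] Nil_in_words[OF w] by (cases m) (auto simp del: upt_Suc)
  moreover have "\<exists>m. map (case_nat a x) [i..<m] \<in> synchronizing_words \<Lambda> l'" for i l'
  proof (cases i)
    case 0
    obtain m where "map x [0..<m] \<in> synchronizing_words \<Lambda> (Suc l')" using sync_rays_sync[OF x] by blast
    then have "map (case_nat a x) [0..<Suc m] \<in> synchronizing_words \<Lambda> l'"
      unfolding map_case_nat_upt(1) by (rule synchronizing_words_Cons'[OF _ aw])
    then show ?thesis using 0 by blast
  next
    case (Suc i')
    obtain m where "map x [i'..<m] \<in> synchronizing_words \<Lambda> l'" using sync_rays_sync[OF x] by blast
    then have "map (case_nat a x) [Suc i'..<Suc m] \<in> synchronizing_words \<Lambda> l'"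
      by (simp only: map_case_nat_upt(2))
    then show ?thesis using Suc by blast
  qed
  ultimately show "case_nat a x \<in> sync_rays \<Lambda>" by (simp add: sync_rays_def)
qed

definition ray_fwd :: "(int \<Rightarrow> 'a) set \<Rightarrow> 'a lambda_gen \<Rightarrow> (nat \<Rightarrow> 'a) \<Rightarrow> (nat \<Rightarrow> 'a) option" where
  "ray_fwd \<Lambda> g x = (case g of
     Partial_Isometry a \<Rightarrow> if x \<in> sync_rays \<Lambda> \<and> case_nat a x \<in> sync_rays \<Lambda> then Some (case_nat a x) else None
   | Vertex_Projection l v \<Rightarrow>
       if x \<in> sync_rays \<Lambda> \<and> v \<in> vertices \<Lambda> l \<and> (\<exists>k. map x [0..<k] \<in> v) then Some x else None)"

definition ray_bwd :: "(int \<Rightarrow> 'a) set \<Rightarrow> 'a lambda_gen \<Rightarrow> (nat \<Rightarrow> 'a) \<Rightarrow> (nat \<Rightarrow> 'a) option" where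
  "ray_bwd \<Lambda> g x = (case g of
     Partial_Isometry a \<Rightarrow> if x \<in> sync_rays \<Lambda> \<and> x 0 = a then Some (x \<circ> Suc) else None
   | Vertex_Projection l v \<Rightarrow>
       if x \<in> sync_rays \<Lambda> \<and> v \<in> vertices \<Lambda> l \<and> (\<exists>k. map x [0..<k] \<in> v) then Some x else None)"

lemma partial_bijections_rays: "partial_bijections (sync_rays \<Lambda>) (ray_fwd \<Lambda>) (ray_bwd \<Lambda>)"
proof
  fix g x y
  show "ray_fwd \<Lambda> g x = Some y \<longleftrightarrow> ray_bwd \<Lambda> g y = Some x"
  proof (cases g)
    case (Partial_Isometry a)
    have "ray_fwd \<Lambda> g x = Some y \<longleftrightarrow> x \<in> sync_rays \<Lambda> \<and> y \<in> sync_rays \<Lambda> \<and> case_nat a x = y"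
      by (auto simp: ray_fwd_def Partial_Isometry)
    moreover have "ray_bwd \<Lambda> g y = Some x \<longleftrightarrow> y \<in> sync_rays \<Lambda> \<and> y 0 = a \<and> y \<circ> Suc = x"
      by (auto simp: ray_bwd_def Partial_Isometry)
    moreover have "case_nat a x = y \<longleftrightarrow> y 0 = a \<and> y \<circ> Suc = x"
      by (auto simp: fun_eq_iff split: nat.splits)
    ultimately show ?thesis using sync_rays_tail[of y \<Lambda>] by blast
  qed (auto simp: ray_fwd_def ray_bwd_def)
  assume "ray_fwd \<Lambda> g x = Some y"
  then show "x \<in> sync_rays \<Lambda> \<and> y \<in> sync_rays \<Lambda>"
    by (cases g) (auto simp: ray_fwd_def split: if_splits)
qed

text \<open>
  \<open>S\<^sub>\<alpha>\<close> adds the letter \<open>\<alpha>\<close> at the front of a ray, and the projection of a vertex cuts down to the rays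
  with a prefix in this vertex.  A ray determines exactly one vertex of each level, by \<open>ray_in_vertex\<close>,
  and this turns the sums over vertices into a single term.
\<close>
lemma ray_seminorm_admissible:
  fixes \<Lambda> :: "(int \<Rightarrow> 'a::finite) set"
  shows "partial_bijections.rep_norm (sync_rays \<Lambda>) (ray_fwd \<Lambda>) (ray_bwd \<Lambda>) \<in>
    admissible_seminorms (lambda_relations \<Lambda>)"
proof -
  interpret partial_bijections "sync_rays \<Lambda>" "ray_fwd \<Lambda>" "ray_bwd \<Lambda>" by (rule partial_bijections_rays)
  let ?D = "sync_rays \<Lambda>"
  have S: "rep (S_gen \<alpha>) v a = (if a 0 = \<alpha> then v (a \<circ> Suc) else 0)" if "a \<in> ?D" for \<alpha> v a
    using that by (simp add: rep_gen ray_bwd_def)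
  have S': "rep (free_adj (S_gen \<alpha>)) v a = (if case_nat \<alpha> a \<in> ?D then v (case_nat \<alpha> a) else 0)"
    if "a \<in> ?D" for \<alpha> v a
    using that by (simp add: rep_gen_adj ray_fwd_def)
  have SS: "rep (S_gen \<alpha>) (rep (free_adj (S_gen \<alpha>)) v) a = (if a 0 = \<alpha> then v a else 0)" if "a \<in> ?D" for \<alpha> v a
    using that by (simp add: S S' sync_rays_tail case_nat_tail)
  have E: "rep (E_gen l u) v a = (if past_class \<Lambda> l (map a [0..<k]) = u then v a else 0)"
    if "a \<in> ?D" "map a [0..<k] \<in> synchronizing_words \<Lambda> l" "u \<in> vertices \<Lambda> l" for l u v a k
    using that ray_in_vertex[OF that] by (simp add: rep_gen ray_bwd_def)
  have "rep_norm (x - y) = 0" if "(x, y) \<in> lambda_relations \<Lambda>" for x y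
  proof (rule rep_norm_relation)
    fix v a assume v: "v \<in> vectors" and a: "a \<in> ?D"
    have pick: "(\<Sum>w\<in>vertices \<Lambda> l. c w * (if past_class \<Lambda> l (map a [0..<k]) = w then v a else 0)) =
        c (past_class \<Lambda> l (map a [0..<k])) * v a"
      if "map a [0..<k] \<in> synchronizing_words \<Lambda> l" for c :: "'a list set \<Rightarrow> complex" and l k
    proof -
      have "(\<Sum>w\<in>vertices \<Lambda> l. c w * (if past_class \<Lambda> l (map a [0..<k]) = w then v a else 0)) =
          (\<Sum>w\<in>vertices \<Lambda> l. if past_class \<Lambda> l (map a [0..<k]) = w then c w * v a else 0)"
        by (intro sum.cong) auto
      then show ?thesis
        using past_class_in_vertices[OF that] by (simp add: sum.delta' finite_vertices)
    qed
    show "rep x v a = rep y v a"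
      using that
    proof cases
      case (partial_isometry \<alpha>)
      then show ?thesis using a by (simp add: rep_mult SS) (simp add: S)
    next
      case (projection_adj u l)
      then show ?thesis using a by (simp add: rep_gen rep_gen_adj ray_fwd_def ray_bwd_def)
    next
      case (projection_idem u l)
      then show ?thesis using a by (simp add: rep_mult rep_gen ray_bwd_def)
    next
      case (no_vertex u l)
      then show ?thesis using a by (simp add: rep_zero rep_gen ray_bwd_def)
    next
      case sum_ranges
      then show ?thesis using a by (simp add: rep_sum rep_mult SS rep_one sum.delta')
    next
      case (sum_vertices l)
      obtain k where k: "map a [0..<k] \<in> synchronizing_words \<Lambda> l" using sync_rays_sync[OF a] by blast
      have "rep x v a = (\<Sum>w\<in>vertices \<Lambda> l. 1 * (if past_class \<Lambda> l (map a [0..<k]) = w then v a else 0))"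
        unfolding sum_vertices(1) rep_sum by (intro sum.cong refl) (simp add: E[OF a k])
      then show ?thesis unfolding pick[OF k] by (simp add: sum_vertices(2) rep_one)
    next
      case (refine u l)
      obtain k where k: "map a [0..<k] \<in> synchronizing_words \<Lambda> (Suc l)" using sync_rays_sync[OF a] by blast
      have k': "map a [0..<k] \<in> synchronizing_words \<Lambda> l" using k synchronizing_words_antimono by blast
      have "rep y v a = (\<Sum>w\<in>vertices \<Lambda> (Suc l). I_entry \<Lambda> l u w *
          (if past_class \<Lambda> (Suc l) (map a [0..<k]) = w then v a else 0))"
        unfolding refine(2) rep_sum rep_scale by (intro sum.cong refl) (simp add: E[OF a k])
      then show ?thesis
        unfolding pick[OF k] using refine(3) by (simp add: refine(1) E[OF a k'] I_entry_def iota_past_class[OF k])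
    next
      case (commute u l \<alpha>)
      obtain k where k: "map a [0..<k] \<in> synchronizing_words \<Lambda> l" using sync_rays_sync[OF a] by blast
      show ?thesis using a commute(3) by (simp add: commute(1,2) rep_mult SS E[OF a k])
    next
      case (edges u l \<alpha>)
      obtain k where k: "map a [0..<k] \<in> synchronizing_words \<Lambda> (Suc l)" using sync_rays_sync[OF a] by blast
      let ?\<kappa> = "map a [0..<k]"
      have "rep y v a = (\<Sum>w\<in>vertices \<Lambda> (Suc l). A_entry \<Lambda> l u \<alpha> w *
          (if past_class \<Lambda> (Suc l) ?\<kappa> = w then v a else 0))"
        unfolding edges(2) rep_sum rep_scale by (intro sum.cong refl) (simp add: E[OF a k])
      also have "\<dots> = (if \<alpha> # ?\<kappa> \<in> words \<Lambda> \<and> past_class \<Lambda> l (\<alpha> # ?\<kappa>) = u then v a else 0)"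
        unfolding pick[OF k] by (simp add: A_entry_def labeled_edge_past_class[OF k])
      also have "\<dots> = rep x v a"
      proof (cases "\<alpha> # ?\<kappa> \<in> words \<Lambda>")
        case True
        let ?b = "case_nat \<alpha> a"
        have b: "?b \<in> ?D" using ray_Cons[OF a k] True by simp
        have "map ?b [0..<Suc k] \<in> synchronizing_words \<Lambda> l"
          unfolding map_case_nat_upt(1) by (rule synchronizing_words_Cons'[OF k True])
        then have "rep (E_gen l u) z ?b = (if past_class \<Lambda> l (\<alpha> # ?\<kappa>) = u then z ?b else 0)" for z
          using E[OF b _ edges(3), of "Suc k"] by (simp only: map_case_nat_upt(1))
        moreover have "?b \<circ> Suc = a" by (simp add: fun_eq_iff)
        ultimately show ?thesis using True b a by (simp add: edges(1) rep_mult S S')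
      next
        case False
        then have "case_nat \<alpha> a \<notin> ?D" using ray_Cons[OF a k] by simp
        then show ?thesis using a False by (simp add: edges(1) rep_mult S')
      qed
      finally show ?thesis by simp
    qed
  qed
  then show ?thesis by (auto simp: admissible_seminorms_def cstar_seminorm_rep_norm)
qed

lemma O_lambda_nonzero:
  fixes \<Lambda> :: "(int \<Rightarrow> 'a::finite) set"
  assumes "lambda_synchronizing \<Lambda>" "[] \<in> words \<Lambda>"
  shows "\<one>\<^bsub>O_lambda \<Lambda>\<^esub> \<noteq> \<zero>\<^bsub>O_lambda \<Lambda>\<^esub>"
proof
  assume eq: "\<one>\<^bsub>O_lambda \<Lambda>\<^esub> = \<zero>\<^bsub>O_lambda \<Lambda>\<^esub>"
  let ?q = "universal_seminorm (lambda_relations \<Lambda>)"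
  have q: "cstar_seminorm ?q" by (rule cstar_seminorm_universal[OF lambda_gens_bounded])
  have "cnorm (O_lambda \<Lambda>) \<one>\<^bsub>O_lambda \<Lambda>\<^esub> = ?q 1"
    unfolding O_lambda_def universal_cstar_algebra_def one_completion[OF q] by (rule cnorm_const[OF q])
  moreover have "cnorm (O_lambda \<Lambda>) \<zero>\<^bsub>O_lambda \<Lambda>\<^esub> = 0"
    by (rule unital_cstar_algebra.cnorm_zero[OF unital_cstar_algebra_O_lambda])
  moreover have "1 \<le> ?q 1"
    using partial_bijections.rep_norm_one[OF partial_bijections_rays sync_rays_nonempty[OF assms]]
      universal_seminorm_upper[OF lambda_gens_bounded ray_seminorm_admissible, of \<Lambda> 1] by (rule order_trans)
  ultimately show False using eq by simp
qed

section \<open>Simplicity\<close>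

lemma polynomials_in_graded_span:
  fixes \<Lambda> :: "(int \<Rightarrow> 'a::finite) set"
  defines "q \<equiv> universal_seminorm (lambda_relations \<Lambda>)"
  defines "gr \<equiv> lambda_family_algebra.graded_span (O_lambda \<Lambda>) \<Lambda> (\<lambda>\<alpha>. O_gen \<Lambda> (Partial_Isometry \<alpha>))
    (\<lambda>l v. O_gen \<Lambda> (Vertex_Projection l v))"
  shows "\<exists>N. limit_class q (\<lambda>_. x) \<in> gr N"
proof -
  interpret O: unital_cstar_algebra "O_lambda \<Lambda>" by (rule unital_cstar_algebra_O_lambda)
  interpret O: lambda_family_algebra "O_lambda \<Lambda>" \<Lambda> "\<lambda>\<alpha>. O_gen \<Lambda> (Partial_Isometry \<alpha>)"
      "\<lambda>l v. O_gen \<Lambda> (Vertex_Projection l v)"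
    by unfold_locales (rule lambda_family_O_lambda)
  let ?O = "O_lambda \<Lambda>"
  have q: "cstar_seminorm q" unfolding q_def by (rule cstar_seminorm_universal[OF lambda_gens_bounded])
  have O: "?O = cstar_completion q" by (simp add: O_lambda_def universal_cstar_algebra_def q_def)
  define j where "j x = limit_class q (\<lambda>_. x)" for x
  have j: "j (x * y) = j x \<otimes>\<^bsub>?O\<^esub> j y" "j (x + y) = j x \<oplus>\<^bsub>?O\<^esub> j y"
    "j 1 = \<one>\<^bsub>?O\<^esub>" "j 0 = \<zero>\<^bsub>?O\<^esub>"
    "j (free_scale c x) = c \<odot>\<^bsub>?O\<^esub> j x" "j (free_adj x) = cadj ?O (j x)" for x y c
    unfolding O j_def by (simp_all add: completion_ops[OF q] cauchy_seqs_const[OF q])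
  have homogeneous: "\<exists>N. x \<in> gr N" if "x \<in> O.graded k" for x k
    unfolding gr_def using O.graded_span.homogeneous[OF that, of "nat \<bar>k\<bar>"] by auto
  have gen: "\<exists>N. j (free_gen g) \<in> gr N" for g
  proof (cases g)
    case (Partial_Isometry \<alpha>)
    then show ?thesis
      using homogeneous[OF O.S_graded[of \<alpha>]] by (simp add: j_def O_gen_def q_def)
  next
    case (Vertex_Projection l v)
    show ?thesis
    proof (cases "v \<in> vertices \<Lambda> l")
      case True
      then show ?thesis
        using homogeneous[OF O.diag_graded[OF O.diag_E[OF True]]] Vertex_Projection
        by (simp add: j_def O_gen_def q_def)
    next
      case False
      have "q (E_gen l v - 0) = 0"
        unfolding q_def
        by (rule universal_seminorm_relation[OF lambda_gens_bounded lambda_relations.no_vertex[OF False]])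
      then have "j (E_gen l v) = \<zero>\<^bsub>?O\<^esub>"
        unfolding j(4)[symmetric] unfolding j_def
        by (subst limit_class_eq_iff[OF q cauchy_seqs_const[OF q] cauchy_seqs_const[OF q]]) simp
      then show ?thesis
        using homogeneous[OF O.graded_zero] by (simp add: Vertex_Projection)
    qed
  qed
  have mult: "\<exists>N. x \<otimes>\<^bsub>?O\<^esub> y \<in> gr N" if "\<exists>M. x \<in> gr M" "\<exists>N. y \<in> gr N" for x y
    using that O.graded_span_mult unfolding gr_def by blast
  have letter: "\<exists>N. j (Poly_Mapping.single (Star_Word [(g, b)]) 1) \<in> gr N" for g b
  proof (cases b)
    case True
    have "Poly_Mapping.single (Star_Word [(g, b)]) 1 = free_adj (free_gen g)"
      by (simp add: free_gen_def free_adj_single True)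
    then show ?thesis using gen[of g] O.graded_span_cadj unfolding gr_def by (auto simp: j)
  next
    case False
    then show ?thesis using gen[of g] by (simp add: free_gen_def)
  qed
  have word: "\<exists>N. j (Poly_Mapping.single (Star_Word w) 1) \<in> gr N" for w
  proof (induction w)
    case Nil
    then show ?case
      using homogeneous[OF O.diag_graded[OF O.diag_one]] j(3) by (simp add: zero_star_word_def[symmetric])
  next
    case (Cons a w)
    have "Poly_Mapping.single (Star_Word (a # w)) (1 :: complex) =
        Poly_Mapping.single (Star_Word [a]) 1 * Poly_Mapping.single (Star_Word w) 1"
      by (simp add: mult_single)
    then show ?case using mult[OF letter[of "fst a" "snd a"] Cons] by (simp add: j)
  qed
  have "\<exists>N. j x \<in> gr N"
  proof (induction x rule: free_algebra_induct)
    case (single w c)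
    have "Poly_Mapping.single w c = free_scale c (Poly_Mapping.single w 1)"
      by (simp add: free_scale_eq_mult mult_single)
    then show ?case
      using word O.graded_span_smult unfolding gr_def by (cases w) (metis j(5))
  next
    case (add x y)
    then obtain M N where "j x \<in> gr M" "j y \<in> gr N" by blast
    then have "j x \<in> gr (max M N)" "j y \<in> gr (max M N)"
      unfolding gr_def by (auto intro: O.graded_span_mono)
    then show ?case unfolding j(2) gr_def by (auto intro: O.graded_span.add)
  qed
  then show ?thesis by (simp add: j_def)
qed

theorem theorem3p7:
  fixes \<Lambda> :: "(int \<Rightarrow> 'a::finite) set"
  assumes "subshift \<Lambda>"
    and "lambda_synchronizing \<Lambda>"
    and "subtopology full_shift \<Lambda> homeomorphic_space cantor_space"
    and "synchronizingly_transitive \<Lambda>"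
  shows "simple_cstar_algebra (O_lambda \<Lambda>)"
proof -
  interpret O: unital_cstar_algebra "O_lambda \<Lambda>" by (rule unital_cstar_algebra_O_lambda)
  interpret O: lambda_family_algebra "O_lambda \<Lambda>" \<Lambda> "\<lambda>\<alpha>. O_gen \<Lambda> (Partial_Isometry \<alpha>)"
      "\<lambda>l v. O_gen \<Lambda> (Vertex_Projection l v)"
    by unfold_locales (rule lambda_family_O_lambda)
  obtain a b where ab: "a \<noteq> b" "[a] \<in> words \<Lambda>" "[b] \<in> words \<Lambda>" using two_letters[OF assms(3)] by blast
  let ?O = "O_lambda \<Lambda>"
  have "\<one>\<^bsub>?O\<^esub> \<noteq> \<zero>\<^bsub>?O\<^esub>"
    by (rule O_lambda_nonzero[OF assms(2) Nil_in_words[OF ab(2)]])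
  then have "carrier ?O \<noteq> {\<zero>\<^bsub>?O\<^esub>}" using O.one_closed by blast
  moreover have "J = {\<zero>\<^bsub>?O\<^esub>} \<or> J = carrier ?O"
    if "ideal J ?O" "closed_in_norm ?O J" for J
  proof (rule O.closed_ideal_trivial[OF that assms(4) ab])
    fix X and e :: real assume X: "X \<in> carrier ?O" and e: "0 < e"
    let ?q = "universal_seminorm (lambda_relations \<Lambda>)"
    have "\<exists>f. (\<lambda>k. cnorm ?O (X \<ominus>\<^bsub>?O\<^esub> limit_class ?q (\<lambda>_. f k))) \<longlonglongrightarrow> 0"
      using completion_const_dense[OF cstar_seminorm_universal[OF lambda_gens_bounded], of X \<Lambda>] X
      by (simp add: O_lambda_def universal_cstar_algebra_def)
    then obtain f where "(\<lambda>k. cnorm ?O (X \<ominus>\<^bsub>?O\<^esub> limit_class ?q (\<lambda>_. f k))) \<longlonglongrightarrow> 0"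
      by blast
    then obtain k where "cnorm ?O (X \<ominus>\<^bsub>?O\<^esub> limit_class ?q (\<lambda>_. f k)) < e"
      using order_tendstoD(2)[OF _ e] eventually_sequentially by (metis (no_types, lifting) order_refl)
    then show "\<exists>N. \<exists>y\<in>O.graded_span N. cnorm ?O (X \<ominus>\<^bsub>?O\<^esub> y) < e"
      using polynomials_in_graded_span[of \<Lambda> "f k"] by blast
  qed
  ultimately show ?thesis
    unfolding simple_cstar_algebra_def using unital_cstar_algebra_O_lambda by blast
qed

end
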